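(* Let $B$ be a Hopf algebra over $k$ with bijective antipode $S$, and let $\star$ denote the product of the Heisenberg double $\mathcal H(B^* )$, regarded as a product on the vector space $B^*\otimes B$ underlying also the Drinfeld double $\mathcal D(B)$ (identifying $\mu\# m$ with $\mu\otimes m$). Let $\eta:\mathcal D(B)\otimes\mathcal D(B)\to k$ be $\eta(\mu\otimes m,\nu\otimes n)=\langle\mu,1\rangle\langle\nu,m\rangle\langle\varepsilon,n\rangle$ and let $\mathsf s(M)=\eta(M',M'')\,S_{\mathcal D(B)}(M''')$ for $M\in\mathcal D(B)$, where $S_{\mathcal D(B)}$ is the antipode of $\mathcal D(B)$; explicitly, $$\mathsf s(\mu\otimes m)=(\varepsilon\# S(m))\star({S^*}^{-1}(\mu)\#1)=(S(m'')\rightharpoonup{S^*}^{-1}(\mu))\# S(m').$$ Then the $\mathcal D(B)$-action on $\mathcal H(B^* )$ given by $$(\mu\otimes m)\triangleright(\beta\# b)=\mu'''(m'\rightharpoonup\beta)\,{S^*}^{-1}(\mu'')\ \#\ \bigl((m''\,b\,S(m'''))\leftharpoonup {S^*}^{-1}(\mu')\bigr)$$ can be written as $$M\triangleright A=M'\star A\star\mathsf s(M''),\qquad M\in\mathcal D(B),\ A\in\mathcal H(B^* ),$$ that is, $(\mu\otimes m)\triangleright(\alpha\# a)=(\mu''\# m')\star(\alpha\# a)\star\mathsf s(\mu'\otimes m'')$ for all $\mu,\alpha\in B^*$, $m,a\in B$.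
   Context: Notation. Primes denote Sweedler components of the coproduct. $k$ is the ground field. $\langle\ ,\ \rangle$ is evaluation; $B^*$ is the dual Hopf algebra of $B$, with product $\langle\alpha\beta,b\rangle=\langle\alpha,b'\rangle\langle\beta,b''\rangle$, coproduct $\beta\mapsto\beta'\otimes\beta''$ with $\langle\beta',a\rangle\langle\beta'',b\rangle=\langle\beta,ab\rangle$, unit $\varepsilon$ (the counit of $B$), and antipode $S^*$. Regular actions: $b\rightharpoonup\beta=\langle\beta'',b\rangle\beta'$, $\ \beta\leftharpoonup m=\langle\beta',m\rangle\beta''$, $\ b\leftharpoonup\mu=\langle\mu,b'\rangle b''$ ($b,m\in B$, $\beta,\mu\in B^*$). Heisenberg double: $\mathcal H(B^* )=B^*\# B$ is the vector space $B^*\otimes B$ with product $(\alpha\# a)\star(\beta\# b)=\alpha(a'\rightharpoonup\beta)\# a''b$. Drinfeld double: $\mathcal D(B)$ is the vector space $B^*\otimes B$ with product $(\mu\otimes m)(\nu\otimes n)=\mu(m'\rightharpoonup\nu\leftharpoonup S^{-1}(m'''))\otimes m''n$, coproduct $\Delta(\mu\otimes m)=(\mu''\otimes m')\otimes(\mu'\otimes m'')$, and antipode $S_{\mathcal D(B)}(\mu\otimes m)=(\varepsilon\otimes S(m))({S^*}^{-1}(\mu)\otimes1)$. *)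

theory Defs
  imports Complex_Main "HOL-Library.Function_Algebras"
begin

section \<open>Tensor products of vector spaces\<close>

text \<open>Vector spaces are given by a scalar multiplication on a type, subspaces by sets. On function
  types the addition is pointwise (\<^theory>\<open>HOL-Library.Function_Algebras\<close>); the pointwise
  product of functionals is never used.\<close>

definition fscale :: "'k::field \<Rightarrow> ('a \<Rightarrow> 'k) \<Rightarrow> 'a \<Rightarrow> 'k" where
  "fscale c f = (\<lambda>x. c * f x)"

lemma vector_space_fscale: "vector_space fscale"
  by unfold_locales (auto simp: fscale_def fun_eq_iff algebra_simps)

definition bilinear_on ::
  "('k::field \<Rightarrow> 'v::ab_group_add \<Rightarrow> 'v) \<Rightarrow> ('k \<Rightarrow> 'w::ab_group_add \<Rightarrow> 'w) \<Rightarrow>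
   ('k \<Rightarrow> 'x::ab_group_add \<Rightarrow> 'x) \<Rightarrow> 'v set \<Rightarrow> 'w set \<Rightarrow> ('v \<Rightarrow> 'w \<Rightarrow> 'x) \<Rightarrow> bool" where
  "bilinear_on sV sW sX V W f \<longleftrightarrow>
     (\<forall>v\<in>V. \<forall>v'\<in>V. \<forall>w\<in>W. f (v + v') w = f v w + f v' w) \<and>
     (\<forall>v\<in>V. \<forall>w\<in>W. \<forall>w'\<in>W. f v (w + w') = f v w + f v w') \<and>
     (\<forall>c. \<forall>v\<in>V. \<forall>w\<in>W. f (sV c v) w = sX c (f v w) \<and> f v (sW c w) = sX c (f v w))"

text \<open>Over a field, the tensor product embeds into the dual of the space of bilinear forms:
  the pure tensor of \<open>v\<close> and \<open>w\<close> is evaluation of bilinear forms at \<open>(v, w)\<close>. The tensor product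
  of subspaces \<open>V\<close>, \<open>W\<close> is the span of their pure tensors. The universal property is
  \<open>tlift_tens\<close>, \<open>tlift_linear\<close> below.\<close>

type_synonym ('k, 'v, 'w) tensor = "('v \<Rightarrow> 'w \<Rightarrow> 'k) \<Rightarrow> 'k"

definition tens ::
  "('k::field \<Rightarrow> 'v::ab_group_add \<Rightarrow> 'v) \<Rightarrow> ('k \<Rightarrow> 'w::ab_group_add \<Rightarrow> 'w) \<Rightarrow>
   'v \<Rightarrow> 'w \<Rightarrow> ('k, 'v, 'w) tensor" where
  "tens sV sW v w = (\<lambda>f. if bilinear_on sV sW (*) UNIV UNIV f then f v w else 0)"

definition tensor_space ::
  "('k::field \<Rightarrow> 'v::ab_group_add \<Rightarrow> 'v) \<Rightarrow> ('k \<Rightarrow> 'w::ab_group_add \<Rightarrow> 'w) \<Rightarrow>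
   'v set \<Rightarrow> 'w set \<Rightarrow> ('k, 'v, 'w) tensor set" where
  "tensor_space sV sW V W = module.span fscale {tens sV sW v w |v w. v \<in> V \<and> w \<in> W}"

text \<open>The linear map on the tensor product of \<open>V\<close> and \<open>W\<close> induced by a map \<open>f\<close> that is bilinear
  on \<open>V \<times> W\<close>.\<close>

definition tlift ::
  "('k::field \<Rightarrow> 'v::ab_group_add \<Rightarrow> 'v) \<Rightarrow> ('k \<Rightarrow> 'w::ab_group_add \<Rightarrow> 'w) \<Rightarrow>
   'v set \<Rightarrow> 'w set \<Rightarrow> ('v \<Rightarrow> 'w \<Rightarrow> 'x::ab_group_add) \<Rightarrow> ('k, 'v, 'w) tensor \<Rightarrow> 'x" where
  "tlift sV sW V W f t =
     (THE y. \<exists>ps. set ps \<subseteq> V \<times> W \<and> t = (\<Sum>(v, w)\<leftarrow>ps. tens sV sW v w) \<and>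
                  y = (\<Sum>(v, w)\<leftarrow>ps. f v w))"

lemma bilinear_on_tens:
  assumes "vector_space sV" "vector_space sW"
  shows "bilinear_on sV sW fscale UNIV UNIV (tens sV sW)"
  unfolding bilinear_on_def tens_def fscale_def by (auto simp: fun_eq_iff)

lemma sum_list_tens_eval:
  assumes "bilinear_on sV sW (*) UNIV UNIV F"
  shows "(\<Sum>(v, w)\<leftarrow>ps. tens sV sW v w) F = (\<Sum>(v, w)\<leftarrow>ps. F v w)"
  using assms by (induction ps) (auto simp: tens_def)

lemma tlift_well_defined:
  assumes sV: "vector_space sV" and sW: "vector_space sW" and sX: "vector_space sX"
    and V: "module.subspace sV V" and W: "module.subspace sW W"
    and f: "bilinear_on sV sW sX V W f"
    and ps: "set ps \<subseteq> V \<times> W" and qs: "set qs \<subseteq> V \<times> W"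
    and eq: "(\<Sum>(v, w)\<leftarrow>ps. tens sV sW v w) = (\<Sum>(v, w)\<leftarrow>qs. tens sV sW v w)"
  shows "(\<Sum>(v, w)\<leftarrow>ps. f v w) = (\<Sum>(v, w)\<leftarrow>qs. f v w)"
proof (rule ccontr)
  define d where "d = (\<Sum>(v, w)\<leftarrow>ps. f v w) - (\<Sum>(v, w)\<leftarrow>qs. f v w)"
  assume "(\<Sum>(v, w)\<leftarrow>ps. f v w) \<noteq> (\<Sum>(v, w)\<leftarrow>qs. f v w)"
  then have d: "d \<noteq> 0" by (simp add: d_def)
  interpret V: vector_space sV by fact
  interpret W: vector_space sW by fact
  interpret X: vector_space sX by fact
  interpret K: vector_space "(*) :: 'a \<Rightarrow> 'a \<Rightarrow> 'a"
    by unfold_locales (auto simp: algebra_simps)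
  interpret VV: vector_space_pair sV sV ..
  interpret WW: vector_space_pair sW sW ..
  interpret XK: vector_space_pair sX "(*) :: 'a \<Rightarrow> 'a \<Rightarrow> 'a" ..
  have "X.independent {d}" using d by (simp add: X.dependent_single)
  from XK.linear_independent_extend[OF this, of "\<lambda>_. 1"]
  obtain g where g: "Vector_Spaces.linear sX (*) g" and gd: "g d = 1" by auto
  obtain p where p: "range p \<subseteq> V" "Vector_Spaces.linear sV sV p" "\<forall>v\<in>V. p v = v"
    using VV.linear_exists_left_inverse_on[OF V.linear_id V] by auto
  obtain q where q: "range q \<subseteq> W" "Vector_Spaces.linear sW sW q" "\<forall>w\<in>W. q w = w"
    using WW.linear_exists_left_inverse_on[OF W.linear_id W] by auto
  interpret g: Vector_Spaces.linear sX "(*)" g by fact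
  interpret p: Vector_Spaces.linear sV sV p by fact
  interpret q: Vector_Spaces.linear sW sW q by fact
  define F where "F = (\<lambda>v w. g (f (p v) (q w)))"
  have pq: "p v \<in> V" "q w \<in> W" for v w using p(1) q(1) by auto
  have F: "bilinear_on sV sW (*) UNIV UNIV F"
    using f pq unfolding bilinear_on_def F_def
    by (simp add: p.add q.add p.scale q.scale g.add g.scale)
  have gs: "(\<Sum>(v, w)\<leftarrow>rs. F v w) = g (\<Sum>(v, w)\<leftarrow>rs. f v w)" if "set rs \<subseteq> V \<times> W" for rs
    using that by (induction rs) (auto simp: F_def p q g.add)
  have "(\<Sum>(v, w)\<leftarrow>ps. F v w) = (\<Sum>(v, w)\<leftarrow>qs. F v w)"
    using arg_cong[OF eq, of "\<lambda>t. t F"] by (simp add: sum_list_tens_eval[OF F])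
  then have "g d = 0" by (simp add: gs[OF ps] gs[OF qs] d_def g.diff)
  with gd show False by simp
qed

lemma tlift_sum_list:
  assumes "vector_space sV" "vector_space sW" "vector_space sX"
    and "module.subspace sV V" "module.subspace sW W"
    and "bilinear_on sV sW sX V W f" and "set ps \<subseteq> V \<times> W"
  shows "tlift sV sW V W f (\<Sum>(v, w)\<leftarrow>ps. tens sV sW v w) = (\<Sum>(v, w)\<leftarrow>ps. f v w)"
  unfolding tlift_def
proof (rule the_equality)
  show "\<exists>qs. set qs \<subseteq> V \<times> W \<and>
      (\<Sum>(v, w)\<leftarrow>ps. tens sV sW v w) = (\<Sum>(v, w)\<leftarrow>qs. tens sV sW v w) \<and>
      (\<Sum>(v, w)\<leftarrow>ps. f v w) = (\<Sum>(v, w)\<leftarrow>qs. f v w)"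
    using assms(7) by (intro exI[of _ ps] conjI refl)
qed (use tlift_well_defined[OF assms(1-7)] in metis)

lemma tlift_tens:
  assumes "vector_space sV" "vector_space sW" "vector_space sX"
    and "module.subspace sV V" "module.subspace sW W"
    and "bilinear_on sV sW sX V W f" and "v \<in> V" "w \<in> W"
  shows "tlift sV sW V W f (tens sV sW v w) = f v w"
  using tlift_sum_list[OF assms(1-6), of "[(v, w)]"] assms(7,8) by simp

lemma tensor_space_sum_list:
  assumes "vector_space sV" and "vector_space sW"
    and V: "module.subspace sV V" and t: "t \<in> tensor_space sV sW V W"
  obtains ps where "set ps \<subseteq> V \<times> W" "t = (\<Sum>(v, w)\<leftarrow>ps. tens sV sW v w)"
proof -
  interpret V: vector_space sV by fact
  interpret T: vector_space "fscale :: 'a \<Rightarrow> (('b \<Rightarrow> 'c \<Rightarrow> 'a) \<Rightarrow> 'a) \<Rightarrow> _"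
    by (rule vector_space_fscale)
  have sc: "fscale c (tens sV sW v w) = tens sV sW (sV c v) w" for c v w
    using bilinear_on_tens[OF assms(1,2)] by (simp add: bilinear_on_def)
  from t have "\<exists>ps. set ps \<subseteq> V \<times> W \<and> t = (\<Sum>(v, w)\<leftarrow>ps. tens sV sW v w)"
    unfolding tensor_space_def
  proof (induction rule: T.span_induct_alt)
    case base
    show ?case by (rule exI[of _ "[]"]) simp
  next
    case (step c x y)
    then obtain v w ps where "x = tens sV sW v w" "v \<in> V" "w \<in> W"
      and "set ps \<subseteq> V \<times> W" "y = (\<Sum>(v, w)\<leftarrow>ps. tens sV sW v w)" by auto
    then show ?case
      using V.subspace_scale[OF V]
      by (intro exI[of _ "(sV c v, w) # ps"]) (simp add: sc)
  qed
  then show ?thesis using that by blast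
qed

lemma tlift_linear:
  assumes "vector_space sV" "vector_space sW" "vector_space sX"
    and "module.subspace sV V" "module.subspace sW W"
    and f: "bilinear_on sV sW sX V W f"
    and t: "t \<in> tensor_space sV sW V W" and u: "u \<in> tensor_space sV sW V W"
  shows "tlift sV sW V W f (t + u) = tlift sV sW V W f t + tlift sV sW V W f u" (is ?add)
    and "tlift sV sW V W f (fscale c t) = sX c (tlift sV sW V W f t)" (is ?scale)
proof -
  interpret V: vector_space sV by fact
  interpret X: vector_space sX by fact
  interpret T: vector_space "fscale :: 'a \<Rightarrow> (('b \<Rightarrow> 'c \<Rightarrow> 'a) \<Rightarrow> 'a) \<Rightarrow> _"
    by (rule vector_space_fscale)
  note lift = tlift_sum_list[OF assms(1-6)]
  obtain ps where ps: "set ps \<subseteq> V \<times> W" "t = (\<Sum>(v, w)\<leftarrow>ps. tens sV sW v w)"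
    using tensor_space_sum_list[OF assms(1,2,4) t] .
  obtain qs where qs: "set qs \<subseteq> V \<times> W" "u = (\<Sum>(v, w)\<leftarrow>qs. tens sV sW v w)"
    using tensor_space_sum_list[OF assms(1,2,4) u] .
  show ?add
    using lift[of "ps @ qs"] lift[of ps] lift[of qs] ps qs by simp
  define rs where "rs = map (\<lambda>(v, w). (sV c v, w)) ps"
  have rs: "set rs \<subseteq> V \<times> W"
    using ps(1) V.subspace_scale[OF assms(4)] by (auto simp: rs_def)
  have sc: "fscale c (tens sV sW v w) = tens sV sW (sV c v) w" for v w
    using bilinear_on_tens[OF assms(1,2)] by (simp add: bilinear_on_def)
  have "fscale c t = (\<Sum>(v, w)\<leftarrow>rs. tens sV sW v w)"
    unfolding ps(2) rs_def
  proof (induction ps)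
    case Nil
    show ?case by (simp add: T.scale_zero_right del: zero_fun_apply)
  next
    case (Cons p ps)
    then show ?case
      by (cases p) (simp only: list.map sum_list.Cons T.scale_right_distrib sc prod.case)
  qed
  moreover have "(\<Sum>(v, w)\<leftarrow>rs. f v w) = sX c (\<Sum>(v, w)\<leftarrow>ps. f v w)"
    using ps(1) f unfolding rs_def
    by (induction ps) (auto simp: X.scale_right_distrib bilinear_on_def)
  ultimately show ?scale
    using lift[OF rs] lift[OF ps(1)] ps(2) by simp
qed


section \<open>Hopf algebras\<close>

text \<open>Multiplication and unit are those of the underlying ring type.\<close>

record ('k, 'b) hopf =
  hscale :: "'k \<Rightarrow> 'b \<Rightarrow> 'b"
  comult :: "'b \<Rightarrow> ('k, 'b, 'b) tensor"
  counit :: "'b \<Rightarrow> 'k"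
  antipode :: "'b \<Rightarrow> 'b"

text \<open>Sweedler notation: \<open>sw B (\<lambda>x y. f x y) b\<close> is \<open>f(b', b'')\<close> and
  \<open>sw3 B (\<lambda>x y z. f x y z) b\<close> is \<open>f(b', b'', b''')\<close>, for multilinear \<open>f\<close>.\<close>

definition sw ::
  "('k::field, 'b::ring_1) hopf \<Rightarrow> ('b \<Rightarrow> 'b \<Rightarrow> 'x::ab_group_add) \<Rightarrow> 'b \<Rightarrow> 'x" where
  "sw B f b = tlift (hscale B) (hscale B) UNIV UNIV f (comult B b)"

definition sw3 ::
  "('k::field, 'b::ring_1) hopf \<Rightarrow> ('b \<Rightarrow> 'b \<Rightarrow> 'b \<Rightarrow> 'x::ab_group_add) \<Rightarrow> 'b \<Rightarrow> 'x" where
  "sw3 B f b = sw B (\<lambda>x z. sw B (\<lambda>x1 x2. f x1 x2 z) x) b"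

locale hopf_algebra =
  fixes B :: "('k::field, 'b::ring_1) hopf"
  assumes vector_space: "vector_space (hscale B)"
    and scale_mult_left: "hscale B c a * b = hscale B c (a * b)"
    and scale_mult_right: "a * hscale B c b = hscale B c (a * b)"
    and comult_in: "comult B b \<in> tensor_space (hscale B) (hscale B) UNIV UNIV"
    and comult_linear: "Vector_Spaces.linear (hscale B) fscale (comult B)"
    and coassoc: \<comment> \<open>in \<open>B \<otimes> (B \<otimes> B)\<close>\<close>
      "sw B (\<lambda>x z. sw B (\<lambda>x1 x2.
          tens (hscale B) fscale x1 (tens (hscale B) (hscale B) x2 z)) x) b =
        sw B (\<lambda>x y. tens (hscale B) fscale x (comult B y)) b"
    and counit_linear: "Vector_Spaces.linear (hscale B) (*) (counit B)"
    and counit_left: "sw B (\<lambda>x y. hscale B (counit B x) y) b = b"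
    and counit_right: "sw B (\<lambda>x y. hscale B (counit B y) x) b = b"
    and comult_one: "comult B 1 = tens (hscale B) (hscale B) 1 1"
    and comult_mult: "comult B (a * b) =
        sw B (\<lambda>a1 a2. sw B (\<lambda>b1 b2. tens (hscale B) (hscale B) (a1 * b1) (a2 * b2)) b) a"
    and counit_one: "counit B 1 = 1"
    and counit_mult: "counit B (a * b) = counit B a * counit B b"
    and antipode_linear: "Vector_Spaces.linear (hscale B) (hscale B) (antipode B)"
    and antipode_left: "sw B (\<lambda>x y. antipode B x * y) b = hscale B (counit B b) 1"
    and antipode_right: "sw B (\<lambda>x y. x * antipode B y) b = hscale B (counit B b) 1"


section \<open>The dual Hopf algebra\<close>

text \<open>The underlying space is the finite (Sweedler) dual: the linear functionals that vanish on
  a two-sided ideal of finite codimension. For finite-dimensional \<open>B\<close> this is the full dual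
  (\<open>hdual_finite_dimensional\<close>).\<close>

definition hdual :: "('k::field, 'b::ring_1) hopf \<Rightarrow> ('b \<Rightarrow> 'k) set" where
  "hdual B = {\<beta>. Vector_Spaces.linear (hscale B) (*) \<beta> \<and>
     (\<exists>I F. module.subspace (hscale B) I \<and> (\<forall>x\<in>I. \<forall>b. b * x \<in> I \<and> x * b \<in> I) \<and>
            finite F \<and> module.span (hscale B) (I \<union> F) = UNIV \<and> (\<forall>x\<in>I. \<beta> x = 0))}"

lemma hdual_finite_dimensional:
  assumes "vector_space (hscale B)" and "finite F" and "module.span (hscale B) F = UNIV"
  shows "hdual B = {\<beta>. Vector_Spaces.linear (hscale B) (*) \<beta>}"
proof -
  interpret vector_space "hscale B" by fact
  have "span ({0} \<union> F) = UNIV"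
    using assms(3) span_insert_0[of F] by simp
  moreover have "\<beta> 0 = 0" if "Vector_Spaces.linear (hscale B) (*) \<beta>" for \<beta>
  proof -
    interpret Vector_Spaces.linear "hscale B" "(*)" \<beta> by fact
    show ?thesis by (rule zero)
  qed
  ultimately show ?thesis
    using assms(2) unfolding hdual_def
    by (intro Collect_cong iffI conjI exI[of _ "{0}"] exI[of _ F])
      (simp_all add: subspace_single_0)
qed

definition dmult ::
  "('k::field, 'b::ring_1) hopf \<Rightarrow> ('b \<Rightarrow> 'k) \<Rightarrow> ('b \<Rightarrow> 'k) \<Rightarrow> 'b \<Rightarrow> 'k" (infixl \<open>\<cdot>\<index>\<close> 75) where
  "\<alpha> \<cdot>\<^bsub>B\<^esub> \<beta> = (\<lambda>b. sw B (\<lambda>x y. \<alpha> x * \<beta> y) b)"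

text \<open>The coproduct of \<open>\<beta>\<close> is the tensor with \<open>\<langle>\<beta>', a\<rangle>\<langle>\<beta>'', b\<rangle> = \<langle>\<beta>, ab\<rangle>\<close>; \<open>dsw\<close>, \<open>dsw3\<close> are the
  corresponding Sweedler notations.\<close>

definition dcomult ::
  "('k::field, 'b::ring_1) hopf \<Rightarrow> ('b \<Rightarrow> 'k) \<Rightarrow> ('k, 'b \<Rightarrow> 'k, 'b \<Rightarrow> 'k) tensor" where
  "dcomult B \<beta> = (THE t. t \<in> tensor_space fscale fscale (hdual B) (hdual B) \<and>
     (\<forall>a b. tlift fscale fscale (hdual B) (hdual B) (\<lambda>\<phi> \<psi>. \<phi> a * \<psi> b) t = \<beta> (a * b)))"

definition dsw ::
  "('k::field, 'b::ring_1) hopf \<Rightarrow> (('b \<Rightarrow> 'k) \<Rightarrow> ('b \<Rightarrow> 'k) \<Rightarrow> 'x::ab_group_add) \<Rightarrow>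
   ('b \<Rightarrow> 'k) \<Rightarrow> 'x" where
  "dsw B f \<beta> = tlift fscale fscale (hdual B) (hdual B) f (dcomult B \<beta>)"

definition dsw3 ::
  "('k::field, 'b::ring_1) hopf \<Rightarrow>
   (('b \<Rightarrow> 'k) \<Rightarrow> ('b \<Rightarrow> 'k) \<Rightarrow> ('b \<Rightarrow> 'k) \<Rightarrow> 'x::ab_group_add) \<Rightarrow> ('b \<Rightarrow> 'k) \<Rightarrow> 'x" where
  "dsw3 B f \<beta> = dsw B (\<lambda>x z. dsw B (\<lambda>x1 x2. f x1 x2 z) x) \<beta>"

definition dantipode :: "('k::field, 'b::ring_1) hopf \<Rightarrow> ('b \<Rightarrow> 'k) \<Rightarrow> 'b \<Rightarrow> 'k" where
  "dantipode B \<beta> = (\<lambda>b. \<beta> (antipode B b))"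

definition dantipode_inv :: "('k::field, 'b::ring_1) hopf \<Rightarrow> ('b \<Rightarrow> 'k) \<Rightarrow> 'b \<Rightarrow> 'k" where
  "dantipode_inv B = inv_into (hdual B) (dantipode B)"

text \<open>The regular actions. The right action of the dual on \<open>B\<close> is written \<open>\<leftharpoondown>\<close> to
  keep it apart from the right action of \<open>B\<close> on the dual.\<close>

definition lact ::
  "('k::field, 'b::ring_1) hopf \<Rightarrow> 'b \<Rightarrow> ('b \<Rightarrow> 'k) \<Rightarrow> 'b \<Rightarrow> 'k" (infixr \<open>\<rightharpoonup>\<index>\<close> 80) where
  "b \<rightharpoonup>\<^bsub>B\<^esub> \<beta> = dsw B (\<lambda>\<beta>1 \<beta>2. fscale (\<beta>2 b) \<beta>1) \<beta>"

definition ract ::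
  "('k::field, 'b::ring_1) hopf \<Rightarrow> ('b \<Rightarrow> 'k) \<Rightarrow> 'b \<Rightarrow> 'b \<Rightarrow> 'k" (infixl \<open>\<leftharpoonup>\<index>\<close> 80) where
  "\<beta> \<leftharpoonup>\<^bsub>B\<^esub> m = dsw B (\<lambda>\<beta>1 \<beta>2. fscale (\<beta>1 m) \<beta>2) \<beta>"

definition bact ::
  "('k::field, 'b::ring_1) hopf \<Rightarrow> 'b \<Rightarrow> ('b \<Rightarrow> 'k) \<Rightarrow> 'b" (infixl \<open>\<leftharpoondown>\<index>\<close> 80) where
  "b \<leftharpoondown>\<^bsub>B\<^esub> \<mu> = sw B (\<lambda>b1 b2. hscale B (\<mu> b1) b2) b"


section \<open>The Heisenberg double and the Drinfeld double\<close>

text \<open>Both live on the tensor product \<open>dbl B\<close> of the dual with \<open>B\<close>; \<open>\<mu> \<otimes>\<^bsub>B\<^esub> m\<close> stands for both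
  \<open>\<mu> # m\<close> and \<open>\<mu> \<otimes> m\<close>.\<close>

type_synonym ('k, 'b) dbl = "('k, 'b \<Rightarrow> 'k, 'b) tensor"

definition dbl :: "('k::field, 'b::ring_1) hopf \<Rightarrow> ('k, 'b) dbl set" where
  "dbl B = tensor_space fscale (hscale B) (hdual B) UNIV"

definition dtens ::
  "('k::field, 'b::ring_1) hopf \<Rightarrow> ('b \<Rightarrow> 'k) \<Rightarrow> 'b \<Rightarrow> ('k, 'b) dbl" (infix \<open>\<otimes>\<index>\<close> 72) where
  "\<mu> \<otimes>\<^bsub>B\<^esub> m = tens fscale (hscale B) \<mu> m"

definition dlift ::
  "('k::field, 'b::ring_1) hopf \<Rightarrow> (('b \<Rightarrow> 'k) \<Rightarrow> 'b \<Rightarrow> 'x::ab_group_add) \<Rightarrow>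
   ('k, 'b) dbl \<Rightarrow> 'x" where
  "dlift B f M = tlift fscale (hscale B) (hdual B) UNIV f M"

definition heis_mult ::
  "('k::field, 'b::ring_1) hopf \<Rightarrow> ('k, 'b) dbl \<Rightarrow> ('k, 'b) dbl \<Rightarrow> ('k, 'b) dbl"
    (infixl \<open>\<star>\<index>\<close> 70) where
  "A \<star>\<^bsub>B\<^esub> C =
     dlift B (\<lambda>\<alpha> a. dlift B (\<lambda>\<beta> b.
       sw B (\<lambda>a1 a2. (\<alpha> \<cdot>\<^bsub>B\<^esub> (a1 \<rightharpoonup>\<^bsub>B\<^esub> \<beta>)) \<otimes>\<^bsub>B\<^esub> (a2 * b)) a) C) A"

definition drin_mult ::
  "('k::field, 'b::ring_1) hopf \<Rightarrow> ('k, 'b) dbl \<Rightarrow> ('k, 'b) dbl \<Rightarrow> ('k, 'b) dbl"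
    (infixl \<open>\<diamondop>\<index>\<close> 70) where
  "M \<diamondop>\<^bsub>B\<^esub> N =
     dlift B (\<lambda>\<mu> m. dlift B (\<lambda>\<nu> n.
       sw3 B (\<lambda>m1 m2 m3.
         (\<mu> \<cdot>\<^bsub>B\<^esub> ((m1 \<rightharpoonup>\<^bsub>B\<^esub> \<nu>) \<leftharpoonup>\<^bsub>B\<^esub> (inv (antipode B) m3))) \<otimes>\<^bsub>B\<^esub> (m2 * n)) m) N) M"

definition drin_comult ::
  "('k::field, 'b::ring_1) hopf \<Rightarrow> ('k, 'b) dbl \<Rightarrow> ('k, ('k, 'b) dbl, ('k, 'b) dbl) tensor" where
  "drin_comult B M =
     dlift B (\<lambda>\<mu> m. dsw B (\<lambda>\<mu>1 \<mu>2. sw B (\<lambda>m1 m2.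
       tens fscale fscale (\<mu>2 \<otimes>\<^bsub>B\<^esub> m1) (\<mu>1 \<otimes>\<^bsub>B\<^esub> m2)) m) \<mu>) M"

definition drin_antipode :: "('k::field, 'b::ring_1) hopf \<Rightarrow> ('k, 'b) dbl \<Rightarrow> ('k, 'b) dbl" where
  "drin_antipode B M =
     dlift B (\<lambda>\<mu> m. (counit B \<otimes>\<^bsub>B\<^esub> antipode B m) \<diamondop>\<^bsub>B\<^esub> (dantipode_inv B \<mu> \<otimes>\<^bsub>B\<^esub> 1)) M"

definition drin_sw ::
  "('k::field, 'b::ring_1) hopf \<Rightarrow> (('k, 'b) dbl \<Rightarrow> ('k, 'b) dbl \<Rightarrow> 'x::ab_group_add) \<Rightarrow>
   ('k, 'b) dbl \<Rightarrow> 'x" where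
  "drin_sw B f M = tlift fscale fscale (dbl B) (dbl B) f (drin_comult B M)"

definition drin_sw3 ::
  "('k::field, 'b::ring_1) hopf \<Rightarrow>
   (('k, 'b) dbl \<Rightarrow> ('k, 'b) dbl \<Rightarrow> ('k, 'b) dbl \<Rightarrow> 'x::ab_group_add) \<Rightarrow> ('k, 'b) dbl \<Rightarrow> 'x" where
  "drin_sw3 B f M = drin_sw B (\<lambda>X Z. drin_sw B (\<lambda>X1 X2. f X1 X2 Z) X) M"

definition eta :: "('k::field, 'b::ring_1) hopf \<Rightarrow> ('k, 'b) dbl \<Rightarrow> ('k, 'b) dbl \<Rightarrow> 'k" where
  "eta B M N = dlift B (\<lambda>\<mu> m. dlift B (\<lambda>\<nu> n. \<mu> 1 * \<nu> m * counit B n) N) M"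

definition s_map :: "('k::field, 'b::ring_1) hopf \<Rightarrow> ('k, 'b) dbl \<Rightarrow> ('k, 'b) dbl" where
  "s_map B M = drin_sw3 B (\<lambda>M1 M2 M3. fscale (eta B M1 M2) (drin_antipode B M3)) M"

definition drin_act ::
  "('k::field, 'b::ring_1) hopf \<Rightarrow> ('k, 'b) dbl \<Rightarrow> ('k, 'b) dbl \<Rightarrow> ('k, 'b) dbl"
    (infixr \<open>\<triangleright>\<index>\<close> 65) where
  "M \<triangleright>\<^bsub>B\<^esub> A =
     dlift B (\<lambda>\<mu> m. dlift B (\<lambda>\<beta> b.
       dsw3 B (\<lambda>\<mu>1 \<mu>2 \<mu>3. sw3 B (\<lambda>m1 m2 m3.
         (\<mu>3 \<cdot>\<^bsub>B\<^esub> (m1 \<rightharpoonup>\<^bsub>B\<^esub> \<beta>) \<cdot>\<^bsub>B\<^esub> dantipode_inv B \<mu>2) \<otimes>\<^bsub>B\<^esub>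
         ((m2 * b * antipode B m3) \<leftharpoondown>\<^bsub>B\<^esub> dantipode_inv B \<mu>1)) m) \<mu>) A) M"

end

theory Submission
  imports Defs
begin

text \<open>The tensor product of functions with vectors embeds into a space of maps: \<open>\<mu> \<otimes> m\<close> is determined
  by \<open>x \<mapsto> \<langle>\<mu>, x\<rangle> m\<close>. In these terms all products, coproducts and actions on the dual are evaluations,
  e.g. \<open>\<langle>b \<rightharpoonup> \<beta>, x\<rangle> = \<langle>\<beta>, xb\<rangle>\<close>, and every identity between elements of the doubles becomes a
  Sweedler identity in \<open>B\<close>. For \<open>s\<close>, the pairing \<open>\<eta>\<close> contributes a factor that cancels against
  the \<open>S\<^sup>-\<^sup>1\<close> of the Drinfeld product by \<open>S\<^sup>-\<^sup>1(m'') m' = \<epsilon>(m)\<close>. For the action, both sides are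
  \<open>\<langle>\<mu>, S\<^sup>-\<^sup>1(y') S\<^sup>-\<^sup>1(x''') x'\<rangle> \<langle>\<alpha>, x'' m'\<rangle> y''\<close> with \<open>y = m'' a S(m''')\<close>, because
  \<open>\<Delta>(S(m)) = S(m'') \<otimes> S(m')\<close>.\<close>

section \<open>Linear maps on subspaces and maps out of tensor products\<close>

text \<open>The obstacle is the finite dual of a possibly infinite-dimensional B. Its coproduct is
  described only by its evaluations, so nothing can be done with it until existence (coordinates
  modulo an ideal of finite codimension) and uniqueness (evaluations separate tensors) are known.
  Sweedler components of \<mu> are never computed: after evaluation they occur only through the
  bilinear form (x, y) \<mapsto> \<mu>'(x) \<mu>''(y), and a linear functional of this form sums to
  its value at (x, y) \<mapsto> \<mu>(xy). What is left are coproducts of elements of B, rearranged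
  by coassociativity and by interchange of independent splittings. All operations are total
  functions on types but behave linearly only on \<open>hdual B\<close> or \<open>dbl B\<close>.
  Hence linearity is a predicate relative to a set, and many auxiliary facts are rules that build it
  up along an expression. That S reverses products and coproducts is not an axiom and has to be
  derived.\<close>

definition lin_on ::
  "('k::field \<Rightarrow> 'v::ab_group_add \<Rightarrow> 'v) \<Rightarrow> ('k \<Rightarrow> 'x::ab_group_add \<Rightarrow> 'x) \<Rightarrow> 'v set \<Rightarrow> ('v \<Rightarrow> 'x) \<Rightarrow> bool"
  where "lin_on sV sX V f \<longleftrightarrow>
    (\<forall>v\<in>V. \<forall>v'\<in>V. f (v + v') = f v + f v') \<and> (\<forall>c. \<forall>v\<in>V. f (sV c v) = sX c (f v))"

lemma lin_onI:
  assumes "\<And>v v'. v \<in> V \<Longrightarrow> v' \<in> V \<Longrightarrow> f (v + v') = f v + f v'"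
    and "\<And>c v. v \<in> V \<Longrightarrow> f (sV c v) = sX c (f v)"
  shows "lin_on sV sX V f"
  using assms by (simp add: lin_on_def)

lemma lin_onD:
  assumes "lin_on sV sX V f"
  shows "v \<in> V \<Longrightarrow> v' \<in> V \<Longrightarrow> f (v + v') = f v + f v'"
    and "v \<in> V \<Longrightarrow> f (sV c v) = sX c (f v)"
  using assms by (simp_all add: lin_on_def)

lemma bilinear_on_iff:
  "bilinear_on sV sW sX V W f \<longleftrightarrow>
     (\<forall>w\<in>W. lin_on sV sX V (\<lambda>v. f v w)) \<and> (\<forall>v\<in>V. lin_on sW sX W (\<lambda>w. f v w))"
  by (auto simp: bilinear_on_def lin_on_def)

lemma bilinear_onI:
  assumes "\<And>w. w \<in> W \<Longrightarrow> lin_on sV sX V (\<lambda>v. f v w)"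
    and "\<And>v. v \<in> V \<Longrightarrow> lin_on sW sX W (\<lambda>w. f v w)"
  shows "bilinear_on sV sW sX V W f"
  using assms by (simp add: bilinear_on_iff)

lemma bilinear_onD:
  assumes "bilinear_on sV sW sX V W f"
  shows "w \<in> W \<Longrightarrow> lin_on sV sX V (\<lambda>v. f v w)" and "v \<in> V \<Longrightarrow> lin_on sW sX W (\<lambda>w. f v w)"
  using assms by (simp_all add: bilinear_on_iff)

lemma lin_on_cong:
  assumes "\<And>v. v \<in> V \<Longrightarrow> f v = g v" and "vector_space sV" and "module.subspace sV V"
  shows "lin_on sV sX V f \<longleftrightarrow> lin_on sV sX V g"
proof -
  interpret vector_space sV by fact
  show ?thesis using assms by (simp add: lin_on_def subspace_add subspace_scale)
qed

lemma lin_on_id: "lin_on sV sV V (\<lambda>v. v)"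
  by (simp add: lin_on_def)

lemma lin_on_comp:
  assumes "lin_on sX sY X h" and "lin_on sV sX V g" and "\<And>v. v \<in> V \<Longrightarrow> g v \<in> X"
  shows "lin_on sV sY V (\<lambda>v. h (g v))"
  using assms by (simp add: lin_on_def)

lemma vector_space_times: "vector_space ((*) :: 'k::field \<Rightarrow> 'k \<Rightarrow> 'k)"
  by unfold_locales (auto simp: algebra_simps)

lemma lin_on_scale_left:
  assumes "vector_space sX" and "lin_on sV (*) V g"
  shows "lin_on sV sX V (\<lambda>v. sX (g v) x)"
proof -
  interpret vector_space sX by fact
  show ?thesis using assms(2) by (simp add: lin_on_def scale_left_distrib)
qed

lemma lin_on_scale_right:
  assumes "vector_space sX" and "lin_on sV sX V g"
  shows "lin_on sV sX V (\<lambda>v. sX c (g v))"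
proof -
  interpret vector_space sX by fact
  show ?thesis using assms(2) by (simp add: lin_on_def scale_right_distrib mult.commute)
qed

lemma lin_on_apply:
  assumes "lin_on sV fscale V g"
  shows "lin_on sV (*) V (\<lambda>v. g v p)"
  using assms by (simp add: lin_on_def fscale_def)

lemma lin_on_fun:
  assumes "\<And>p. lin_on sV (*) V (\<lambda>v. g v p)"
  shows "lin_on sV fscale V g"
  using assms by (simp add: lin_on_def fscale_def fun_eq_iff)

lemma lin_on_sum_list:
  assumes "vector_space sX" "module.subspace sX X" "vector_space sY"
    and h: "lin_on sX sY X h" and "\<And>p. p \<in> set ps \<Longrightarrow> f p \<in> X"
  shows "h (\<Sum>p\<leftarrow>ps. f p) = (\<Sum>p\<leftarrow>ps. h (f p))" "(\<Sum>p\<leftarrow>ps. f p) \<in> X"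
proof -
  interpret X: vector_space sX by fact
  interpret Y: vector_space sY by fact
  have "h (sX 0 0) = sY 0 (h 0)"
    by (rule lin_onD(2)[OF h]) (rule X.subspace_0[OF assms(2)])
  then have "h 0 = 0" by simp
  then have "h (\<Sum>p\<leftarrow>ps. f p) = (\<Sum>p\<leftarrow>ps. h (f p)) \<and> (\<Sum>p\<leftarrow>ps. f p) \<in> X"
    using assms(5)
    by (induction ps) (auto simp: lin_onD(1)[OF h] X.subspace_0[OF assms(2)] X.subspace_add[OF assms(2)])
  then show "h (\<Sum>p\<leftarrow>ps. f p) = (\<Sum>p\<leftarrow>ps. h (f p))" "(\<Sum>p\<leftarrow>ps. f p) \<in> X" by auto
qed

lemma sum_list_lin_on:
  assumes "vector_space sX" and "\<And>p. p \<in> set ps \<Longrightarrow> lin_on sV sX V (\<lambda>v. f v p)"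
  shows "lin_on sV sX V (\<lambda>v. \<Sum>p\<leftarrow>ps. f v p)"
proof -
  interpret X: vector_space sX by fact
  show ?thesis using assms(2)
    by (induction ps) (auto simp: lin_on_def X.scale_right_distrib add_ac)
qed

section \<open>Maps induced on the tensor product of two subspaces\<close>

locale tensor_pair =
  fixes sV :: "'k::field \<Rightarrow> 'v::ab_group_add \<Rightarrow> 'v" and sW :: "'k \<Rightarrow> 'w::ab_group_add \<Rightarrow> 'w"
    and V :: "'v set" and W :: "'w set"
  assumes vs: "vector_space sV" "vector_space sW"
    and sub: "module.subspace sV V" "module.subspace sW W"
begin

abbreviation "lift \<equiv> tlift sV sW V W"
abbreviation "tspace \<equiv> tensor_space sV sW V W"

lemma subspace_tspace: "module.subspace fscale tspace"
proof -
  interpret T: vector_space "fscale :: 'k \<Rightarrow> (('v \<Rightarrow> 'w \<Rightarrow> 'k) \<Rightarrow> 'k) \<Rightarrow> _"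
    by (rule vector_space_fscale)
  show ?thesis unfolding tensor_space_def by (rule T.subspace_span)
qed

lemma tens_in_tspace: "v \<in> V \<Longrightarrow> w \<in> W \<Longrightarrow> tens sV sW v w \<in> tspace"
proof -
  interpret T: vector_space "fscale :: 'k \<Rightarrow> (('v \<Rightarrow> 'w \<Rightarrow> 'k) \<Rightarrow> 'k) \<Rightarrow> _"
    by (rule vector_space_fscale)
  show "v \<in> V \<Longrightarrow> w \<in> W \<Longrightarrow> tens sV sW v w \<in> tspace"
    unfolding tensor_space_def by (rule T.span_base) auto
qed

text \<open>The description defining \<open>tlift\<close> mentions \<open>f\<close> only at pairs
  from V \<times> W, so functions agreeing there give the same description, whatever
  \<open>t\<close> is.\<close>

lemma lift_cong:
  assumes "\<And>v w. v \<in> V \<Longrightarrow> w \<in> W \<Longrightarrow> f v w = g v w"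
  shows "lift f t = lift g t"
proof -
  have "(\<Sum>(v, w)\<leftarrow>ps. f v w) = (\<Sum>(v, w)\<leftarrow>ps. g v w)" if "set ps \<subseteq> V \<times> W" for ps
    using that assms by (intro arg_cong[of _ _ sum_list] map_cong) auto
  then show ?thesis
    unfolding tlift_def by (intro arg_cong[of _ _ The] ext) metis
qed

lemma lift_tens:
  assumes "vector_space sX" and "bilinear_on sV sW sX V W f" and "v \<in> V" "w \<in> W"
  shows "lift f (tens sV sW v w) = f v w"
  using tlift_tens[OF vs assms(1) sub assms(2-)] .

lemma lin_on_lift_arg:
  assumes "vector_space sX" and "bilinear_on sV sW sX V W f"
    and "lin_on sU fscale U g" and "\<And>u. u \<in> U \<Longrightarrow> g u \<in> tspace"
  shows "lin_on sU sX U (\<lambda>u. lift f (g u))"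
proof (rule lin_onI)
  fix u u' c assume u: "u \<in> U"
  show "lift f (g (sU c u)) = sX c (lift f (g u))"
    by (simp only: lin_onD(2)[OF assms(3) u] tlift_linear(2)[OF vs assms(1) sub assms(2) assms(4)[OF u] assms(4)[OF u]])
  assume u': "u' \<in> U"
  show "lift f (g (u + u')) = lift f (g u) + lift f (g u')"
    by (simp only: lin_onD(1)[OF assms(3) u u']
        tlift_linear(1)[OF vs assms(1) sub assms(2) assms(4)[OF u] assms(4)[OF u']])
qed

lemma lin_on_lift:
  assumes "vector_space sX" and "bilinear_on sV sW sX V W f"
  shows "lin_on fscale sX tspace (lift f)"
  by (rule lin_on_lift_arg[OF assms lin_on_id])

text \<open>One list \<open>ps\<close> serves every bilinear map into a given type. Lifts of a fixed
  \<open>t\<close> can thus be compared as finite sums over the same list, on which linearity in a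
  parameter and the interchange of two Sweedler sums rest.\<close>

lemma lift_sum_list:
  assumes "t \<in> tspace"
  obtains ps where "set ps \<subseteq> V \<times> W" "t = (\<Sum>(v, w)\<leftarrow>ps. tens sV sW v w)"
    and "\<And>(sX :: 'k \<Rightarrow> 'x::ab_group_add \<Rightarrow> 'x) f. vector_space sX \<Longrightarrow> bilinear_on sV sW sX V W f \<Longrightarrow>
           lift f t = (\<Sum>(v, w)\<leftarrow>ps. f v w)"
proof -
  obtain ps where ps: "set ps \<subseteq> V \<times> W" "t = (\<Sum>(v, w)\<leftarrow>ps. tens sV sW v w)"
    using tensor_space_sum_list[OF vs sub(1) assms] .
  show ?thesis
    by (rule that[OF ps]) (simp_all only: ps(2) tlift_sum_list[OF vs _ sub _ ps(1)])
qed

text \<open>For fixed \<open>t\<close> the lift is a finite sum over pairs that do not depend on the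
  parameter \<open>u\<close>, so linearity is inherited summand by summand. This serves when the
  variable sits in the body of a Sweedler sum rather than in its argument.\<close>

lemma lin_on_lift_fun:
  assumes "vector_space sX" and "t \<in> tspace" and "vector_space sU" and "module.subspace sU U"
    and F: "\<And>u. u \<in> U \<Longrightarrow> bilinear_on sV sW sX V W (F u)"
    and lin: "\<And>v w. v \<in> V \<Longrightarrow> w \<in> W \<Longrightarrow> lin_on sU sX U (\<lambda>u. F u v w)"
  shows "lin_on sU sX U (\<lambda>u. lift (F u) t)"
proof -
  obtain ps where ps: "set ps \<subseteq> V \<times> W"
    "\<And>f. bilinear_on sV sW sX V W f \<Longrightarrow> lift f t = (\<Sum>(v, w)\<leftarrow>ps. f v w)"
    using lift_sum_list[OF assms(2)] assms(1) by metis
  have "lin_on sU sX U (\<lambda>u. \<Sum>p\<leftarrow>ps. F u (fst p) (snd p))"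
    using ps(1) by (intro sum_list_lin_on assms(1) lin) auto
  then show ?thesis
    by (subst lin_on_cong[OF _ assms(3,4)]) (auto simp: ps(2)[OF F] split_def)
qed

text \<open>On a representing list both sides are finite sums. The map \<open>h\<close> is linear
  only on the subspace X, so the values of \<open>f\<close> have to stay in X; closure of the lift
  in X falls out of the same sums.\<close>

lemma lift_comm:
  assumes "vector_space sX" "module.subspace sX X" "vector_space sY"
    and h: "lin_on sX sY X h" and f: "bilinear_on sV sW sX V W f"
    and X: "\<And>v w. v \<in> V \<Longrightarrow> w \<in> W \<Longrightarrow> f v w \<in> X" and "t \<in> tspace"
  shows "h (lift f t) = lift (\<lambda>v w. h (f v w)) t" "lift f t \<in> X"
proof -
  obtain ps where ps: "set ps \<subseteq> V \<times> W" "t = (\<Sum>(v, w)\<leftarrow>ps. tens sV sW v w)"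
    using tensor_space_sum_list[OF vs sub(1) assms(7)] .
  have hf: "bilinear_on sV sW sY V W (\<lambda>v w. h (f v w))"
    by (intro bilinear_onI lin_on_comp[OF h] bilinear_onD[OF f] X)
  have "f (fst p) (snd p) \<in> X" if "p \<in> set ps" for p
    using X that ps(1) by (auto dest: subsetD)
  note c = lin_on_sum_list[OF assms(1-3) h this]
  show "lift f t \<in> X"
    using c(2) ps tlift_sum_list[OF vs assms(1) sub f ps(1)] by (auto simp: split_def)
  show "h (lift f t) = lift (\<lambda>v w. h (f v w)) t"
    unfolding ps(2) tlift_sum_list[OF vs assms(1) sub f ps(1)] tlift_sum_list[OF vs assms(3) sub hf ps(1)]
    using c(1) by (auto simp: split_def)
qed

lemma lift_closed:
  assumes "vector_space sX" "module.subspace sX X" "bilinear_on sV sW sX V W f"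
    and "\<And>v w. v \<in> V \<Longrightarrow> w \<in> W \<Longrightarrow> f v w \<in> X" and "t \<in> tspace"
  shows "lift f t \<in> X"
  using lift_comm(2)[OF assms(1,2,1) lin_on_id assms(3-5)] .

lemma tspace_ext:
  assumes "vector_space sX" and f: "lin_on fscale sX tspace f" and g: "lin_on fscale sX tspace g"
    and eq: "\<And>v w. v \<in> V \<Longrightarrow> w \<in> W \<Longrightarrow> f (tens sV sW v w) = g (tens sV sW v w)"
    and t: "t \<in> tspace"
  shows "f t = g t"
proof -
  obtain ps where ps: "set ps \<subseteq> V \<times> W" "t = (\<Sum>(v, w)\<leftarrow>ps. tens sV sW v w)"
    using tensor_space_sum_list[OF vs sub(1) t] .
  have *: "h t = (\<Sum>p\<leftarrow>ps. h (tens sV sW (fst p) (snd p)))" if "lin_on fscale sX tspace h" for h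
  proof -
    have "tens sV sW (fst p) (snd p) \<in> tspace" if "p \<in> set ps" for p
      using tens_in_tspace that ps(1) by (auto dest: subsetD)
    from lin_on_sum_list(1)[OF vector_space_fscale subspace_tspace assms(1) that this]
    show ?thesis by (simp add: ps(2) split_def)
  qed
  have "(\<Sum>p\<leftarrow>ps. f (tens sV sW (fst p) (snd p))) = (\<Sum>p\<leftarrow>ps. g (tens sV sW (fst p) (snd p)))"
    using ps(1) eq by (intro arg_cong[of _ _ sum_list] map_cong) auto
  then show ?thesis using *[OF f] *[OF g] by simp
qed

end

section \<open>Separation of tensors by evaluation in the left factor\<close>

lemma sum_fscale_apply: "(\<Sum>e\<in>E. fscale (c e) (h e)) a = (\<Sum>e\<in>E. c e * h e a)"
  by (induction E rule: infinite_finite_induct) (auto simp: fscale_def)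

text \<open>Expand the left factors in a finite basis E of their span and collect t as the sum of e
  \<otimes> u_e. The hypothesis makes the sum of e(a) u_e vanish for every a. If some u_e were
  nonzero, a functional g with g(u_e) = 1 would give a vanishing linear combination of the functions
  in E with a nonzero coefficient. So all u_e are 0, and t with them.\<close>

lemma function_tensor_eq_0:
  fixes t :: "('k::field, 'a \<Rightarrow> 'k, 'w::ab_group_add) tensor"
  assumes sW: "vector_space sW" "module.subspace sW W" and V: "module.subspace fscale V"
    and t: "t \<in> tensor_space fscale sW V W"
    and 0: "\<And>a. tlift fscale sW V W (\<lambda>\<phi> w. sW (\<phi> a) w) t = 0"
  shows "t = 0"
proof -
  interpret F: vector_space "fscale :: 'k \<Rightarrow> ('a \<Rightarrow> 'k) \<Rightarrow> _" by (rule vector_space_fscale)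
  interpret W: vector_space sW by fact
  interpret K: vector_space "(*) :: 'k \<Rightarrow> 'k \<Rightarrow> 'k" by (rule vector_space_times)
  interpret WK: vector_space_pair sW "(*) :: 'k \<Rightarrow> 'k \<Rightarrow> 'k" ..
  obtain ps where ps: "set ps \<subseteq> V \<times> W" "t = (\<Sum>(v, w)\<leftarrow>ps. tens fscale sW v w)"
    using tensor_space_sum_list[OF vector_space_fscale sW(1) V t] .
  define n v w where "n = length ps" and "v = (\<lambda>i. fst (ps ! i))" and "w = (\<lambda>i. snd (ps ! i))"
  have sum: "(\<Sum>(a, b)\<leftarrow>ps. h a b) = (\<Sum>i<n. h (v i) (w i))" for h :: "_ \<Rightarrow> _ \<Rightarrow> 'z::ab_group_add"
    by (simp add: sum_list_sum_nth n_def v_def w_def atLeast0LessThan split_def)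
  obtain E where E: "E \<subseteq> v ` {..<n}" "F.independent E" "v ` {..<n} \<subseteq> F.span E"
    using F.maximal_independent_subset by blast
  have fin: "finite E" using E(1) by (rule finite_subset) simp
  define r where "r = (\<lambda>i. F.representation E (v i))"
  have r: "v i = (\<Sum>e\<in>E. fscale (r i e) e)" if "i < n" for i
    unfolding r_def using F.sum_representation_eq[OF E(2) _ fin order_refl, of "v i"] E(3) that by auto
  \<comment> \<open>The sum is u_e, the right factor that accompanies the basis element e.\<close>
  have w0: "(\<Sum>i<n. sW (r i e) (w i)) = 0" if e: "e \<in> E" for e
  proof (rule ccontr)
    assume ne: "(\<Sum>i<n. sW (r i e) (w i)) \<noteq> 0"
    then have "W.independent {\<Sum>i<n. sW (r i e) (w i)}" by (simp add: W.dependent_single)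
    from WK.linear_independent_extend[OF this, of "\<lambda>_. 1"]
    obtain g where g: "Vector_Spaces.linear sW (*) g" and g1: "g (\<Sum>i<n. sW (r i e) (w i)) = 1"
      by auto
    interpret g: Vector_Spaces.linear sW "(*)" g by fact
    have vg: "(\<Sum>i<n. v i a * g (w i)) = 0" for a
    proof -
      have "bilinear_on fscale sW sW V W (\<lambda>\<phi> w. sW (\<phi> a) w)"
        by (simp add: bilinear_on_def fscale_def W.scale_left_distrib W.scale_right_distrib mult.commute)
      note lft = tlift_sum_list[OF vector_space_fscale sW(1) sW(1) V sW(2) this ps(1)]
      have "(\<Sum>i<n. sW (v i a) (w i)) = 0"
        using lft 0[of a] unfolding ps(2) sum by (rule trans[OF sym])
      from arg_cong[OF this, of g] show ?thesis by (simp add: g.sum g.scale g.zero)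
    qed
    have ve: "v i a = (\<Sum>e\<in>E. r i e * e a)" if "i < n" for i a
    proof -
      have "v i a = (\<Sum>e\<in>E. fscale (r i e) e) a" by (rule arg_cong[OF r[OF that]])
      then show ?thesis by (simp only: sum_fscale_apply)
    qed
    have "(\<Sum>i<n. (\<Sum>e\<in>E. r i e * e a) * g (w i)) = 0" for a
      unfolding vg[of a, symmetric] by (rule sum.cong[OF refl]) (simp only: lessThan_iff ve)
    then have *: "(\<Sum>e\<in>E. (\<Sum>i<n. r i e * g (w i)) * e a) = 0" for a
      unfolding sum_distrib_right by (subst sum.swap) (simp only: mult_ac)
    have "(\<Sum>e\<in>E. fscale (\<Sum>i<n. r i e * g (w i)) e) = 0"
    proof
      fix a
      show "(\<Sum>e\<in>E. fscale (\<Sum>i<n. r i e * g (w i)) e) a = 0 a" by (simp add: sum_fscale_apply *)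
    qed
    from F.independentD[OF E(2) fin order_refl this e] have "g (\<Sum>i<n. sW (r i e) (w i)) = 0"
      by (simp add: g.sum g.scale)
    with g1 show False by simp
  qed
  show "t = 0"
  proof
    fix f
    show "t f = 0 f"
    proof (cases "bilinear_on fscale sW (*) UNIV UNIV f")
      case True
      interpret f: Vector_Spaces.linear sW "(*)" "f e" for e
        using True by unfold_locales (auto simp: bilinear_on_def)
      interpret f': Vector_Spaces.linear fscale "(*)" "\<lambda>e. f e x" for x
        using True by unfold_locales (auto simp: bilinear_on_def)
      have "t f = (\<Sum>(v, w)\<leftarrow>ps. f v w)"
        unfolding ps(2) by (rule sum_list_tens_eval[OF True])
      also have "\<dots> = (\<Sum>i<n. f (v i) (w i))" by (rule sum)
      also have "\<dots> = (\<Sum>i<n. \<Sum>e\<in>E. r i e * f e (w i))"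
      proof (rule sum.cong)
        fix i assume "i \<in> {..<n}"
        then have "f (v i) (w i) = f (\<Sum>e\<in>E. fscale (r i e) e) (w i)" using r by (metis lessThan_iff)
        also have "\<dots> = (\<Sum>e\<in>E. r i e * f e (w i))" by (simp only: f'.sum f'.scale)
        finally show "f (v i) (w i) = (\<Sum>e\<in>E. r i e * f e (w i))" .
      qed simp
      also have "\<dots> = (\<Sum>e\<in>E. f e (\<Sum>i<n. sW (r i e) (w i)))"
        by (subst sum.swap) (simp add: f.sum f.scale)
      also have "\<dots> = 0" by (simp add: w0 f.zero)
      finally show ?thesis by simp
    next
      \<comment> \<open>\<open>tens\<close> is 0 by definition at arguments that are not bilinear,
        so t vanishes there as well.\<close>
      case False
      have "(\<Sum>(v, w)\<leftarrow>qs. tens fscale sW v w) f = 0" for qs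
        using False by (induction qs) (auto simp: tens_def)
      then show ?thesis by (simp add: ps(2))
    qed
  qed
qed

section \<open>Sweedler calculus\<close>

lemma sum_list_swap:
  "(\<Sum>p\<leftarrow>ps. \<Sum>q\<leftarrow>qs. f p q) = (\<Sum>q\<leftarrow>qs. \<Sum>p\<leftarrow>ps. f p q :: 'a::comm_monoid_add)"
  by (induction ps) (simp_all add: sum_list_addf)

lemma subspace_UNIV_if_vector_space: "vector_space sV \<Longrightarrow> module.subspace sV UNIV"
proof -
  assume "vector_space sV"
  then interpret vector_space sV .
  show ?thesis by (rule subspace_UNIV)
qed

lemma lin_on_iff_linear:
  assumes "vector_space sV" "vector_space sX"
  shows "lin_on sV sX UNIV f \<longleftrightarrow> Vector_Spaces.linear sV sX f"
  using assms by (auto simp: lin_on_def Vector_Spaces.linear_iff)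

context hopf_algebra
begin

sublocale BB: tensor_pair "hscale B" "hscale B" UNIV UNIV
proof -
  interpret Vector_Spaces.vector_space "hscale B" by (rule vector_space)
  show "tensor_pair (hscale B) (hscale B) UNIV UNIV"
    by (rule tensor_pair.intro) (rule vector_space subspace_UNIV)+
qed

abbreviation lin ::
  "('k \<Rightarrow> 'v::ab_group_add \<Rightarrow> 'v) \<Rightarrow> ('k \<Rightarrow> 'x::ab_group_add \<Rightarrow> 'x) \<Rightarrow> ('v \<Rightarrow> 'x) \<Rightarrow> bool"
  where "lin sV sX \<equiv> lin_on sV sX UNIV"

abbreviation bil :: "('k \<Rightarrow> 'x::ab_group_add \<Rightarrow> 'x) \<Rightarrow> ('b \<Rightarrow> 'b \<Rightarrow> 'x) \<Rightarrow> bool"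
  where "bil sX \<equiv> bilinear_on (hscale B) (hscale B) sX UNIV UNIV"

lemma subspace_UNIV_B: "module.subspace (hscale B) UNIV"
  by (rule BB.sub)

lemmas subspace_UNIV_K = subspace_UNIV_if_vector_space[OF vector_space_times]
lemmas subspace_UNIV_fscale = subspace_UNIV_if_vector_space[OF vector_space_fscale]

lemma lin_on_antipode: "lin_on sV (hscale B) V g \<Longrightarrow> lin_on sV (hscale B) V (\<lambda>v. antipode B (g v))"
  by (rule lin_on_comp[of "hscale B" _ UNIV])
    (auto simp: lin_on_iff_linear[OF vector_space vector_space] antipode_linear)

lemma lin_on_counit: "lin_on sV (hscale B) V g \<Longrightarrow> lin_on sV (*) V (\<lambda>v. counit B (g v))"
  by (rule lin_on_comp[of "hscale B" _ UNIV])
    (auto simp: lin_on_iff_linear[OF vector_space vector_space_times] counit_linear)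

lemma lin_on_comult: "lin_on sV (hscale B) V g \<Longrightarrow> lin_on sV fscale V (\<lambda>v. comult B (g v))"
  by (rule lin_on_comp[of "hscale B" _ UNIV])
    (auto simp: lin_on_iff_linear[OF vector_space vector_space_fscale] comult_linear)

lemma lin_on_mult:
  assumes "lin_on sV (hscale B) V g"
  shows lin_on_mult_left: "lin_on sV (hscale B) V (\<lambda>v. g v * c)"
    and lin_on_mult_right: "lin_on sV (hscale B) V (\<lambda>v. c * g v)"
  using assms by (simp_all add: lin_on_def distrib_left distrib_right scale_mult_left scale_mult_right)

lemma lin_on_times:
  fixes g :: "'v::ab_group_add \<Rightarrow> 'k"
  assumes "lin_on sV (*) V g"
  shows lin_on_times_left: "lin_on sV (*) V (\<lambda>v. g v * c)"
    and lin_on_times_right: "lin_on sV (*) V (\<lambda>v. c * g v)"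
  using assms by (simp_all add: lin_on_def algebra_simps)

lemma lin_on_sw:
  assumes "vector_space sX" "bil sX f" "lin_on sV (hscale B) V g"
  shows "lin_on sV sX V (\<lambda>v. sw B f (g v))"
  unfolding sw_def using assms by (intro BB.lin_on_lift_arg lin_on_comult comult_in)

lemma lin_on_sw_fun:
  assumes "vector_space sX" "vector_space sU" "module.subspace sU U"
    and "\<And>u. u \<in> U \<Longrightarrow> bil sX (F u)" "\<And>x y. lin_on sU sX U (\<lambda>u. F u x y)"
  shows "lin_on sU sX U (\<lambda>u. sw B (F u) b)"
  unfolding sw_def using assms by (intro BB.lin_on_lift_fun comult_in)

lemma sw_comm:
  assumes "vector_space sX" "module.subspace sX X" "vector_space sY" "lin_on sX sY X h" "bil sX f"
    and "\<And>x y. f x y \<in> X"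
  shows "h (sw B f b) = sw B (\<lambda>x y. h (f x y)) b"
  unfolding sw_def using BB.lift_comm(1)[OF assms(1-5) _ comult_in] assms(6) by simp

lemma sw_closed:
  assumes "vector_space sX" "module.subspace sX X" "bil sX f" "\<And>x y. f x y \<in> X"
  shows "sw B f b \<in> X"
  unfolding sw_def using BB.lift_closed[OF assms(1-3) _ comult_in] assms(4) by simp

lemma sw_cong: "(\<And>x y. f x y = g x y) \<Longrightarrow> sw B f b = sw B g b"
  by presburger

lemma lin_on_tens_left:
  assumes "vector_space sX" "vector_space sY" "lin_on sV sX V g"
  shows "lin_on sV fscale V (\<lambda>v. tens sX sY (g v) c)"
  using bilinear_on_tens[OF assms(1,2)] assms(3) by (simp add: lin_on_def bilinear_on_def)

lemma lin_on_tens_right: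
  assumes "vector_space sX" "vector_space sY" "lin_on sV sY V g"
  shows "lin_on sV fscale V (\<lambda>v. tens sX sY c (g v))"
  using bilinear_on_tens[OF assms(1,2)] assms(3) by (simp add: lin_on_def bilinear_on_def)

text \<open>Most of these rules reduce linearity of an expression in one variable to linearity of
  its subexpressions; repeated resolution with the list discharges the bilinearity conditions of the
  Sweedler steps. The vector space and subspace facts that they require are included.\<close>

lemmas lin_rules =
  lin_on_id lin_on_antipode lin_on_counit lin_on_mult_left lin_on_mult_right
  lin_on_times_left lin_on_times_right
  lin_on_scale_left[OF vector_space] lin_on_scale_right[OF vector_space]
  lin_on_scale_left[OF vector_space_fscale] lin_on_scale_right[OF vector_space_fscale]
  lin_on_sw lin_on_sw_fun lin_on_tens_left lin_on_tens_right lin_on_comult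
  bilinear_onI vector_space vector_space_fscale vector_space_times UNIV_I
  subspace_UNIV_B subspace_UNIV_K subspace_UNIV_fscale

text \<open>The linear map induced by \<open>f\<close> is applied to \<open>comult_mult\<close> and
  pushed under both Sweedler sums. It is used as a map on \<open>BB.tspace\<close>, so the inner sum
  must be known to stay there.\<close>

lemma sw_mult:
  assumes [intro]: "vector_space sX" and f: "bil sX f"
  shows "sw B f (a * b) = sw B (\<lambda>a1 a2. sw B (\<lambda>b1 b2. f (a1 * b1) (a2 * b2)) b) a"
proof -
  note lift = BB.lin_on_lift[OF assms]
  have T: "tens (hscale B) (hscale B) x y \<in> BB.tspace" for x y
    by (rule BB.tens_in_tspace) auto
  have "sw B f (a * b) = BB.lift f (sw B (\<lambda>a1 a2. sw B (\<lambda>b1 b2.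
      tens (hscale B) (hscale B) (a1 * b1) (a2 * b2)) b) a)"
    unfolding sw_def[of _ f] comult_mult ..
  also have "\<dots> = sw B (\<lambda>a1 a2. BB.lift f (sw B (\<lambda>b1 b2.
      tens (hscale B) (hscale B) (a1 * b1) (a2 * b2)) b)) a"
    by (rule sw_comm[OF vector_space_fscale BB.subspace_tspace assms(1) lift])
      (rule lin_rules sw_closed[OF vector_space_fscale BB.subspace_tspace] T | assumption)+
  also have "\<dots> = sw B (\<lambda>a1 a2. sw B (\<lambda>b1 b2.
      BB.lift f (tens (hscale B) (hscale B) (a1 * b1) (a2 * b2))) b) a"
    by (rule sw_cong, rule sw_comm[OF vector_space_fscale BB.subspace_tspace assms(1) lift])
      (rule lin_rules T | assumption)+
  also have "\<dots> = sw B (\<lambda>a1 a2. sw B (\<lambda>b1 b2. f (a1 * b1) (a2 * b2)) b) a"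
    by (simp add: BB.lift_tens[OF assms])
  finally show ?thesis .
qed

lemma sw_one:
  assumes "vector_space sX" "bil sX f"
  shows "sw B f 1 = f 1 1"
  by (simp add: sw_def comult_one BB.lift_tens[OF assms])

lemma sw_counit_left:
  assumes "vector_space sX" and g: "lin (hscale B) sX g"
  shows "sw B (\<lambda>x y. sX (counit B x) (g y)) b = g b"
proof -
  have "g b = g (sw B (\<lambda>x y. hscale B (counit B x) y) b)" by (simp add: counit_left)
  also have "\<dots> = sw B (\<lambda>x y. g (hscale B (counit B x) y)) b"
    by (rule sw_comm[OF vector_space subspace_UNIV_B assms]) (rule lin_rules | assumption)+
  finally show ?thesis by (simp add: lin_onD(2)[OF g])
qed

lemma sw_counit_right:
  assumes "vector_space sX" and g: "lin (hscale B) sX g"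
  shows "sw B (\<lambda>x y. sX (counit B y) (g x)) b = g b"
proof -
  have "g b = g (sw B (\<lambda>x y. hscale B (counit B y) x) b)" by (simp add: counit_right)
  also have "\<dots> = sw B (\<lambda>x y. g (hscale B (counit B y) x)) b"
    by (rule sw_comm[OF vector_space subspace_UNIV_B assms]) (rule lin_rules | assumption)+
  finally show ?thesis by (simp add: lin_onD(2)[OF g])
qed

lemma sw_antipode_left:
  assumes "vector_space sX" and g: "lin (hscale B) sX g"
  shows "sw B (\<lambda>x y. g (antipode B x * y)) b = sX (counit B b) (g 1)"
proof -
  have "sX (counit B b) (g 1) = g (sw B (\<lambda>x y. antipode B x * y) b)"
    by (simp add: antipode_left lin_onD(2)[OF g])
  also have "\<dots> = sw B (\<lambda>x y. g (antipode B x * y)) b"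
    by (rule sw_comm[OF vector_space subspace_UNIV_B assms]) (rule lin_rules | assumption)+
  finally show ?thesis by simp
qed

lemma sw_antipode_right:
  assumes "vector_space sX" and g: "lin (hscale B) sX g"
  shows "sw B (\<lambda>x y. g (x * antipode B y)) b = sX (counit B b) (g 1)"
proof -
  have "sX (counit B b) (g 1) = g (sw B (\<lambda>x y. x * antipode B y) b)"
    by (simp add: antipode_right lin_onD(2)[OF g])
  also have "\<dots> = sw B (\<lambda>x y. g (x * antipode B y)) b"
    by (rule sw_comm[OF vector_space subspace_UNIV_B assms]) (rule lin_rules | assumption)+
  finally show ?thesis by simp
qed

text \<open>With lists representing the two coproducts fixed, this is the interchange of two finite
  sums. Separate linearity in all four variables makes the inner and the outer sums lifts of
  bilinear maps.\<close>

lemma sw_swap: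
  assumes "vector_space sX"
    and "\<And>y u v. lin (hscale B) sX (\<lambda>x. F x y u v)" "\<And>x u v. lin (hscale B) sX (\<lambda>y. F x y u v)"
    and "\<And>x y v. lin (hscale B) sX (\<lambda>u. F x y u v)" "\<And>x y u. lin (hscale B) sX (\<lambda>v. F x y u v)"
  shows "sw B (\<lambda>x y. sw B (\<lambda>u v. F x y u v) b) a = sw B (\<lambda>u v. sw B (\<lambda>x y. F x y u v) a) b"
proof -
  note r = lin_rules assms
  obtain ps where ps: "\<And>f. bil sX f \<Longrightarrow> sw B f a = (\<Sum>(v, w)\<leftarrow>ps. f v w)"
    using BB.lift_sum_list[OF comult_in[of a]] assms(1) unfolding sw_def by metis
  obtain qs where qs: "\<And>f. bil sX f \<Longrightarrow> sw B f b = (\<Sum>(v, w)\<leftarrow>qs. f v w)"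
    using BB.lift_sum_list[OF comult_in[of b]] assms(1) unfolding sw_def by metis
  have "sw B (\<lambda>x y. sw B (\<lambda>u v. F x y u v) b) a = (\<Sum>(x, y)\<leftarrow>ps. sw B (\<lambda>u v. F x y u v) b)"
    by (rule ps) (rule r)+
  moreover have "sw B (\<lambda>u v. F x y u v) b = (\<Sum>(u, v)\<leftarrow>qs. F x y u v)" for x y
    by (rule qs) (rule r)+
  moreover have "sw B (\<lambda>u v. sw B (\<lambda>x y. F x y u v) a) b = (\<Sum>(u, v)\<leftarrow>qs. sw B (\<lambda>x y. F x y u v) a)"
    by (rule qs) (rule r)+
  moreover have "sw B (\<lambda>x y. F x y u v) a = (\<Sum>(x, y)\<leftarrow>ps. F x y u v)" for u v
    by (rule ps) (rule r)+
  ultimately show ?thesis by (simp add: split_def sum_list_swap[of _ qs ps])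
qed

text \<open>The axiom \<open>coassoc\<close> is an equality in B \<otimes> (B \<otimes> B), so it is
  transferred to \<open>f\<close> by the linear map that \<open>f\<close> induces there.\<close>

lemma sw_coassoc:
  assumes "vector_space sX"
    and f: "\<And>y z. lin (hscale B) sX (\<lambda>x. f x y z)" "\<And>x z. lin (hscale B) sX (\<lambda>y. f x y z)"
      "\<And>x y. lin (hscale B) sX (\<lambda>z. f x y z)"
  shows "sw B (\<lambda>x z. sw B (\<lambda>x1 x2. f x1 x2 z) x) b = sw B (\<lambda>x y. sw B (\<lambda>y1 y2. f x y1 y2) y) b"
proof -
  interpret T: tensor_pair "hscale B" "fscale :: 'k \<Rightarrow> ('k, 'b, 'b) tensor \<Rightarrow> _" UNIV BB.tspace
    by (rule tensor_pair.intro)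
      (rule vector_space vector_space_fscale subspace_UNIV_B BB.subspace_tspace)+
  \<comment> \<open>\<open>h\<close> lifts \<open>f\<close> to B \<otimes> B in its last two
    arguments; lifting \<open>h\<close> once more gives the map on B \<otimes> (B \<otimes>
    B).\<close>
  define h where "h = (\<lambda>x. BB.lift (\<lambda>y z. f x y z))"
  note r = lin_rules f assms(1)
  have bf: "bil sX (\<lambda>y z. f x y z)" for x by (rule r)+
  have bh: "bilinear_on (hscale B) fscale sX UNIV BB.tspace h"
    unfolding h_def
    by (rule bilinear_onI)
     (rule BB.lin_on_lift_fun BB.lin_on_lift r | assumption)+
  note H = T.lin_on_lift[OF assms(1) bh]
  have tt: "tens (hscale B) (hscale B) x y \<in> BB.tspace" for x y by (rule BB.tens_in_tspace) auto
  have T: "tens (hscale B) fscale x t \<in> T.tspace" if "t \<in> BB.tspace" for x t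
    using that by (intro T.tens_in_tspace) auto
  note c = sw_comm[OF vector_space_fscale T.subspace_tspace assms(1) H]
  have hT: "T.lift h (tens (hscale B) fscale x t) = BB.lift (\<lambda>y z. f x y z) t" if "t \<in> BB.tspace" for x t
    using T.lift_tens[OF assms(1) bh _ that] by (simp add: h_def)
  have "T.lift h (sw B (\<lambda>x z. sw B (\<lambda>x1 x2.
          tens (hscale B) fscale x1 (tens (hscale B) (hscale B) x2 z)) x) b) =
    sw B (\<lambda>x z. T.lift h (sw B (\<lambda>x1 x2.
          tens (hscale B) fscale x1 (tens (hscale B) (hscale B) x2 z)) x)) b"
    by (rule c) (rule lin_rules sw_closed[OF vector_space_fscale T.subspace_tspace] T tt)+
  also have "\<dots> = sw B (\<lambda>x z. sw B (\<lambda>x1 x2.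
          T.lift h (tens (hscale B) fscale x1 (tens (hscale B) (hscale B) x2 z))) x) b"
    by (rule sw_cong, rule c) (rule lin_rules T tt)+
  also have "\<dots> = sw B (\<lambda>x z. sw B (\<lambda>x1 x2. f x1 x2 z) x) b"
    by (simp add: hT tt BB.lift_tens[OF assms(1) bf])
  finally have 1: "sw B (\<lambda>x z. sw B (\<lambda>x1 x2. f x1 x2 z) x) b =
    T.lift h (sw B (\<lambda>x y. tens (hscale B) fscale x (comult B y)) b)" by (simp add: coassoc)
  also have "\<dots> = sw B (\<lambda>x y. T.lift h (tens (hscale B) fscale x (comult B y))) b"
    by (rule c) (rule lin_rules T comult_in)+
  also have "\<dots> = sw B (\<lambda>x y. sw B (\<lambda>y1 y2. f x y1 y2) y) b"
    by (simp add: hT comult_in sw_def)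
  finally show ?thesis .
qed

section \<open>The antipode\<close>

lemma antipode_one: "antipode B 1 = 1"
proof -
  have "sw B (\<lambda>x y. antipode B x * y) 1 = antipode B 1 * 1"
    by (rule sw_one[OF vector_space]) (rule lin_rules)+
  moreover have "hscale B 1 1 = 1"
    using module.scale_one[of "hscale B"] vector_space vector_space.vector_space_assms(4) by blast
  ultimately show ?thesis by (simp add: antipode_left counit_one)
qed

text \<open>Both \<open>S(ab)\<close> and \<open>S(b)S(a)\<close> are convolution inverses of the multiplication: the sum
  \<open>S(a'b') a''b'' S(b''')S(a''')\<close> is evaluated by contracting the last or the first two factors.\<close>

lemma antipode_mult: "antipode B (a * b) = antipode B b * antipode B a"
proof -
  let ?S = "antipode B" and ?s = "hscale B" and ?e = "counit B"
  define G where "G = (\<lambda>a1 b1 a2 b2 a3 b3. ?S (a1 * b1) * (a2 * b2) * (?S b3 * ?S a3))"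
  \<comment> \<open>Rebracketing makes b'' and S(b''') adjacent, as the contraction from the right
    requires.\<close>
  have G': "G a1 b1 a2 b2 a3 b3 = ?S (a1 * b1) * a2 * (b2 * ?S b3) * ?S a3" for a1 b1 a2 b2 a3 b3
    by (simp add: G_def mult.assoc)
  note r = lin_rules
  have "sw B (\<lambda>a' a3. sw B (\<lambda>a1 a2. sw B (\<lambda>b' b3. sw B (\<lambda>b1 b2. G a1 b1 a2 b2 a3 b3) b') b) a') a
      = sw B (\<lambda>a1 a'. sw B (\<lambda>a2 a3. sw B (\<lambda>b' b3. sw B (\<lambda>b1 b2. G a1 b1 a2 b2 a3 b3) b') b) a') a"
    unfolding G_def by (rule sw_coassoc) (rule r)+
  also have "\<dots> = sw B (\<lambda>a1 a'. sw B (\<lambda>a2 a3. ?S (a1 * b) * a2 * ?S a3) a') a"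
  proof (intro sw_cong)
    fix a1 a2 a3
    have "sw B (\<lambda>b' b3. sw B (\<lambda>b1 b2. G a1 b1 a2 b2 a3 b3) b') b
      = sw B (\<lambda>b1 b'. sw B (\<lambda>b2 b3. G a1 b1 a2 b2 a3 b3) b') b"
      unfolding G_def by (rule sw_coassoc) (rule r)+
    also have "\<dots> = sw B (\<lambda>b1 b'. ?s (?e b') (?S (a1 * b1) * a2 * 1 * ?S a3)) b"
      unfolding G' by (intro sw_cong sw_antipode_right) (rule r)+
    also have "\<dots> = ?S (a1 * b) * a2 * 1 * ?S a3"
      by (rule sw_counit_right) (rule r)+
    finally show "sw B (\<lambda>b' b3. sw B (\<lambda>b1 b2. G a1 b1 a2 b2 a3 b3) b') b = ?S (a1 * b) * a2 * ?S a3"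
      by simp
  qed
  also have "\<dots> = sw B (\<lambda>a1 a'. ?s (?e a') (?S (a1 * b) * 1)) a"
    unfolding mult.assoc by (intro sw_cong sw_antipode_right) (rule r)+
  also have "\<dots> = ?S (a * b) * 1"
    by (rule sw_counit_right) (rule r)+
  finally have 1: "sw B (\<lambda>a' a3. sw B (\<lambda>a1 a2. sw B (\<lambda>b' b3. sw B (\<lambda>b1 b2. G a1 b1 a2 b2 a3 b3) b') b) a') a
    = ?S (a * b)" by simp
  \<comment> \<open>For the contraction from the left, the two splittings are interchanged so that
    the first two components of a and of b combine into the coproduct of the product a'b'.\<close>
  have "sw B (\<lambda>a' a3. sw B (\<lambda>a1 a2. sw B (\<lambda>b' b3. sw B (\<lambda>b1 b2. G a1 b1 a2 b2 a3 b3) b') b) a') a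
     = sw B (\<lambda>a' a3. sw B (\<lambda>b' b3. sw B (\<lambda>a1 a2. sw B (\<lambda>b1 b2. G a1 b1 a2 b2 a3 b3) b') a') b) a"
    unfolding G_def by (intro sw_cong, rule sw_swap) (rule r)+
  also have "\<dots> = sw B (\<lambda>a' a3. sw B (\<lambda>b' b3. sw B (\<lambda>x y. ?S x * y * (?S b3 * ?S a3)) (a' * b')) b) a"
    unfolding G_def by (intro sw_cong, rule sw_mult[symmetric]) (rule r)+
  also have "\<dots> = sw B (\<lambda>a' a3. sw B (\<lambda>b' b3. ?s (?e (a' * b')) (1 * (?S b3 * ?S a3))) b) a"
    by (intro sw_cong sw_antipode_left) (rule r)+
  also have "\<dots> = sw B (\<lambda>a' a3. sw B (\<lambda>b' b3. ?s (?e b') (?s (?e a') (?S b3 * ?S a3))) b) a"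
    by (simp add: counit_mult BB.vs vector_space.vector_space_assms(3)[OF vector_space] mult.commute)
  also have "\<dots> = sw B (\<lambda>a' a3. ?s (?e a') (?S b * ?S a3)) a"
    by (intro sw_cong sw_counit_left) (rule r)+
  also have "\<dots> = ?S b * ?S a"
    by (rule sw_counit_left) (rule r)+
  finally show ?thesis unfolding 1 .
qed

text \<open>Both sides are convolution inverses of the coproduct: \<open>\<Delta>(S(b')) \<Delta>(b'') (S \<otimes> S) \<Delta>\<^sup>c\<^sup>o\<^sup>p(b''')\<close>
  is contracted from the left and from the right.\<close>

lemma sw_antipode:
  assumes sX: "vector_space sX" and f: "bil sX f"
  shows "sw B f (antipode B b) = sw B (\<lambda>x y. f (antipode B y) (antipode B x)) b"
proof -
  let ?S = "antipode B" and ?e = "counit B"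
  \<comment> \<open>\<open>H z b3\<close> is f applied to the product of \<Delta>(z) with S(d)
    \<otimes> S(c), where c and d are the components of \<open>b3\<close> in this order.\<close>
  define H where "H = (\<lambda>z b3. sw B (\<lambda>c d. sw B (\<lambda>P Q. f (P * ?S d) (Q * ?S c)) z) b3)"
  note r = lin_rules sX lin_on_comp[OF bilinear_onD(1)[OF f UNIV_I]]
    lin_on_comp[OF bilinear_onD(2)[OF f UNIV_I]]
  have "sw B (\<lambda>b' b3. sw B (\<lambda>b1 b2. H (?S b1 * b2) b3) b') b = sw B (\<lambda>b' b3. sX (?e b') (H 1 b3)) b"
    unfolding H_def by (intro sw_cong, rule sw_antipode_left[OF sX]) (rule r)+
  also have "\<dots> = H 1 b"
    unfolding H_def by (rule sw_counit_left[OF sX]) (rule r)+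
  also have "\<dots> = sw B (\<lambda>c d. f (1 * ?S d) (1 * ?S c)) b"
    unfolding H_def by (intro sw_cong, rule sw_one[OF sX]) (rule r)+
  finally have 1: "sw B (\<lambda>b' b3. sw B (\<lambda>b1 b2. H (?S b1 * b2) b3) b') b =
    sw B (\<lambda>x y. f (?S y) (?S x)) b" by simp
  have "sw B (\<lambda>b' b3. sw B (\<lambda>b1 b2. H (?S b1 * b2) b3) b') b
    = sw B (\<lambda>b1 b'. sw B (\<lambda>b2 b3. H (?S b1 * b2) b3) b') b"
    unfolding H_def by (rule sw_coassoc[OF sX]) (rule r)+
  also have "\<dots> = sw B (\<lambda>b1 b'. sX (?e b') (sw B f (?S b1))) b"
  proof (intro sw_cong)
    fix b1 b'
    let ?M = "\<lambda>p q u v c d. f (p * (u * ?S d)) (q * (v * ?S c))"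
    have "H (?S b1 * b2) b3 =
       sw B (\<lambda>p q. sw B (\<lambda>u v. sw B (\<lambda>c d. ?M p q u v c d) b3) b2) (?S b1)" for b2 b3
    proof -
      have "H (?S b1 * b2) b3 = sw B (\<lambda>c d. sw B (\<lambda>p q. sw B (\<lambda>u v. ?M p q u v c d) b2) (?S b1)) b3"
        unfolding H_def mult.assoc[symmetric] by (intro sw_cong, rule sw_mult[OF sX]) (rule r)+
      also have "\<dots> = sw B (\<lambda>p q. sw B (\<lambda>c d. sw B (\<lambda>u v. ?M p q u v c d) b2) b3) (?S b1)"
        by (rule sw_swap[OF sX]) (rule r)+
      also have "\<dots> = sw B (\<lambda>p q. sw B (\<lambda>u v. sw B (\<lambda>c d. ?M p q u v c d) b3) b2) (?S b1)"
        by (intro sw_cong, rule sw_swap[OF sX]) (rule r)+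
      finally show ?thesis .
    qed
    then have "sw B (\<lambda>b2 b3. H (?S b1 * b2) b3) b' =
      sw B (\<lambda>b2 b3. sw B (\<lambda>p q. sw B (\<lambda>u v. sw B (\<lambda>c d. ?M p q u v c d) b3) b2) (?S b1)) b'"
      by simp
    also have "\<dots> = sw B (\<lambda>p q. sw B (\<lambda>b2 b3. sw B (\<lambda>u v. sw B (\<lambda>c d. ?M p q u v c d) b3) b2) b') (?S b1)"
      by (rule sw_swap[OF sX]) (rule r)+
    also have "\<dots> = sw B (\<lambda>p q. sX (?e b') (f p q)) (?S b1)"
    proof (intro sw_cong)
      fix p q
      \<comment> \<open>Here b' carries four components u, v, c, d. Two rebracketings make v and c a
        pair; v S(c) contracts to a counit, which leaves u and d as neighbours for the last
        contraction.\<close>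
      have "sw B (\<lambda>b2 b3. sw B (\<lambda>u v. sw B (\<lambda>c d. ?M p q u v c d) b3) b2) b' =
        sw B (\<lambda>u y. sw B (\<lambda>v b3. sw B (\<lambda>c d. ?M p q u v c d) b3) y) b'"
        by (rule sw_coassoc[OF sX]) (rule r)+
      also have "\<dots> = sw B (\<lambda>u y. sw B (\<lambda>z d. sw B (\<lambda>v c. ?M p q u v c d) z) y) b'"
        by (rule sw_cong, rule sw_coassoc[OF sX, symmetric]) (rule r)+
      also have "\<dots> = sw B (\<lambda>u y. sw B (\<lambda>z d. sX (?e z) (f (p * (u * ?S d)) (q * 1))) y) b'"
        by (intro sw_cong, rule sw_antipode_right[OF sX]) (rule r)+
      also have "\<dots> = sw B (\<lambda>u y. f (p * (u * ?S y)) (q * 1)) b'"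
        by (intro sw_cong, rule sw_counit_left[OF sX]) (rule r)+
      also have "\<dots> = sX (?e b') (f (p * 1) (q * 1))"
        by (rule sw_antipode_right[OF sX]) (rule r)+
      finally show "sw B (\<lambda>b2 b3. sw B (\<lambda>u v. sw B (\<lambda>c d. ?M p q u v c d) b3) b2) b' = sX (?e b') (f p q)"
        by simp
    qed
    also have "\<dots> = sX (?e b') (sw B f (?S b1))"
      by (rule sw_comm[OF sX subspace_UNIV_if_vector_space[OF sX] sX
         lin_on_scale_right[OF sX lin_on_id] f UNIV_I, symmetric])
    finally show "sw B (\<lambda>b2 b3. H (?S b1 * b2) b3) b' = sX (?e b') (sw B f (?S b1))" .
  qed
  also have "\<dots> = sw B f (?S b)"
    by (rule sw_counit_right[OF sX]) (rule r f)+
  finally show ?thesis unfolding 1 ..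
qed

end

locale hopf_algebra_bij_antipode = hopf_algebra B for B :: "('k::field, 'b::ring_1) hopf" (structure) +
  assumes bij_antipode: "bij (antipode B)"
begin

abbreviation Sinv :: "'b \<Rightarrow> 'b" where "Sinv \<equiv> inv (antipode B)"

lemma antipode_Sinv [simp]: "antipode B (Sinv b) = b"
  by (rule surj_f_inv_f[OF bij_is_surj[OF bij_antipode]])

lemma Sinv_antipode [simp]: "Sinv (antipode B b) = b"
  by (rule inv_f_f[OF bij_is_inj[OF bij_antipode]])

lemma Sinv_eqI: "antipode B x = b \<Longrightarrow> Sinv b = x"
  by auto

lemma lin_on_Sinv:
  assumes "lin_on sV (hscale B) V g"
  shows "lin_on sV (hscale B) V (\<lambda>v. Sinv (g v))"
proof (rule lin_on_comp[OF _ assms UNIV_I], rule lin_onI)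
  show "Sinv (v + v') = Sinv v + Sinv v'" for v v'
    using lin_on_antipode[OF lin_on_id[where V = UNIV]] by (intro Sinv_eqI) (simp add: lin_on_def)
  show "Sinv (hscale B c v) = hscale B c (Sinv v)" for c v
    using lin_on_antipode[OF lin_on_id[where V = UNIV]] by (intro Sinv_eqI) (simp add: lin_on_def)
qed

lemma Sinv_mult: "Sinv (a * b) = Sinv b * Sinv a"
  by (rule Sinv_eqI) (simp add: antipode_mult)

lemma Sinv_one: "Sinv 1 = 1"
  by (rule Sinv_eqI) (rule antipode_one)

text \<open>Applying \<open>Sinv\<close> to S(b') b'' reverses the product and gives S^-1(b'') b',
  while 1 is fixed.\<close>

lemma sw_Sinv:
  assumes "vector_space sX" and g: "lin (hscale B) sX g"
  shows "sw B (\<lambda>x y. g (Sinv y * x)) b = sX (counit B b) (g 1)"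
proof -
  have "sw B (\<lambda>x y. g (Sinv (antipode B x * y))) b = sX (counit B b) (g (Sinv 1))"
    by (rule sw_antipode_left[OF assms(1)]) (rule lin_on_comp[OF g] lin_on_Sinv lin_rules)+
  then show ?thesis by (simp add: Sinv_mult Sinv_one)
qed

end

section \<open>The finite dual\<close>

text \<open>One more functional costs at most one more spanning vector: if it is nonzero at some k
  of the previous intersection K, every element of K differs from an element of the new intersection
  by a multiple of k.\<close>

lemma finite_codimension_kernels:
  assumes "vector_space sV" and "finite A" and "\<forall>\<phi>\<in>A. lin_on sV ((*) :: 'k::field \<Rightarrow> _) UNIV \<phi>"
  shows "\<exists>F. finite F \<and> module.span sV ({x. \<forall>\<phi>\<in>A. \<phi> x = 0} \<union> F) = UNIV"
  using assms(2,3)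
proof (induction A)
  case empty
  interpret vector_space sV by fact
  show ?case by (intro exI[of _ "{}"]) auto
next
  case (insert \<phi> A)
  interpret vector_space sV by fact
  let ?K = "{x. \<forall>\<phi>\<in>A. \<phi> x = 0}" and ?K' = "{x. \<forall>\<phi>\<in>insert \<phi> A. \<phi> x = 0}"
  obtain F where F: "finite F" "span (?K \<union> F) = UNIV" using insert by auto
  have l: "\<psi> (x + sV c y) = \<psi> x + c * \<psi> y" if "\<psi> \<in> insert \<phi> A" for \<psi> x y c
    using insert.prems that by (auto simp: lin_on_def)
  show ?case
  proof (cases "\<exists>k\<in>?K. \<phi> k \<noteq> 0")
    case False
    then have "?K' = ?K" by auto
    then show ?thesis using F by (intro exI[of _ F]) simp
  next
    case True
    then obtain k where k: "k \<in> ?K" "\<phi> k \<noteq> 0" by auto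
    have "?K \<subseteq> span (?K' \<union> insert k F)"
    proof
      fix x assume x: "x \<in> ?K"
      let ?y = "x + sV (- (\<phi> x / \<phi> k)) k"
      have "?y \<in> ?K'" using x k by (auto simp: l simp del: scale_minus_left)
      then have "?y \<in> span (?K' \<union> insert k F)" "k \<in> span (?K' \<union> insert k F)"
        by (auto intro!: span_base)
      then have "?y + sV (\<phi> x / \<phi> k) k \<in> span (?K' \<union> insert k F)"
        by (rule span_add[OF _ span_scale])
      then show "x \<in> span (?K' \<union> insert k F)" by (simp add: scale_minus_left)
    qed
    moreover have "F \<subseteq> span (?K' \<union> insert k F)" by (auto intro!: span_base)
    ultimately have "span (?K \<union> F) \<subseteq> span (?K' \<union> insert k F)"
      by (intro span_minimal subspace_span) auto
    then show ?thesis using F by (intro exI[of _ "insert k F"]) (simp add: top.extremum_unique)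
  qed
qed

section \<open>Two-sided ideals of finite codimension\<close>

context hopf_algebra
begin

definition cofinite_ideal :: "'b set \<Rightarrow> bool" where
  "cofinite_ideal I \<longleftrightarrow> module.subspace (hscale B) I \<and> (\<forall>x\<in>I. \<forall>b. b * x \<in> I \<and> x * b \<in> I) \<and>
     (\<exists>F. finite F \<and> module.span (hscale B) (I \<union> F) = UNIV)"

lemma hdual_iff: "\<beta> \<in> hdual B \<longleftrightarrow> lin (hscale B) (*) \<beta> \<and> (\<exists>I. cofinite_ideal I \<and> (\<forall>x\<in>I. \<beta> x = 0))"
  by (auto simp: hdual_def cofinite_ideal_def lin_on_iff_linear[OF vector_space vector_space_times])

text \<open>Finite codimension is checked by finding finitely many functionals whose common kernel
  lies in I. This avoids choosing a complement each time an ideal is built from others.\<close>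

lemma cofinite_idealI:
  assumes "module.subspace (hscale B) I" "\<And>x b. x \<in> I \<Longrightarrow> b * x \<in> I" "\<And>x b. x \<in> I \<Longrightarrow> x * b \<in> I"
    and "finite A" "\<forall>\<phi>\<in>A. lin (hscale B) (*) \<phi>" "{x. \<forall>\<phi>\<in>A. \<phi> x = 0} \<subseteq> I"
  shows "cofinite_ideal I"
proof -
  interpret V: Vector_Spaces.vector_space "hscale B" by (rule vector_space)
  obtain F where "finite F" "V.span ({x. \<forall>\<phi>\<in>A. \<phi> x = 0} \<union> F) = UNIV"
    using finite_codimension_kernels[OF vector_space assms(4,5)] by auto
  moreover from this have "V.span (I \<union> F) = UNIV"
    using V.span_mono[of "{x. \<forall>\<phi>\<in>A. \<phi> x = 0} \<union> F" "I \<union> F"] assms(6) by auto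
  ultimately show ?thesis using assms(1-3) by (auto simp: cofinite_ideal_def)
qed

text \<open>A basis \<open>I0\<close> of I is extended by elements of the finite set
  \<open>F\<close> to a basis \<open>T\<close> of B. The added vectors \<open>C\<close> span a
  complement of I, and \<open>e c\<close> is the coordinate at c: for c in \<open>C\<close> these
  coordinates vanish on I, cut it out, and expand every functional that vanishes on I.\<close>

lemma cofinite_ideal_coordinates:
  assumes "cofinite_ideal I"
  obtains C e where "finite C" "\<forall>c. lin (hscale B) (*) (e c)" "\<forall>x\<in>I. \<forall>c\<in>C. e c x = 0"
    and "\<forall>\<phi> b. lin (hscale B) (*) \<phi> \<longrightarrow> (\<forall>x\<in>I. \<phi> x = 0) \<longrightarrow> \<phi> b = (\<Sum>c\<in>C. \<phi> c * e c b)"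
    and "I = {x. \<forall>c\<in>C. e c x = 0}"
proof -
  interpret V: Vector_Spaces.vector_space "hscale B" by (rule vector_space)
  obtain F where I: "V.subspace I" and F: "finite F" "V.span (I \<union> F) = UNIV"
    using assms by (auto simp: cofinite_ideal_def)
  obtain I0 where I0: "I0 \<subseteq> I" "V.independent I0" "I \<subseteq> V.span I0"
    using V.maximal_independent_subset by blast
  obtain T where T: "I0 \<subseteq> T" "T \<subseteq> I0 \<union> F" "V.independent T" "I0 \<union> F \<subseteq> V.span T"
    using V.maximal_independent_subset_extend[of I0 "I0 \<union> F"] I0(2) by auto
  have "I \<subseteq> V.span T" using I0(3) V.span_mono[OF T(1)] by auto
  then have "V.span (I \<union> F) \<subseteq> V.span T"
    using T(4) by (intro V.span_minimal V.subspace_span) auto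
  then have UN: "b \<in> V.span T" for b using F(2) by auto
  define C e where "C = T - I0" and "e = (\<lambda>c b. V.representation T b c)"
  have fin: "finite C" unfolding C_def by (rule finite_subset[OF _ F(1)]) (use T(2) in auto)
  have lin_e: "lin (hscale B) (*) (e c)" for c
    by (rule lin_onI)
      (simp_all add: e_def V.representation_add[OF T(3) UN UN] V.representation_scale[OF T(3) UN])
  have van: "e c x = 0" if "x \<in> I" "c \<in> C" for c x
  proof -
    have "x \<in> V.span I0" using that I0(3) by auto
    then have "V.representation T x = V.representation I0 x"
      by (rule V.representation_extend[OF T(3) _ T(1)])
    then show ?thesis using that(2) V.representation_ne_zero[of I0 x c] by (auto simp: e_def C_def)
  qed
  \<comment> \<open>Subtracting the part of b in the span of \<open>C\<close> leaves a combination
    of elements of \<open>I0\<close>.\<close>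
  have dec: "b - (\<Sum>c\<in>C. hscale B (e c b) c) \<in> I" for b
  proof -
    define A where "A = {t. e t b \<noteq> 0}"
    have A: "finite A" "A \<subseteq> T"
      using V.finite_representation[of T b] V.representation_ne_zero[of T b] by (auto simp: A_def e_def)
    have "b = (\<Sum>t\<in>A. hscale B (e t b) t)"
      using V.sum_nonzero_representation_eq[OF T(3) UN[of b]] by (simp add: A_def e_def)
    also have "\<dots> = (\<Sum>t\<in>A \<inter> C. hscale B (e t b) t) + (\<Sum>t\<in>A - C. hscale B (e t b) t)"
      using A(1) by (subst sum.union_disjoint[symmetric]) (auto intro!: sum.cong)
    also have "(\<Sum>t\<in>A \<inter> C. hscale B (e t b) t) = (\<Sum>t\<in>C. hscale B (e t b) t)"
      using fin by (intro sum.mono_neutral_left) (auto simp: A_def)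
    finally have "b - (\<Sum>c\<in>C. hscale B (e c b) c) = (\<Sum>t\<in>A - C. hscale B (e t b) t)"
      by (simp add: algebra_simps)
    moreover have "(\<Sum>t\<in>A - C. hscale B (e t b) t) \<in> I"
      using A(2) I0(1) by (intro V.subspace_sum[OF I] V.subspace_scale[OF I]) (auto simp: C_def)
    ultimately show ?thesis by simp
  qed
  show ?thesis
  proof (rule that[OF fin])
    show "\<forall>c. lin (hscale B) (*) (e c)" using lin_e by simp
    show "\<forall>x\<in>I. \<forall>c\<in>C. e c x = 0" using van by simp
    show "\<forall>\<phi> b. lin (hscale B) (*) \<phi> \<longrightarrow> (\<forall>x\<in>I. \<phi> x = 0) \<longrightarrow> \<phi> b = (\<Sum>c\<in>C. \<phi> c * e c b)"
    proof (intro allI impI)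
      fix \<phi> b assume \<phi>: "lin (hscale B) (*) \<phi>" "\<forall>x\<in>I. \<phi> x = 0"
      interpret \<phi>: Vector_Spaces.linear "hscale B" "(*)" \<phi>
        using \<phi>(1) by (simp add: lin_on_iff_linear[OF vector_space vector_space_times])
      have "\<phi> (b - (\<Sum>c\<in>C. hscale B (e c b) c)) = 0" using \<phi>(2) dec by blast
      then show "\<phi> b = (\<Sum>c\<in>C. \<phi> c * e c b)" by (simp add: \<phi>.diff \<phi>.sum \<phi>.scale mult.commute)
    qed
  next
    show "I = {x. \<forall>c\<in>C. e c x = 0}"
    proof (intro set_eqI iffI)
      fix x assume "x \<in> {x. \<forall>c\<in>C. e c x = 0}"
      then show "x \<in> I" using dec[of x] by (simp cong: sum.cong)
    qed (use van in auto)
  qed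
qed

lemma fscale_apply: "fscale c f x = c * f x"
  by (simp add: fscale_def)

lemma cofinite_ideal_kernels:
  assumes "cofinite_ideal I"
  obtains A where "finite A" "\<forall>\<phi>\<in>A. lin (hscale B) (*) \<phi>" "I = {x. \<forall>\<phi>\<in>A. \<phi> x = 0}"
proof (rule cofinite_ideal_coordinates[OF assms])
  fix C e
  assume C: "finite C" "\<forall>c. lin (hscale B) (*) (e c)" "I = {x. \<forall>c\<in>C. e c x = 0}"
  show thesis
    by (rule that[of "e ` C"]) (use C in auto)
qed

section \<open>Closure properties of the finite dual\<close>

lemma lin_hdual: "\<beta> \<in> hdual B \<Longrightarrow> lin (hscale B) (*) \<beta>"
  by (simp add: hdual_iff)

lemma lin_on_hdual: "\<beta> \<in> hdual B \<Longrightarrow> lin_on sV (hscale B) V g \<Longrightarrow> lin_on sV (*) V (\<lambda>v. \<beta> (g v))"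
  by (rule lin_on_comp[OF lin_hdual _ UNIV_I])

lemma lin_translates:
  assumes "lin (hscale B) (*) \<phi>"
  shows "lin (hscale B) (*) (\<lambda>x. \<phi> (c * x))" and "lin (hscale B) (*) (\<lambda>x. \<phi> (x * c))"
  by (rule lin_on_comp[OF assms lin_on_mult_right[OF lin_on_id] UNIV_I]
      lin_on_comp[OF assms lin_on_mult_left[OF lin_on_id] UNIV_I])+

text \<open>A sum of functionals vanishing on I and J vanishes on I \<inter> J, which again has
  finite codimension because the finite families of functionals cutting out I and J can be
  united.\<close>

lemma subspace_hdual: "module.subspace fscale (hdual B)"
proof -
  interpret vector_space "fscale :: 'k \<Rightarrow> ('b \<Rightarrow> 'k) \<Rightarrow> _" by (rule vector_space_fscale)
  interpret V: Vector_Spaces.vector_space "hscale B" by (rule vector_space)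
  show ?thesis
  proof (rule subspaceI)
    have "cofinite_ideal UNIV"
      by (rule cofinite_idealI[where A = "{}"]) (auto simp: V.subspace_UNIV)
    then show "0 \<in> hdual B"
      unfolding hdual_iff by (intro conjI exI[of _ UNIV] lin_onI) auto
  next
    fix \<alpha> \<beta> assume a: "\<alpha> \<in> hdual B" and b: "\<beta> \<in> hdual B"
    obtain I where I: "cofinite_ideal I" "\<forall>x\<in>I. \<alpha> x = 0" using a by (auto simp: hdual_iff)
    obtain J where J: "cofinite_ideal J" "\<forall>x\<in>J. \<beta> x = 0" using b by (auto simp: hdual_iff)
    obtain A where A: "finite A" "\<forall>\<phi>\<in>A. lin (hscale B) (*) \<phi>" "I = {x. \<forall>\<phi>\<in>A. \<phi> x = 0}"
      using cofinite_ideal_kernels[OF I(1)] .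
    obtain A' where A': "finite A'" "\<forall>\<phi>\<in>A'. lin (hscale B) (*) \<phi>" "J = {x. \<forall>\<phi>\<in>A'. \<phi> x = 0}"
      using cofinite_ideal_kernels[OF J(1)] .
    have "cofinite_ideal (I \<inter> J)"
    proof (rule cofinite_idealI[where A = "A \<union> A'"])
      show "finite (A \<union> A')" using A(1) A'(1) by simp
      show "\<forall>\<phi>\<in>A \<union> A'. lin (hscale B) (*) \<phi>" using A(2) A'(2) by blast
      show "b * x \<in> I \<inter> J" "x * b \<in> I \<inter> J" if "x \<in> I \<inter> J" for x b
        using that I(1) J(1) by (simp_all add: cofinite_ideal_def)
      show "V.subspace (I \<inter> J)"
        using I(1) J(1) by (intro V.subspace_inter) (auto simp: cofinite_ideal_def)
      show "{x. \<forall>\<phi>\<in>A \<union> A'. \<phi> x = 0} \<subseteq> I \<inter> J" unfolding A(3) A'(3) by auto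
    qed
    then show "\<alpha> + \<beta> \<in> hdual B"
      using I(2) J(2) lin_onD[OF lin_hdual[OF a]] lin_onD[OF lin_hdual[OF b]] unfolding hdual_iff
      by (intro conjI exI[of _ "I \<inter> J"] lin_onI) (simp_all add: algebra_simps)
  next
    fix c \<alpha> assume a: "\<alpha> \<in> hdual B"
    obtain I where I: "cofinite_ideal I" "\<forall>x\<in>I. \<alpha> x = 0" using a by (auto simp: hdual_iff)
    then show "fscale c \<alpha> \<in> hdual B"
      using lin_onD[OF lin_hdual[OF a]] unfolding hdual_iff
      by (intro conjI exI[of _ I] lin_onI) (simp_all add: fscale_def algebra_simps)
  qed
qed

lemma hdual_right_translate:
  assumes "\<beta> \<in> hdual B"
  shows "(\<lambda>x. \<beta> (x * b)) \<in> hdual B"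
proof -
  obtain I where I: "cofinite_ideal I" "\<forall>x\<in>I. \<beta> x = 0" using assms by (auto simp: hdual_iff)
  then have "\<forall>x\<in>I. \<beta> (x * b) = 0" by (simp add: cofinite_ideal_def)
  with I(1) show ?thesis
    using lin_translates[OF lin_hdual[OF assms]] by (auto simp: hdual_iff)
qed

lemma hdual_left_translate:
  assumes "\<beta> \<in> hdual B"
  shows "(\<lambda>x. \<beta> (b * x)) \<in> hdual B"
proof -
  obtain I where I: "cofinite_ideal I" "\<forall>x\<in>I. \<beta> x = 0" using assms by (auto simp: hdual_iff)
  then have "\<forall>x\<in>I. \<beta> (b * x) = 0" by (simp add: cofinite_ideal_def)
  with I(1) show ?thesis
    using lin_translates[OF lin_hdual[OF assms]] by (auto simp: hdual_iff)
qed

text \<open>The kernel of the counit is an ideal because the counit is multiplicative, and it is cut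
  out by a single functional.\<close>

lemma counit_in_hdual: "counit B \<in> hdual B"
  unfolding hdual_iff
proof (intro conjI exI[of _ "{x. counit B x = 0}"])
  interpret V: Vector_Spaces.vector_space "hscale B" by (rule vector_space)
  interpret e: Vector_Spaces.linear "hscale B" "(*)" "counit B" by (rule counit_linear)
  show "lin (hscale B) (*) (counit B)" by (rule lin_on_counit[OF lin_on_id])
  then show "cofinite_ideal {x. counit B x = 0}"
    by (intro cofinite_idealI[where A = "{counit B}"] V.subspaceI)
      (auto simp: counit_mult e.zero e.add e.scale)
qed auto

lemma sw_sum:
  assumes "vector_space sX" "\<And>c. bil sX (f c)" "finite C"
  shows "sw B (\<lambda>x y. \<Sum>c\<in>C. f c x y) b = (\<Sum>c\<in>C. sw B (f c) b)"
proof -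
  obtain ps where ps: "\<And>f. bil sX f \<Longrightarrow> sw B f b = (\<Sum>(v, w)\<leftarrow>ps. f v w)"
    using BB.lift_sum_list[OF comult_in[of b]] assms(1) unfolding sw_def by metis
  interpret X: Vector_Spaces.vector_space sX by fact
  have "bil sX (\<lambda>x y. \<Sum>c\<in>C. f c x y)"
    using assms(2) by (simp add: bilinear_on_def sum.distrib X.scale_sum_right)
  then have "sw B (\<lambda>x y. \<Sum>c\<in>C. f c x y) b = (\<Sum>(v, w)\<leftarrow>ps. \<Sum>c\<in>C. f c v w)" by (rule ps)
  also have "\<dots> = (\<Sum>c\<in>C. \<Sum>(v, w)\<leftarrow>ps. f c v w)"
    by (induction ps) (auto simp: sum.distrib)
  finally show ?thesis by (simp add: ps[OF assms(2)])
qed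

text \<open>The product vanishes on K, the preimage under \<Delta> of I \<otimes> B + B \<otimes> J,
  described here by pairs of functionals instead of tensors. K is an ideal since translates of a
  functional that vanishes on I, or on J, vanish there too. It has finite codimension since the
  finitely many pairs of coordinates \<open>e c\<close>, \<open>f d\<close> already detect
  it.\<close>

lemma hdual_dmult:
  assumes a: "\<alpha> \<in> hdual B" and b: "\<beta> \<in> hdual B"
  shows "\<alpha> \<cdot>\<^bsub>B\<^esub> \<beta> \<in> hdual B"
proof -
  interpret V: Vector_Spaces.vector_space "hscale B" by (rule vector_space)
  obtain I where I: "cofinite_ideal I" "\<forall>x\<in>I. \<alpha> x = 0" using a by (auto simp: hdual_iff)
  obtain J where J: "cofinite_ideal J" "\<forall>x\<in>J. \<beta> x = 0" using b by (auto simp: hdual_iff)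
  obtain C e where C: "finite C" "\<forall>c. lin (hscale B) (*) (e c)"
      "\<forall>x\<in>I. \<forall>c\<in>C. e c x = 0"
      "\<forall>\<phi> b. lin (hscale B) (*) \<phi> \<longrightarrow> (\<forall>x\<in>I. \<phi> x = 0) \<longrightarrow> \<phi> b = (\<Sum>c\<in>C. \<phi> c * e c b)"
      "I = {x. \<forall>c\<in>C. e c x = 0}"
    using cofinite_ideal_coordinates[OF I(1)] .
  obtain D f where D: "finite D" "\<forall>c. lin (hscale B) (*) (f c)"
      "\<forall>x\<in>J. \<forall>c\<in>D. f c x = 0"
      "\<forall>\<phi> b. lin (hscale B) (*) \<phi> \<longrightarrow> (\<forall>x\<in>J. \<phi> x = 0) \<longrightarrow> \<phi> b = (\<Sum>c\<in>D. \<phi> c * f c b)"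
      "J = {x. \<forall>c\<in>D. f c x = 0}"
    using cofinite_ideal_coordinates[OF J(1)] .
  define van where "van = (\<lambda>I \<phi>. lin (hscale B) (*) \<phi> \<and> (\<forall>x\<in>I. \<phi> x = 0))"
  have bm: "bil (*) (\<lambda>x y. \<phi> x * \<psi> y)" if "lin (hscale B) (*) \<phi>" "lin (hscale B) (*) \<psi>" for \<phi> \<psi>
    by (rule lin_rules that[THEN lin_on_comp])+
  have l: "lin (hscale B) (*) (\<lambda>b. sw B (\<lambda>x y. \<phi> x * \<psi> y) b)"
    if "lin (hscale B) (*) \<phi>" "lin (hscale B) (*) \<psi>" for \<phi> \<psi>
    by (rule lin_on_sw) (rule lin_rules bm that)+
  define K where "K = {b. \<forall>\<phi> \<psi>. van I \<phi> \<longrightarrow> van J \<psi> \<longrightarrow> sw B (\<lambda>x y. \<phi> x * \<psi> y) b = 0}"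
  then have KD: "sw B (\<lambda>x y. \<phi> x * \<psi> y) b = 0" if "b \<in> K" "van I \<phi>" "van J \<psi>" for b \<phi> \<psi>
    using that by simp
  \<comment> \<open>The zero map is the empty case of \<open>sw_sum\<close>.\<close>
  have sw0: "sw B (\<lambda>x y. 0 :: 'k) b = 0" for b
    using sw_sum[OF vector_space_times, of "\<lambda>c x y. 0" "{}"] by (simp add: bilinear_on_def)
  have "cofinite_ideal K"
  proof (rule cofinite_idealI[where A = "(\<lambda>(c, d) b. sw B (\<lambda>x y. e c x * f d y) b) ` (C \<times> D)"])
    have "V.subspace {b. sw B (\<lambda>x y. \<phi> x * \<psi> y) b = 0}" if "van I \<phi>" "van J \<psi>" for \<phi> \<psi>
    proof -
      interpret h: Vector_Spaces.linear "hscale B" "(*)" "\<lambda>b. sw B (\<lambda>x y. \<phi> x * \<psi> y) b"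
        using l that by (simp add: van_def lin_on_iff_linear[OF vector_space vector_space_times])
      show ?thesis by (rule V.subspaceI) (auto simp: h.zero h.add h.scale)
    qed
    then show "V.subspace K" by (auto simp: K_def V.subspace_def)
  next
    fix x a assume x: "x \<in> K"
    have vI: "van I (\<lambda>x. \<phi> (c * x))" "van I (\<lambda>x. \<phi> (x * c))" if "van I \<phi>" for \<phi> c
      using that I(1) lin_translates[of \<phi> c] by (auto simp: van_def cofinite_ideal_def)
    have vJ: "van J (\<lambda>x. \<phi> (c * x))" "van J (\<lambda>x. \<phi> (x * c))" if "van J \<phi>" for \<phi> c
      using that J(1) lin_translates[of \<phi> c] by (auto simp: van_def cofinite_ideal_def)
    show "a * x \<in> K"
      unfolding K_def
    proof (intro CollectI allI impI)
      fix \<phi> \<psi> assume v: "van I \<phi>" "van J \<psi>"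
      have "sw B (\<lambda>x y. \<phi> x * \<psi> y) (a * x) = sw B (\<lambda>a1 a2. sw B (\<lambda>x y. \<phi> (a1 * x) * \<psi> (a2 * y)) x) a"
        using v by (intro sw_mult[OF vector_space_times bm]) (auto simp: van_def)
      also have "\<dots> = sw B (\<lambda>a1 a2. 0) a"
        by (rule sw_cong, rule KD[OF x vI(1)[OF v(1)] vJ(1)[OF v(2)]])
      finally show "sw B (\<lambda>x y. \<phi> x * \<psi> y) (a * x) = 0" by (simp add: sw0)
    qed
    show "x * a \<in> K"
      unfolding K_def
    proof (intro CollectI allI impI)
      fix \<phi> \<psi> assume v: "van I \<phi>" "van J \<psi>"
      then have lv: "lin (hscale B) (*) \<phi>" "lin (hscale B) (*) \<psi>" by (auto simp: van_def)
      have "sw B (\<lambda>x y. \<phi> x * \<psi> y) (x * a) = sw B (\<lambda>x y. sw B (\<lambda>a1 a2. \<phi> (x * a1) * \<psi> (y * a2)) a) x"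
        using v by (intro sw_mult[OF vector_space_times bm]) (auto simp: van_def)
      \<comment> \<open>With the splitting of x moved inside, the inner sum tests x against a pair
        of right translates, for which membership in K gives 0.\<close>
      also have "\<dots> = sw B (\<lambda>a1 a2. sw B (\<lambda>x y. \<phi> (x * a1) * \<psi> (y * a2)) x) a"
        by (rule sw_swap) (rule lin_rules lv[THEN lin_on_comp])+
      also have "\<dots> = sw B (\<lambda>a1 a2. 0) a"
        by (rule sw_cong, rule KD[OF x vI(2)[OF v(1)] vJ(2)[OF v(2)]])
      finally show "sw B (\<lambda>x y. \<phi> x * \<psi> y) (x * a) = 0" by (simp add: sw0)
    qed
  next
    show "{x. \<forall>\<phi>\<in>(\<lambda>(c, d) b. sw B (\<lambda>x y. e c x * f d y) b) ` (C \<times> D). \<phi> x = 0} \<subseteq> K"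
      unfolding K_def
    proof (intro subsetI CollectI allI impI)
      fix b \<phi> \<psi>
      assume "b \<in> {x. \<forall>\<phi>\<in>(\<lambda>(c, d) b. sw B (\<lambda>x y. e c x * f d y) b) ` (C \<times> D). \<phi> x = 0}"
      then have 0: "sw B (\<lambda>x y. e c x * f d y) b = 0" if "c \<in> C" "d \<in> D" for c d
        using that by (auto dest!: bspec[of _ _ "\<lambda>b. sw B (\<lambda>x y. e c x * f d y) b"])
      assume v: "van I \<phi>" "van J \<psi>"
      have bp: "bil (*) (\<lambda>x y. k * (e c x * f d y))" for k c d
        by (rule lin_rules C(2)[rule_format, THEN lin_on_comp] D(2)[rule_format, THEN lin_on_comp])+
      have \<phi>: "\<phi> x = (\<Sum>c\<in>C. \<phi> c * e c x)" and \<psi>: "\<psi> x = (\<Sum>d\<in>D. \<psi> d * f d x)" for x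
        using v C(4)[rule_format] D(4)[rule_format] unfolding van_def by blast+
      \<comment> \<open>Both functionals are expanded in coordinates, so the value at b becomes a
        combination of the numbers assumed to vanish.\<close>
      have ex: "\<phi> x * \<psi> y = (\<Sum>p\<in>C \<times> D. (\<phi> (fst p) * \<psi> (snd p)) * (e (fst p) x * f (snd p) y))" for x y
      proof -
        have "\<phi> x * \<psi> y = (\<Sum>c\<in>C. \<phi> c * e c x) * (\<Sum>d\<in>D. \<psi> d * f d y)"
          by (rule arg_cong2[OF \<phi> \<psi>])
        also have "\<dots> = (\<Sum>p\<in>C \<times> D. (\<phi> (fst p) * \<psi> (snd p)) * (e (fst p) x * f (snd p) y))"
          unfolding sum_product sum.cartesian_product by (intro sum.cong refl) (simp only: split_def mult_ac)
        finally show ?thesis .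
      qed
      have "sw B (\<lambda>x y. \<phi> x * \<psi> y) b =
        sw B (\<lambda>x y. \<Sum>p\<in>C \<times> D. (\<phi> (fst p) * \<psi> (snd p)) * (e (fst p) x * f (snd p) y)) b"
        by (rule sw_cong) (rule ex)
      also have "\<dots> = (\<Sum>p\<in>C \<times> D. sw B (\<lambda>x y. (\<phi> (fst p) * \<psi> (snd p)) * (e (fst p) x * f (snd p) y)) b)"
        by (rule sw_sum[OF vector_space_times bp finite_cartesian_product[OF C(1) D(1)]])
      also have "\<dots> = (\<Sum>p\<in>C \<times> D. (\<phi> (fst p) * \<psi> (snd p)) * sw B (\<lambda>x y. e (fst p) x * f (snd p) y) b)"
        by (intro sum.cong refl sw_comm[OF vector_space_times subspace_UNIV_K vector_space_times
            lin_on_times_right[OF lin_on_id] bm[OF C(2)[rule_format] D(2)[rule_format]] UNIV_I, symmetric])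
      also have "\<dots> = 0" by (rule sum.neutral) (auto simp: 0)
      finally show "sw B (\<lambda>x y. \<phi> x * \<psi> y) b = 0" .
    qed
  qed (use C(1,2) D(1,2) l in auto)
  moreover have "\<forall>x\<in>K. sw B (\<lambda>x y. \<alpha> x * \<beta> y) x = 0"
    using I(2) J(2) lin_hdual[OF a] lin_hdual[OF b] by (auto simp: K_def van_def)
  ultimately show ?thesis
    unfolding hdual_iff dmult_def using l[OF lin_hdual[OF a] lin_hdual[OF b]] by auto
qed

text \<open>The preimage of a two-sided ideal under a linear map that reverses products is again a
  two-sided ideal, with left and right exchanged. The case of interest is \<open>T\<close> equal to
  the inverse antipode.\<close>

lemma hdual_antimultiplicative_comp:
  assumes b: "\<beta> \<in> hdual B"
    and T: "lin (hscale B) (hscale B) T" "\<And>x y. T (x * y) = T y * T x"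
    and U: "lin (hscale B) (hscale B) U" "\<And>x. U (T x) = x" "\<And>x. T (U x) = x"
  shows "(\<lambda>x. \<beta> (T x)) \<in> hdual B"
proof -
  interpret V: Vector_Spaces.vector_space "hscale B" by (rule vector_space)
  interpret T: Vector_Spaces.linear "hscale B" "hscale B" T
    using T(1) by (simp add: lin_on_iff_linear[OF vector_space vector_space])
  obtain I where I: "cofinite_ideal I" "\<forall>x\<in>I. \<beta> x = 0" using b by (auto simp: hdual_iff)
  obtain A where A: "finite A" "\<forall>\<phi>\<in>A. lin (hscale B) (*) \<phi>" "I = {x. \<forall>\<phi>\<in>A. \<phi> x = 0}"
    using cofinite_ideal_kernels[OF I(1)] .
  have "cofinite_ideal {x. T x \<in> I}"
  proof (rule cofinite_idealI[where A = "(\<lambda>\<phi> x. \<phi> (T x)) ` A"])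
    show "V.subspace {x. T x \<in> I}"
      using I(1) by (auto simp: cofinite_ideal_def V.subspace_def T.zero T.add T.scale)
    show "\<forall>\<phi>\<in>(\<lambda>\<phi> x. \<phi> (T x)) ` A. lin (hscale B) (*) \<phi>"
      using lin_on_comp[OF bspec[OF A(2)] T(1) UNIV_I] by auto
    show "{x. \<forall>\<phi>\<in>(\<lambda>\<phi> x. \<phi> (T x)) ` A. \<phi> x = 0} \<subseteq> {x. T x \<in> I}" unfolding A(3) by auto
  qed (use A(1) I(1) in \<open>auto simp: cofinite_ideal_def T(2)\<close>)
  then show ?thesis
    unfolding hdual_iff using I(2) lin_on_comp[OF lin_hdual[OF b] T(1) UNIV_I] by auto
qed

subsection \<open>The coproduct of the dual\<close>

sublocale DD: tensor_pair fscale fscale "hdual B" "hdual B"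
  by (rule tensor_pair.intro) (rule vector_space_fscale subspace_hdual)+

lemma bilinear_on_evaluations:
  "bilinear_on fscale fscale (*) (hdual B) (hdual B) (\<lambda>\<phi> \<psi>. \<phi> a * \<psi> b)"
  by (auto simp: bilinear_on_def fscale_def algebra_simps)

text \<open>For fixed x the functional y \<mapsto> \<beta>(xy) vanishes on the ideal I, so
  \<beta>(xy) is the sum of \<beta>(xc) times the coordinate \<open>e c\<close> of y. The required
  tensor is therefore the sum over c in \<open>C\<close> of the right translate of \<beta> by c,
  tensored with \<open>e c\<close>.\<close>

lemma dcomult_existence:
  assumes b: "\<beta> \<in> hdual B"
  shows "\<exists>t\<in>DD.tspace. \<forall>x y. DD.lift (\<lambda>\<phi> \<psi>. \<phi> x * \<psi> y) t = \<beta> (x * y)"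
proof -
  interpret T: Vector_Spaces.vector_space "fscale :: 'k \<Rightarrow> ('k, 'b \<Rightarrow> 'k, 'b \<Rightarrow> 'k) tensor \<Rightarrow> _"
    by (rule vector_space_fscale)
  obtain I where I: "cofinite_ideal I" "\<forall>x\<in>I. \<beta> x = 0" using b by (auto simp: hdual_iff)
  obtain C e where C: "finite C" "\<forall>c. lin (hscale B) (*) (e c)"
      "\<forall>x\<in>I. \<forall>c\<in>C. e c x = 0"
      "\<forall>\<phi> b. lin (hscale B) (*) \<phi> \<longrightarrow> (\<forall>x\<in>I. \<phi> x = 0) \<longrightarrow> \<phi> b = (\<Sum>c\<in>C. \<phi> c * e c b)"
      "I = {x. \<forall>c\<in>C. e c x = 0}"
    using cofinite_ideal_coordinates[OF I(1)] .
  have e: "e c \<in> hdual B" if "c \<in> C" for c using I(1) C that by (auto simp: hdual_iff)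
  obtain cs where cs: "set cs = C" "distinct cs" using finite_distinct_list[OF C(1)] by auto
  define ps where "ps = map (\<lambda>c. (\<lambda>x. \<beta> (x * c), e c)) cs"
  have ps: "set ps \<subseteq> hdual B \<times> hdual B"
    using e cs by (auto simp: ps_def intro: hdual_right_translate[OF b])
  show ?thesis
  proof (intro bexI allI)
    have "tens fscale fscale v w \<in> DD.tspace" if "(v, w) \<in> set ps" for v w
      using that ps by (intro DD.tens_in_tspace) auto
    then show "(\<Sum>(v, w)\<leftarrow>ps. tens fscale fscale v w) \<in> DD.tspace"
      by (induction ps) (auto intro: T.subspace_0[OF DD.subspace_tspace] T.subspace_add[OF DD.subspace_tspace])
  next
    fix x y
    have "DD.lift (\<lambda>\<phi> \<psi>. \<phi> x * \<psi> y) (\<Sum>(v, w)\<leftarrow>ps. tens fscale fscale v w) = (\<Sum>(\<phi>, \<psi>)\<leftarrow>ps. \<phi> x * \<psi> y)"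
      by (rule tlift_sum_list[OF vector_space_fscale vector_space_fscale vector_space_times
            subspace_hdual subspace_hdual bilinear_on_evaluations ps])
    also have "\<dots> = (\<Sum>c\<in>C. \<beta> (x * c) * e c y)"
      by (simp add: ps_def comp_def cs(1)[symmetric] sum_list_distinct_conv_sum_set[OF cs(2)])
    also have "\<dots> = \<beta> (x * y)"
      using C(4)[rule_format, OF lin_translates(1)[OF lin_hdual[OF b]], of x y] I
      by (auto simp: cofinite_ideal_def)
    finally show "DD.lift (\<lambda>\<phi> \<psi>. \<phi> x * \<psi> y) (\<Sum>(v, w)\<leftarrow>ps. tens fscale fscale v w) = \<beta> (x * y)" .
  qed
qed

text \<open>Evaluating the left factor of the difference at x gives a functional that is zero at
  every y, so \<open>function_tensor_eq_0\<close> applies. This is the uniqueness that gives meaning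
  to the definite description in \<open>dcomult\<close>.\<close>

lemma dual_tensor_eqI:
  assumes "t \<in> DD.tspace" "u \<in> DD.tspace"
    and "\<And>x y. DD.lift (\<lambda>\<phi> \<psi>. \<phi> x * \<psi> y) t = DD.lift (\<lambda>\<phi> \<psi>. \<phi> x * \<psi> y) u"
  shows "t = u"
proof -
  interpret T: Vector_Spaces.vector_space "fscale :: 'k \<Rightarrow> ('k, 'b \<Rightarrow> 'k, 'b \<Rightarrow> 'k) tensor \<Rightarrow> _"
    by (rule vector_space_fscale)
  have tu: "t + fscale (-1) u \<in> DD.tspace"
    using assms(1,2) by (intro T.subspace_add[OF DD.subspace_tspace] T.subspace_scale[OF DD.subspace_tspace])
  have bf: "bilinear_on fscale fscale fscale (hdual B) (hdual B) (\<lambda>\<phi> \<psi>. fscale (\<phi> x) \<psi>)" for x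
    by (auto simp: bilinear_on_def fscale_def algebra_simps fun_eq_iff)
  have "t + fscale (-1) u = 0"
  proof (rule function_tensor_eq_0[OF vector_space_fscale subspace_hdual subspace_hdual tu])
    fix x
    show "DD.lift (\<lambda>\<phi> \<psi>. fscale (\<phi> x) \<psi>) (t + fscale (-1) u) = 0"
    proof
      fix y
      have "DD.lift (\<lambda>\<phi> \<psi>. fscale (\<phi> x) \<psi>) (t + fscale (-1) u) y
         = DD.lift (\<lambda>\<phi> \<psi>. fscale (\<phi> x) \<psi> y) (t + fscale (-1) u)"
        by (rule DD.lift_comm(1)[OF vector_space_fscale subspace_UNIV_fscale vector_space_times
           lin_on_apply[OF lin_on_id] bf UNIV_I tu])
      also have "\<dots> = DD.lift (\<lambda>\<phi> \<psi>. \<phi> x * \<psi> y) (t + fscale (-1) u)"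
        by (simp add: fscale_def)
      also have "\<dots> = DD.lift (\<lambda>\<phi> \<psi>. \<phi> x * \<psi> y) t + (-1) * DD.lift (\<lambda>\<phi> \<psi>. \<phi> x * \<psi> y) u"
        by (simp only: lin_onD[OF DD.lin_on_lift[OF vector_space_times bilinear_on_evaluations[of x y]]]
            assms(1,2) T.subspace_scale[OF DD.subspace_tspace])
      also have "\<dots> = 0" by (simp add: assms(3))
      finally show "DD.lift (\<lambda>\<phi> \<psi>. fscale (\<phi> x) \<psi>) (t + fscale (-1) u) y = 0 y" by simp
    qed
  qed
  then show ?thesis by (simp add: fscale_def fun_eq_iff)
qed

lemma dcomult:
  assumes "\<beta> \<in> hdual B"
  shows dcomult_in: "dcomult B \<beta> \<in> DD.tspace"
    and dcomult_eval: "DD.lift (\<lambda>\<phi> \<psi>. \<phi> x * \<psi> y) (dcomult B \<beta>) = \<beta> (x * y)"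
proof -
  have "\<exists>!t. t \<in> DD.tspace \<and> (\<forall>x y. DD.lift (\<lambda>\<phi> \<psi>. \<phi> x * \<psi> y) t = \<beta> (x * y))"
    using dcomult_existence[OF assms] by (auto intro: dual_tensor_eqI)
  from theI'[OF this] show "dcomult B \<beta> \<in> DD.tspace"
    and "DD.lift (\<lambda>\<phi> \<psi>. \<phi> x * \<psi> y) (dcomult B \<beta>) = \<beta> (x * y)"
    by (auto simp: dcomult_def)
qed

text \<open>A definite description carries no linearity by itself; here it follows because both
  sides have the same evaluations.\<close>

lemma lin_on_dcomult: "lin_on fscale fscale (hdual B) (dcomult B)"
proof (rule lin_onI)
  interpret T: Vector_Spaces.vector_space "fscale :: 'k \<Rightarrow> ('k, 'b \<Rightarrow> 'k, 'b \<Rightarrow> 'k) tensor \<Rightarrow> _"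
    by (rule vector_space_fscale)
  interpret F: Vector_Spaces.vector_space "fscale :: 'k \<Rightarrow> ('b \<Rightarrow> 'k) \<Rightarrow> _" by (rule vector_space_fscale)
  note l = lin_onD[OF DD.lin_on_lift[OF vector_space_times bilinear_on_evaluations]]
  show "dcomult B (\<alpha> + \<beta>) = dcomult B \<alpha> + dcomult B \<beta>" if "\<alpha> \<in> hdual B" "\<beta> \<in> hdual B" for \<alpha> \<beta>
    using that by (intro dual_tensor_eqI)
     (simp_all add: l dcomult_in dcomult_eval F.subspace_add[OF subspace_hdual] T.subspace_add[OF DD.subspace_tspace])
  show "dcomult B (fscale c \<beta>) = fscale c (dcomult B \<beta>)" if "\<beta> \<in> hdual B" for c \<beta>
    using that by (intro dual_tensor_eqI)
     (simp_all add: l dcomult_in dcomult_eval F.subspace_scale[OF subspace_hdual]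
        T.subspace_scale[OF DD.subspace_tspace] fscale_apply)
qed

section \<open>Sweedler sums and regular actions on the finite dual\<close>

lemma lin_on_dsw:
  assumes "vector_space sX" "bilinear_on fscale fscale sX (hdual B) (hdual B) f"
    and "lin_on sV fscale V g" "\<And>v. v \<in> V \<Longrightarrow> g v \<in> hdual B"
  shows "lin_on sV sX V (\<lambda>v. dsw B f (g v))"
  unfolding dsw_def
  by (rule DD.lin_on_lift_arg[OF assms(1,2) lin_on_comp[OF lin_on_dcomult assms(3,4)] dcomult_in[OF assms(4)]])

lemma lin_on_dsw_fun:
  assumes "vector_space sX" "\<beta> \<in> hdual B" "vector_space sU" "module.subspace sU U"
    and "\<And>u. u \<in> U \<Longrightarrow> bilinear_on fscale fscale sX (hdual B) (hdual B) (F u)"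
    and "\<And>\<phi> \<psi>. \<phi> \<in> hdual B \<Longrightarrow> \<psi> \<in> hdual B \<Longrightarrow> lin_on sU sX U (\<lambda>u. F u \<phi> \<psi>)"
  shows "lin_on sU sX U (\<lambda>u. dsw B (F u) \<beta>)"
  unfolding dsw_def by (rule DD.lin_on_lift_fun[OF assms(1) dcomult_in[OF assms(2)] assms(3-)])

lemma dsw_comm:
  assumes "vector_space sX" "module.subspace sX X" "vector_space sY" "lin_on sX sY X h"
    and "bilinear_on fscale fscale sX (hdual B) (hdual B) f"
    and "\<And>\<phi> \<psi>. \<phi> \<in> hdual B \<Longrightarrow> \<psi> \<in> hdual B \<Longrightarrow> f \<phi> \<psi> \<in> X" "\<beta> \<in> hdual B"
  shows "h (dsw B f \<beta>) = dsw B (\<lambda>\<phi> \<psi>. h (f \<phi> \<psi>)) \<beta>"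
  unfolding dsw_def by (rule DD.lift_comm(1)[OF assms(1-6) dcomult_in[OF assms(7)]])

lemma dsw_closed:
  assumes "vector_space sX" "module.subspace sX X"
    and "bilinear_on fscale fscale sX (hdual B) (hdual B) f"
    and "\<And>\<phi> \<psi>. \<phi> \<in> hdual B \<Longrightarrow> \<psi> \<in> hdual B \<Longrightarrow> f \<phi> \<psi> \<in> X" "\<beta> \<in> hdual B"
  shows "dsw B f \<beta> \<in> X"
  unfolding dsw_def by (rule DD.lift_closed[OF assms(1-4) dcomult_in[OF assms(5)]])

lemma dsw_cong:
  assumes "\<And>\<phi> \<psi>. \<phi> \<in> hdual B \<Longrightarrow> \<psi> \<in> hdual B \<Longrightarrow> f \<phi> \<psi> = g \<phi> \<psi>"
  shows "dsw B f \<beta> = dsw B g \<beta>"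
  unfolding dsw_def by (rule DD.lift_cong[OF assms])

lemma dsw_evaluations: "\<beta> \<in> hdual B \<Longrightarrow> dsw B (\<lambda>\<phi> \<psi>. \<phi> x * \<psi> y) \<beta> = \<beta> (x * y)"
  unfolding dsw_def by (rule dcomult_eval)

lemma lact_eq:
  assumes "\<beta> \<in> hdual B"
  shows "b \<rightharpoonup>\<^bsub>B\<^esub> \<beta> = (\<lambda>x. \<beta> (x * b))"
proof
  fix x
  have "(b \<rightharpoonup>\<^bsub>B\<^esub> \<beta>) x = dsw B (\<lambda>\<phi> \<psi>. fscale (\<psi> b) \<phi> x) \<beta>"
    unfolding lact_def
    by (rule dsw_comm[OF vector_space_fscale subspace_UNIV_fscale vector_space_times
          lin_on_apply[OF lin_on_id] _ UNIV_I assms])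
      (auto simp: bilinear_on_def fscale_def algebra_simps fun_eq_iff)
  then show "(b \<rightharpoonup>\<^bsub>B\<^esub> \<beta>) x = \<beta> (x * b)"
    using dsw_evaluations[OF assms, of x b] by (simp add: fscale_def mult.commute)
qed

lemma ract_eq:
  assumes "\<beta> \<in> hdual B"
  shows "\<beta> \<leftharpoonup>\<^bsub>B\<^esub> b = (\<lambda>x. \<beta> (b * x))"
proof
  fix x
  have "(\<beta> \<leftharpoonup>\<^bsub>B\<^esub> b) x = dsw B (\<lambda>\<phi> \<psi>. fscale (\<phi> b) \<psi> x) \<beta>"
    unfolding ract_def
    by (rule dsw_comm[OF vector_space_fscale subspace_UNIV_fscale vector_space_times
          lin_on_apply[OF lin_on_id] _ UNIV_I assms])
      (auto simp: bilinear_on_def fscale_def algebra_simps fun_eq_iff)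
  then show "(\<beta> \<leftharpoonup>\<^bsub>B\<^esub> b) x = \<beta> (b * x)"
    using dsw_evaluations[OF assms, of b x] by (simp add: fscale_def)
qed

lemma hdual_lact: "\<beta> \<in> hdual B \<Longrightarrow> b \<rightharpoonup>\<^bsub>B\<^esub> \<beta> \<in> hdual B"
  by (simp add: lact_eq hdual_right_translate)

lemma hdual_ract: "\<beta> \<in> hdual B \<Longrightarrow> \<beta> \<leftharpoonup>\<^bsub>B\<^esub> b \<in> hdual B"
  by (simp add: ract_eq hdual_left_translate)

lemma hdual_add: "\<alpha> \<in> hdual B \<Longrightarrow> \<beta> \<in> hdual B \<Longrightarrow> \<alpha> + \<beta> \<in> hdual B"
proof -
  interpret F: Vector_Spaces.vector_space "fscale :: 'k \<Rightarrow> ('b \<Rightarrow> 'k) \<Rightarrow> _" by (rule vector_space_fscale)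
  show "\<alpha> \<in> hdual B \<Longrightarrow> \<beta> \<in> hdual B \<Longrightarrow> \<alpha> + \<beta> \<in> hdual B" by (rule F.subspace_add[OF subspace_hdual])
qed

lemma hdual_fscale: "\<beta> \<in> hdual B \<Longrightarrow> fscale c \<beta> \<in> hdual B"
proof -
  interpret F: Vector_Spaces.vector_space "fscale :: 'k \<Rightarrow> ('b \<Rightarrow> 'k) \<Rightarrow> _" by (rule vector_space_fscale)
  show "\<beta> \<in> hdual B \<Longrightarrow> fscale c \<beta> \<in> hdual B" by (rule F.subspace_scale[OF subspace_hdual])
qed

lemma lin_on_lact_left:
  assumes "lin_on sV (hscale B) V g" "\<beta> \<in> hdual B"
  shows "lin_on sV fscale V (\<lambda>v. g v \<rightharpoonup>\<^bsub>B\<^esub> \<beta>)"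
  unfolding lact_eq[OF assms(2)] by (intro lin_on_fun lin_on_hdual lin_on_mult_right assms)

lemma lin_on_lact_right:
  assumes "lin_on sV fscale V g" "\<And>v. v \<in> V \<Longrightarrow> g v \<in> hdual B"
  shows "lin_on sV fscale V (\<lambda>v. b \<rightharpoonup>\<^bsub>B\<^esub> g v)"
  by (rule lin_on_comp[OF _ assms])
    (auto simp: lin_on_def lact_eq hdual_add hdual_fscale fscale_apply fun_eq_iff)

lemma lin_on_ract_left:
  assumes "lin_on sV fscale V g" "\<And>v. v \<in> V \<Longrightarrow> g v \<in> hdual B"
  shows "lin_on sV fscale V (\<lambda>v. g v \<leftharpoonup>\<^bsub>B\<^esub> b)"
  by (rule lin_on_comp[OF _ assms])
    (auto simp: lin_on_def ract_eq hdual_add hdual_fscale fscale_apply fun_eq_iff)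

lemma lin_on_ract_right:
  assumes "lin_on sV (hscale B) V g" "\<beta> \<in> hdual B"
  shows "lin_on sV fscale V (\<lambda>v. \<beta> \<leftharpoonup>\<^bsub>B\<^esub> g v)"
  unfolding ract_eq[OF assms(2)] by (intro lin_on_fun lin_on_hdual lin_on_mult_left assms)

lemma bil_dmult: "\<alpha> \<in> hdual B \<Longrightarrow> \<beta> \<in> hdual B \<Longrightarrow> bil (*) (\<lambda>x y. \<alpha> x * \<beta> y)"
  by (intro bilinear_onI lin_on_times_left lin_on_times_right lin_hdual)

lemma lin_on_dmult_left:
  assumes "lin_on sV fscale V g" "\<And>v. v \<in> V \<Longrightarrow> g v \<in> hdual B" "\<beta> \<in> hdual B"
  shows "lin_on sV fscale V (\<lambda>v. g v \<cdot>\<^bsub>B\<^esub> \<beta>)"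
  by (rule lin_on_comp[OF lin_on_fun assms(1,2)], unfold dmult_def, rule lin_on_sw_fun)
    (rule vector_space_fscale vector_space_times subspace_hdual bil_dmult assms(3)
      lin_on_times_left lin_on_times_right lin_on_apply lin_on_id | assumption)+

lemma lin_on_dmult_right:
  assumes "lin_on sV fscale V g" "\<And>v. v \<in> V \<Longrightarrow> g v \<in> hdual B" "\<alpha> \<in> hdual B"
  shows "lin_on sV fscale V (\<lambda>v. \<alpha> \<cdot>\<^bsub>B\<^esub> g v)"
  by (rule lin_on_comp[OF lin_on_fun assms(1,2)], unfold dmult_def, rule lin_on_sw_fun)
    (rule vector_space_fscale vector_space_times subspace_hdual bil_dmult assms(3)
      lin_on_times_left lin_on_times_right lin_on_apply lin_on_id | assumption)+

lemma bil_bact: "\<mu> \<in> hdual B \<Longrightarrow> bil (hscale B) (\<lambda>x y. hscale B (\<mu> x) y)"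
  by (intro bilinear_onI lin_on_scale_left[OF vector_space] lin_on_scale_right[OF vector_space]
      lin_on_id lin_hdual)

lemma lin_on_bact_left:
  assumes "lin_on sV (hscale B) V g" "\<mu> \<in> hdual B"
  shows "lin_on sV (hscale B) V (\<lambda>v. g v \<leftharpoondown>\<^bsub>B\<^esub> \<mu>)"
  unfolding bact_def by (rule lin_on_sw[OF vector_space bil_bact[OF assms(2)] assms(1)])

lemma lin_on_bact_right:
  assumes "lin_on sV fscale V g" "\<And>v. v \<in> V \<Longrightarrow> g v \<in> hdual B"
  shows "lin_on sV (hscale B) V (\<lambda>v. b \<leftharpoondown>\<^bsub>B\<^esub> g v)"
  by (rule lin_on_comp[OF _ assms], unfold bact_def, rule lin_on_sw_fun)
    (rule vector_space_fscale vector_space subspace_hdual bil_bact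
      lin_on_scale_left[OF vector_space] lin_on_apply lin_on_id | assumption)+

section \<open>Maps on the doubles\<close>

sublocale DB: tensor_pair fscale "hscale B" "hdual B" UNIV
  by (rule tensor_pair.intro) (rule vector_space_fscale vector_space subspace_hdual subspace_UNIV_B)+

lemma subspace_dbl: "module.subspace fscale (dbl B)"
  unfolding dbl_def by (rule DB.subspace_tspace)

sublocale DBDB: tensor_pair fscale fscale "dbl B" "dbl B"
  by (rule tensor_pair.intro) (rule vector_space_fscale subspace_dbl)+

lemma dtens_in_dbl: "\<mu> \<in> hdual B \<Longrightarrow> \<mu> \<otimes>\<^bsub>B\<^esub> m \<in> dbl B"
  unfolding dbl_def dtens_def by (rule DB.tens_in_tspace) auto

lemma lin_on_dtens_left: "lin_on sV fscale V g \<Longrightarrow> lin_on sV fscale V (\<lambda>v. g v \<otimes>\<^bsub>B\<^esub> m)"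
  unfolding dtens_def by (rule lin_on_tens_left[OF vector_space_fscale vector_space])

lemma lin_on_dtens_right: "lin_on sV (hscale B) V g \<Longrightarrow> lin_on sV fscale V (\<lambda>v. \<mu> \<otimes>\<^bsub>B\<^esub> g v)"
  unfolding dtens_def by (rule lin_on_tens_right[OF vector_space_fscale vector_space])

abbreviation dbil :: "('k \<Rightarrow> 'x::ab_group_add \<Rightarrow> 'x) \<Rightarrow> (('b \<Rightarrow> 'k) \<Rightarrow> 'b \<Rightarrow> 'x) \<Rightarrow> bool" where
  "dbil sX \<equiv> bilinear_on fscale (hscale B) sX (hdual B) UNIV"

lemma dlift_dtens:
  assumes "vector_space sX" "dbil sX f" "\<mu> \<in> hdual B"
  shows "dlift B f (\<mu> \<otimes>\<^bsub>B\<^esub> m) = f \<mu> m"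
  unfolding dlift_def dtens_def by (rule DB.lift_tens[OF assms UNIV_I])

lemma lin_on_dlift:
  assumes "vector_space sX" "dbil sX f" "lin_on sV fscale V g" "\<And>v. v \<in> V \<Longrightarrow> g v \<in> dbl B"
  shows "lin_on sV sX V (\<lambda>v. dlift B f (g v))"
  using assms unfolding dlift_def dbl_def by (rule DB.lin_on_lift_arg)

lemma lin_on_dlift_fun:
  assumes "vector_space sX" "M \<in> dbl B" "vector_space sU" "module.subspace sU U"
    and "\<And>u. u \<in> U \<Longrightarrow> dbil sX (F u)"
    and "\<And>\<mu> m. \<mu> \<in> hdual B \<Longrightarrow> lin_on sU sX U (\<lambda>u. F u \<mu> m)"
  shows "lin_on sU sX U (\<lambda>u. dlift B (F u) M)"
  using assms unfolding dlift_def dbl_def by (rule DB.lin_on_lift_fun)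

lemma dlift_closed:
  assumes "vector_space sX" "module.subspace sX X" "dbil sX f"
    and "\<And>\<mu> m. \<mu> \<in> hdual B \<Longrightarrow> f \<mu> m \<in> X" "M \<in> dbl B"
  shows "dlift B f M \<in> X"
  using assms unfolding dlift_def dbl_def by (rule DB.lift_closed)

lemma dbl_ext:
  assumes "vector_space sX" "lin_on fscale sX (dbl B) f" "lin_on fscale sX (dbl B) g"
    and "\<And>\<mu> m. \<mu> \<in> hdual B \<Longrightarrow> f (\<mu> \<otimes>\<^bsub>B\<^esub> m) = g (\<mu> \<otimes>\<^bsub>B\<^esub> m)" "M \<in> dbl B"
  shows "f M = g M"
  using assms unfolding dtens_def dbl_def by (rule DB.tspace_ext)

text \<open>The two products, the pairing \<open>eta\<close> and the action are all defined by two
  nested lifts. Values on pure tensors, linearity in either factor and closure are obtained here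
  once, for use with each.\<close>

lemma dlift2:
  assumes "vector_space sX" "\<And>\<nu> n. \<nu> \<in> hdual B \<Longrightarrow> dbil sX (\<lambda>\<mu> m. f \<mu> m \<nu> n)"
    and "\<And>\<mu> m. \<mu> \<in> hdual B \<Longrightarrow> dbil sX (\<lambda>\<nu> n. f \<mu> m \<nu> n)"
  shows dlift2_dtens: "\<mu> \<in> hdual B \<Longrightarrow> \<nu> \<in> hdual B \<Longrightarrow>
      dlift B (\<lambda>\<mu> m. dlift B (\<lambda>\<nu> n. f \<mu> m \<nu> n) (\<nu> \<otimes>\<^bsub>B\<^esub> n)) (\<mu> \<otimes>\<^bsub>B\<^esub> m) = f \<mu> m \<nu> n"
    and lin_on_dlift2_left: "lin_on sV fscale V g \<Longrightarrow> (\<And>v. v \<in> V \<Longrightarrow> g v \<in> dbl B) \<Longrightarrow> N \<in> dbl B \<Longrightarrow>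
      lin_on sV sX V (\<lambda>v. dlift B (\<lambda>\<mu> m. dlift B (\<lambda>\<nu> n. f \<mu> m \<nu> n) N) (g v))"
    and lin_on_dlift2_right: "lin_on sV fscale V g \<Longrightarrow> (\<And>v. v \<in> V \<Longrightarrow> g v \<in> dbl B) \<Longrightarrow> M \<in> dbl B \<Longrightarrow>
      lin_on sV sX V (\<lambda>v. dlift B (\<lambda>\<mu> m. dlift B (\<lambda>\<nu> n. f \<mu> m \<nu> n) (g v)) M)"
    and dlift2_closed: "module.subspace sX X \<Longrightarrow>
      (\<And>\<mu> m \<nu> n. \<mu> \<in> hdual B \<Longrightarrow> \<nu> \<in> hdual B \<Longrightarrow> f \<mu> m \<nu> n \<in> X) \<Longrightarrow> M \<in> dbl B \<Longrightarrow> N \<in> dbl B \<Longrightarrow>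
      dlift B (\<lambda>\<mu> m. dlift B (\<lambda>\<nu> n. f \<mu> m \<nu> n) N) M \<in> X"
proof -
  note vs = vector_space_fscale vector_space subspace_hdual subspace_UNIV_B subspace_dbl assms(1)
  have outer: "dbil sX (\<lambda>\<mu> m. dlift B (\<lambda>\<nu> n. f \<mu> m \<nu> n) N)" if "N \<in> dbl B" for N
    by (rule bilinear_onI)
     (rule lin_on_dlift_fun vs that assms(3) bilinear_onD[OF assms(2)] UNIV_I | assumption)+
  show "dlift B (\<lambda>\<mu> m. dlift B (\<lambda>\<nu> n. f \<mu> m \<nu> n) (\<nu> \<otimes>\<^bsub>B\<^esub> n)) (\<mu> \<otimes>\<^bsub>B\<^esub> m) = f \<mu> m \<nu> n"
    if "\<mu> \<in> hdual B" "\<nu> \<in> hdual B"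
    using that by (simp add: dlift_dtens[OF assms(1) outer] dlift_dtens[OF assms(1) assms(3)] dtens_in_dbl)
  show "lin_on sV sX V (\<lambda>v. dlift B (\<lambda>\<mu> m. dlift B (\<lambda>\<nu> n. f \<mu> m \<nu> n) N) (g v))"
    if "lin_on sV fscale V g" "\<And>v. v \<in> V \<Longrightarrow> g v \<in> dbl B" "N \<in> dbl B"
    by (rule lin_on_dlift[OF assms(1) outer[OF that(3)] that(1,2)])
  show "lin_on sV sX V (\<lambda>v. dlift B (\<lambda>\<mu> m. dlift B (\<lambda>\<nu> n. f \<mu> m \<nu> n) (g v)) M)"
    if "lin_on sV fscale V g" "\<And>v. v \<in> V \<Longrightarrow> g v \<in> dbl B" "M \<in> dbl B"
    by (rule lin_on_comp[OF lin_on_dlift_fun that(1,2)])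
      (rule vs that outer lin_on_dlift lin_on_id assms(3) | assumption)+
  show "dlift B (\<lambda>\<mu> m. dlift B (\<lambda>\<nu> n. f \<mu> m \<nu> n) N) M \<in> X"
    if "module.subspace sX X" "\<And>\<mu> m \<nu> n. \<mu> \<in> hdual B \<Longrightarrow> \<nu> \<in> hdual B \<Longrightarrow> f \<mu> m \<nu> n \<in> X"
      "M \<in> dbl B" "N \<in> dbl B"
    by (rule dlift_closed[OF assms(1) that(1) outer[OF that(4)] _ that(3)],
        rule dlift_closed[OF assms(1) that(1) assms(3) that(2) that(4)])
qed

text \<open>Besides linearity the list contains membership facts, because many rules for operations
  involving the dual require their arguments to lie in \<open>hdual B\<close>, and lifts require
  arguments in the tensor space.\<close>

lemmas dual_lin_rules =
  lin_rules lin_on_dtens_left lin_on_dtens_right lin_on_dmult_left lin_on_dmult_right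
  lin_on_lact_left lin_on_lact_right lin_on_ract_left lin_on_ract_right
  lin_on_bact_left lin_on_bact_right lin_on_dsw lin_on_dsw_fun
  hdual_dmult hdual_lact hdual_ract subspace_hdual counit_in_hdual
  subspace_dbl dtens_in_dbl DBDB.subspace_tspace DBDB.tens_in_tspace
  sw_closed[OF vector_space_fscale subspace_dbl] dsw_closed[OF vector_space_fscale subspace_dbl]
  sw_closed[OF vector_space_fscale DBDB.subspace_tspace] dsw_closed[OF vector_space_fscale DBDB.subspace_tspace]

section \<open>Heisenberg product, pairing and Drinfeld coproduct on pure tensors\<close>

lemma heis_mult_bilinear:
  shows "\<beta> \<in> hdual B \<Longrightarrow> dbil fscale (\<lambda>\<alpha> a. sw B (\<lambda>a1 a2. (\<alpha> \<cdot>\<^bsub>B\<^esub> (a1 \<rightharpoonup>\<^bsub>B\<^esub> \<beta>)) \<otimes>\<^bsub>B\<^esub> (a2 * b)) a)"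
    and "\<alpha> \<in> hdual B \<Longrightarrow> dbil fscale (\<lambda>\<beta> b. sw B (\<lambda>a1 a2. (\<alpha> \<cdot>\<^bsub>B\<^esub> (a1 \<rightharpoonup>\<^bsub>B\<^esub> \<beta>)) \<otimes>\<^bsub>B\<^esub> (a2 * b)) a)"
  by (assumption | rule dual_lin_rules)+

lemma heis_mult_dtens:
  assumes "\<mu> \<in> hdual B" "\<nu> \<in> hdual B"
  shows "(\<mu> \<otimes>\<^bsub>B\<^esub> m) \<star>\<^bsub>B\<^esub> (\<nu> \<otimes>\<^bsub>B\<^esub> n) = sw B (\<lambda>m1 m2. (\<mu> \<cdot>\<^bsub>B\<^esub> (m1 \<rightharpoonup>\<^bsub>B\<^esub> \<nu>)) \<otimes>\<^bsub>B\<^esub> (m2 * n)) m"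
  unfolding heis_mult_def by (rule dlift2_dtens[OF vector_space_fscale heis_mult_bilinear assms])

lemma lin_on_heis_mult_left:
  assumes "lin_on sV fscale V g" "\<And>v. v \<in> V \<Longrightarrow> g v \<in> dbl B" "N \<in> dbl B"
  shows "lin_on sV fscale V (\<lambda>v. g v \<star>\<^bsub>B\<^esub> N)"
  unfolding heis_mult_def by (rule lin_on_dlift2_left[OF vector_space_fscale heis_mult_bilinear assms])

lemma lin_on_heis_mult_right:
  assumes "lin_on sV fscale V g" "\<And>v. v \<in> V \<Longrightarrow> g v \<in> dbl B" "M \<in> dbl B"
  shows "lin_on sV fscale V (\<lambda>v. M \<star>\<^bsub>B\<^esub> g v)"
  unfolding heis_mult_def by (rule lin_on_dlift2_right[OF vector_space_fscale heis_mult_bilinear assms])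

lemma heis_mult_closed: "A \<in> dbl B \<Longrightarrow> C \<in> dbl B \<Longrightarrow> A \<star>\<^bsub>B\<^esub> C \<in> dbl B"
  unfolding heis_mult_def
  by (rule dlift2_closed[OF vector_space_fscale heis_mult_bilinear subspace_dbl])
    (assumption | rule dual_lin_rules)+

lemma eta_bilinear:
  shows "\<nu> \<in> hdual B \<Longrightarrow> dbil (*) (\<lambda>\<mu> m. \<mu> 1 * \<nu> m * counit B n)"
    and "\<mu> \<in> hdual B \<Longrightarrow> dbil (*) (\<lambda>\<nu> n. \<mu> 1 * \<nu> m * counit B n)"
  by (assumption | rule bilinear_onI lin_on_times_left lin_on_times_right
      lin_on_counit lin_hdual lin_on_apply lin_on_id)+

lemma eta_dtens: "\<mu> \<in> hdual B \<Longrightarrow> \<nu> \<in> hdual B \<Longrightarrow> eta B (\<mu> \<otimes>\<^bsub>B\<^esub> m) (\<nu> \<otimes>\<^bsub>B\<^esub> n) = \<mu> 1 * \<nu> m * counit B n"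
  unfolding eta_def
  by (rule dlift2_dtens[where f = "\<lambda>\<mu> m \<nu> n. \<mu> 1 * \<nu> m * counit B n", OF vector_space_times])
    (rule eta_bilinear | assumption)+

lemma lin_on_eta_left:
  assumes "lin_on sV fscale V g" "\<And>v. v \<in> V \<Longrightarrow> g v \<in> dbl B" "N \<in> dbl B"
  shows "lin_on sV (*) V (\<lambda>v. eta B (g v) N)"
  unfolding eta_def
  by (rule lin_on_dlift2_left[where f = "\<lambda>\<mu> m \<nu> n. \<mu> 1 * \<nu> m * counit B n", OF vector_space_times])
    (rule eta_bilinear assms | assumption)+

lemma lin_on_eta_right:
  assumes "lin_on sV fscale V g" "\<And>v. v \<in> V \<Longrightarrow> g v \<in> dbl B" "M \<in> dbl B"
  shows "lin_on sV (*) V (\<lambda>v. eta B M (g v))"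
  unfolding eta_def
  by (rule lin_on_dlift2_right[where f = "\<lambda>\<mu> m \<nu> n. \<mu> 1 * \<nu> m * counit B n", OF vector_space_times])
    (rule eta_bilinear assms | assumption)+

lemma drin_comult_bilinear:
  "dbil fscale (\<lambda>\<mu> m. dsw B (\<lambda>\<mu>1 \<mu>2. sw B (\<lambda>m1 m2.
     tens fscale fscale (\<mu>2 \<otimes>\<^bsub>B\<^esub> m1) (\<mu>1 \<otimes>\<^bsub>B\<^esub> m2)) m) \<mu>)"
  by (assumption | rule dual_lin_rules)+

lemma drin_comult_in: "M \<in> dbl B \<Longrightarrow> drin_comult B M \<in> DBDB.tspace"
  unfolding drin_comult_def
  by (rule dlift_closed[OF vector_space_fscale DBDB.subspace_tspace drin_comult_bilinear])
    (assumption | rule dual_lin_rules)+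

lemma drin_comult_dtens: "\<mu> \<in> hdual B \<Longrightarrow> drin_comult B (\<mu> \<otimes>\<^bsub>B\<^esub> m) =
    dsw B (\<lambda>\<mu>1 \<mu>2. sw B (\<lambda>m1 m2. tens fscale fscale (\<mu>2 \<otimes>\<^bsub>B\<^esub> m1) (\<mu>1 \<otimes>\<^bsub>B\<^esub> m2)) m) \<mu>"
  unfolding drin_comult_def by (rule dlift_dtens[OF vector_space_fscale drin_comult_bilinear])

abbreviation ddbil where
  "ddbil sX \<equiv> bilinear_on fscale fscale sX (dbl B) (dbl B)"

lemma lin_on_drin_sw:
  assumes "vector_space sX" "ddbil sX f" "lin_on sV fscale V g" "\<And>v. v \<in> V \<Longrightarrow> g v \<in> dbl B"
  shows "lin_on sV sX V (\<lambda>v. drin_sw B f (g v))"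
  unfolding drin_sw_def
  by (rule DBDB.lin_on_lift_arg[OF assms(1,2)], unfold drin_comult_def,
      rule lin_on_dlift[OF vector_space_fscale drin_comult_bilinear assms(3,4)], assumption,
      rule drin_comult_in[unfolded drin_comult_def, OF assms(4)])

lemma lin_on_drin_sw_fun:
  assumes "vector_space sX" "M \<in> dbl B" "vector_space sU" "module.subspace sU U"
    and "\<And>u. u \<in> U \<Longrightarrow> ddbil sX (F u)"
    and "\<And>X Y. X \<in> dbl B \<Longrightarrow> Y \<in> dbl B \<Longrightarrow> lin_on sU sX U (\<lambda>u. F u X Y)"
  shows "lin_on sU sX U (\<lambda>u. drin_sw B (F u) M)"
  unfolding drin_sw_def by (rule DBDB.lin_on_lift_fun[OF assms(1) drin_comult_in[OF assms(2)] assms(3-)])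

lemma drin_sw_closed:
  assumes "vector_space sX" "module.subspace sX X" "ddbil sX f"
    and "\<And>Y Z. Y \<in> dbl B \<Longrightarrow> Z \<in> dbl B \<Longrightarrow> f Y Z \<in> X" "M \<in> dbl B"
  shows "drin_sw B f M \<in> X"
  unfolding drin_sw_def by (rule DBDB.lift_closed[OF assms(1-4) drin_comult_in[OF assms(5)]])

text \<open>The map induced by \<open>f\<close> on \<open>DBDB.tspace\<close> is linear and hence
  passes through the two Sweedler sums in the value of the coproduct. The crossed order of the dual
  components is that of the coproduct of the Drinfeld double.\<close>

lemma drin_sw_dtens:
  assumes "vector_space sX" and f: "ddbil sX f" and "\<mu> \<in> hdual B"
  shows "drin_sw B f (\<mu> \<otimes>\<^bsub>B\<^esub> m) = dsw B (\<lambda>\<mu>1 \<mu>2. sw B (\<lambda>m1 m2. f (\<mu>2 \<otimes>\<^bsub>B\<^esub> m1) (\<mu>1 \<otimes>\<^bsub>B\<^esub> m2)) m) \<mu>"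
proof -
  note lift = DBDB.lin_on_lift[OF assms(1) f]
  have "drin_sw B f (\<mu> \<otimes>\<^bsub>B\<^esub> m) = dsw B (\<lambda>\<mu>1 \<mu>2. DBDB.lift f (sw B (\<lambda>m1 m2.
      tens fscale fscale (\<mu>2 \<otimes>\<^bsub>B\<^esub> m1) (\<mu>1 \<otimes>\<^bsub>B\<^esub> m2)) m)) \<mu>"
    unfolding drin_sw_def drin_comult_dtens[OF assms(3)]
    by (rule dsw_comm[OF vector_space_fscale DBDB.subspace_tspace assms(1) lift])
      (assumption | rule dual_lin_rules assms(3))+
  also have "\<dots> = dsw B (\<lambda>\<mu>1 \<mu>2. sw B (\<lambda>m1 m2. DBDB.lift f (
      tens fscale fscale (\<mu>2 \<otimes>\<^bsub>B\<^esub> m1) (\<mu>1 \<otimes>\<^bsub>B\<^esub> m2))) m) \<mu>"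
    by (rule dsw_cong, rule sw_comm[OF vector_space_fscale DBDB.subspace_tspace assms(1) lift])
      (assumption | rule dual_lin_rules)+
  also have "\<dots> = dsw B (\<lambda>\<mu>1 \<mu>2. sw B (\<lambda>m1 m2. f (\<mu>2 \<otimes>\<^bsub>B\<^esub> m1) (\<mu>1 \<otimes>\<^bsub>B\<^esub> m2)) m) \<mu>"
    by (intro dsw_cong sw_cong DBDB.lift_tens[OF assms(1) f] dtens_in_dbl)
  finally show ?thesis .
qed

end

section \<open>Inverse antipode of the dual and structure maps of the Drinfeld double\<close>

context hopf_algebra_bij_antipode
begin

lemma hdual_Sinv: "\<beta> \<in> hdual B \<Longrightarrow> (\<lambda>x. \<beta> (Sinv x)) \<in> hdual B"
  by (rule hdual_antimultiplicative_comp[OF _ lin_on_Sinv[OF lin_on_id] Sinv_mult lin_on_antipode[OF lin_on_id]]) auto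

text \<open>\<open>inv_into\<close> picks a preimage in \<open>hdual B\<close>. The composite of
  \<beta> with \<open>Sinv\<close> is one, by \<open>hdual_Sinv\<close>, and it is the only one
  because S is surjective.\<close>

lemma dantipode_inv_eq:
  assumes "\<beta> \<in> hdual B"
  shows "dantipode_inv B \<beta> = (\<lambda>x. \<beta> (Sinv x))"
  unfolding dantipode_inv_def
proof (rule inv_into_f_eq[OF _ hdual_Sinv[OF assms]])
  show "inj_on (dantipode B) (hdual B)"
    by (rule inj_onI) (metis dantipode_def antipode_Sinv ext)
  show "dantipode B (\<lambda>x. \<beta> (Sinv x)) = \<beta>" by (simp add: dantipode_def)
qed

lemma hdual_dantipode_inv: "\<beta> \<in> hdual B \<Longrightarrow> dantipode_inv B \<beta> \<in> hdual B"
  by (simp add: dantipode_inv_eq hdual_Sinv)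

lemma lin_on_dantipode_inv:
  assumes "lin_on sV fscale V g" "\<And>v. v \<in> V \<Longrightarrow> g v \<in> hdual B"
  shows "lin_on sV fscale V (\<lambda>v. dantipode_inv B (g v))"
  by (rule lin_on_comp[OF _ assms])
    (auto simp: lin_on_def dantipode_inv_eq hdual_add hdual_fscale fscale_apply fun_eq_iff)

lemmas bij_lin_rules = dual_lin_rules lin_on_Sinv lin_on_dantipode_inv hdual_dantipode_inv

lemma drin_mult_bilinear:
  shows "\<nu> \<in> hdual B \<Longrightarrow> dbil fscale (\<lambda>\<mu> m. sw3 B (\<lambda>m1 m2 m3.
         (\<mu> \<cdot>\<^bsub>B\<^esub> ((m1 \<rightharpoonup>\<^bsub>B\<^esub> \<nu>) \<leftharpoonup>\<^bsub>B\<^esub> Sinv m3)) \<otimes>\<^bsub>B\<^esub> (m2 * n)) m)"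
    and "\<mu> \<in> hdual B \<Longrightarrow> dbil fscale (\<lambda>\<nu> n. sw3 B (\<lambda>m1 m2 m3.
         (\<mu> \<cdot>\<^bsub>B\<^esub> ((m1 \<rightharpoonup>\<^bsub>B\<^esub> \<nu>) \<leftharpoonup>\<^bsub>B\<^esub> Sinv m3)) \<otimes>\<^bsub>B\<^esub> (m2 * n)) m)"
  unfolding sw3_def by (assumption | rule bij_lin_rules)+

lemma drin_mult_dtens:
  assumes "\<mu> \<in> hdual B" "\<nu> \<in> hdual B"
  shows "(\<mu> \<otimes>\<^bsub>B\<^esub> m) \<diamondop>\<^bsub>B\<^esub> (\<nu> \<otimes>\<^bsub>B\<^esub> n) = sw3 B (\<lambda>m1 m2 m3.
    (\<mu> \<cdot>\<^bsub>B\<^esub> ((m1 \<rightharpoonup>\<^bsub>B\<^esub> \<nu>) \<leftharpoonup>\<^bsub>B\<^esub> Sinv m3)) \<otimes>\<^bsub>B\<^esub> (m2 * n)) m"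
  unfolding drin_mult_def by (rule dlift2_dtens[OF vector_space_fscale drin_mult_bilinear assms])

lemma lin_on_drin_mult_left:
  assumes "lin_on sV fscale V g" "\<And>v. v \<in> V \<Longrightarrow> g v \<in> dbl B" "N \<in> dbl B"
  shows "lin_on sV fscale V (\<lambda>v. g v \<diamondop>\<^bsub>B\<^esub> N)"
  unfolding drin_mult_def by (rule lin_on_dlift2_left[OF vector_space_fscale drin_mult_bilinear assms])

lemma lin_on_drin_mult_right:
  assumes "lin_on sV fscale V g" "\<And>v. v \<in> V \<Longrightarrow> g v \<in> dbl B" "M \<in> dbl B"
  shows "lin_on sV fscale V (\<lambda>v. M \<diamondop>\<^bsub>B\<^esub> g v)"
  unfolding drin_mult_def by (rule lin_on_dlift2_right[OF vector_space_fscale drin_mult_bilinear assms])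

lemma drin_mult_closed: "M \<in> dbl B \<Longrightarrow> N \<in> dbl B \<Longrightarrow> M \<diamondop>\<^bsub>B\<^esub> N \<in> dbl B"
  unfolding drin_mult_def
  by (rule dlift2_closed[OF vector_space_fscale drin_mult_bilinear subspace_dbl], unfold sw3_def)
    (assumption | rule bij_lin_rules)+

lemma drin_act_bilinear:
  shows "\<beta> \<in> hdual B \<Longrightarrow> dbil fscale (\<lambda>\<mu> m. dsw3 B (\<lambda>\<mu>1 \<mu>2 \<mu>3. sw3 B (\<lambda>m1 m2 m3.
         (\<mu>3 \<cdot>\<^bsub>B\<^esub> (m1 \<rightharpoonup>\<^bsub>B\<^esub> \<beta>) \<cdot>\<^bsub>B\<^esub> dantipode_inv B \<mu>2) \<otimes>\<^bsub>B\<^esub>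
         ((m2 * b * antipode B m3) \<leftharpoondown>\<^bsub>B\<^esub> dantipode_inv B \<mu>1)) m) \<mu>)"
    and "\<mu> \<in> hdual B \<Longrightarrow> dbil fscale (\<lambda>\<beta> b. dsw3 B (\<lambda>\<mu>1 \<mu>2 \<mu>3. sw3 B (\<lambda>m1 m2 m3.
         (\<mu>3 \<cdot>\<^bsub>B\<^esub> (m1 \<rightharpoonup>\<^bsub>B\<^esub> \<beta>) \<cdot>\<^bsub>B\<^esub> dantipode_inv B \<mu>2) \<otimes>\<^bsub>B\<^esub>
         ((m2 * b * antipode B m3) \<leftharpoondown>\<^bsub>B\<^esub> dantipode_inv B \<mu>1)) m) \<mu>)"
  unfolding sw3_def dsw3_def by (assumption | rule bij_lin_rules)+

lemma drin_act_dtens: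
  assumes "\<mu> \<in> hdual B" "\<nu> \<in> hdual B"
  shows "(\<mu> \<otimes>\<^bsub>B\<^esub> m) \<triangleright>\<^bsub>B\<^esub> (\<nu> \<otimes>\<^bsub>B\<^esub> n) = dsw3 B (\<lambda>\<mu>1 \<mu>2 \<mu>3. sw3 B (\<lambda>m1 m2 m3.
    (\<mu>3 \<cdot>\<^bsub>B\<^esub> (m1 \<rightharpoonup>\<^bsub>B\<^esub> \<nu>) \<cdot>\<^bsub>B\<^esub> dantipode_inv B \<mu>2) \<otimes>\<^bsub>B\<^esub>
    ((m2 * n * antipode B m3) \<leftharpoondown>\<^bsub>B\<^esub> dantipode_inv B \<mu>1)) m) \<mu>"
  unfolding drin_act_def by (rule dlift2_dtens[OF vector_space_fscale drin_act_bilinear assms])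

lemma lin_on_drin_act_left:
  assumes "lin_on sV fscale V g" "\<And>v. v \<in> V \<Longrightarrow> g v \<in> dbl B" "N \<in> dbl B"
  shows "lin_on sV fscale V (\<lambda>v. g v \<triangleright>\<^bsub>B\<^esub> N)"
  unfolding drin_act_def by (rule lin_on_dlift2_left[OF vector_space_fscale drin_act_bilinear assms])

lemma lin_on_drin_act_right:
  assumes "lin_on sV fscale V g" "\<And>v. v \<in> V \<Longrightarrow> g v \<in> dbl B" "M \<in> dbl B"
  shows "lin_on sV fscale V (\<lambda>v. M \<triangleright>\<^bsub>B\<^esub> g v)"
  unfolding drin_act_def by (rule lin_on_dlift2_right[OF vector_space_fscale drin_act_bilinear assms])

lemma drin_act_closed: "M \<in> dbl B \<Longrightarrow> A \<in> dbl B \<Longrightarrow> M \<triangleright>\<^bsub>B\<^esub> A \<in> dbl B"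
  unfolding drin_act_def
  by (rule dlift2_closed[OF vector_space_fscale drin_act_bilinear subspace_dbl], unfold sw3_def dsw3_def)
    (assumption | rule bij_lin_rules)+

lemma drin_antipode_bilinear:
  "dbil fscale (\<lambda>\<mu> m. (counit B \<otimes>\<^bsub>B\<^esub> antipode B m) \<diamondop>\<^bsub>B\<^esub> (dantipode_inv B \<mu> \<otimes>\<^bsub>B\<^esub> 1))"
  by (assumption | rule bij_lin_rules lin_on_drin_mult_left lin_on_drin_mult_right)+

lemma lin_on_drin_antipode:
  "lin_on sV fscale V g \<Longrightarrow> (\<And>v. v \<in> V \<Longrightarrow> g v \<in> dbl B) \<Longrightarrow> lin_on sV fscale V (\<lambda>v. drin_antipode B (g v))"
  unfolding drin_antipode_def by (rule lin_on_dlift[OF vector_space_fscale drin_antipode_bilinear])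

lemma drin_antipode_closed: "M \<in> dbl B \<Longrightarrow> drin_antipode B M \<in> dbl B"
  unfolding drin_antipode_def
  by (rule dlift_closed[OF vector_space_fscale subspace_dbl drin_antipode_bilinear])
    (assumption | rule drin_mult_closed bij_lin_rules)+

lemma drin_antipode_dtens: "\<mu> \<in> hdual B \<Longrightarrow>
    drin_antipode B (\<mu> \<otimes>\<^bsub>B\<^esub> m) = (counit B \<otimes>\<^bsub>B\<^esub> antipode B m) \<diamondop>\<^bsub>B\<^esub> (dantipode_inv B \<mu> \<otimes>\<^bsub>B\<^esub> 1)"
  unfolding drin_antipode_def by (rule dlift_dtens[OF vector_space_fscale drin_antipode_bilinear])

lemma dbl_fscale: "M \<in> dbl B \<Longrightarrow> fscale c M \<in> dbl B"
proof -
  interpret F: Vector_Spaces.vector_space "fscale :: 'k \<Rightarrow> ('k, 'b) dbl \<Rightarrow> _" by (rule vector_space_fscale)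
  show "M \<in> dbl B \<Longrightarrow> fscale c M \<in> dbl B" by (rule F.subspace_scale[OF subspace_dbl])
qed

lemmas double_rules = bij_lin_rules lin_on_heis_mult_left lin_on_heis_mult_right heis_mult_closed
  lin_on_drin_antipode drin_antipode_closed lin_on_eta_left lin_on_eta_right
  lin_on_drin_sw lin_on_drin_sw_fun drin_sw_closed[OF vector_space_fscale subspace_dbl] dbl_fscale

lemma lin_on_s_map:
  assumes "lin_on sV fscale V g" "\<And>v. v \<in> V \<Longrightarrow> g v \<in> dbl B"
  shows "lin_on sV fscale V (\<lambda>v. s_map B (g v))"
  unfolding s_map_def drin_sw3_def by (assumption | rule assms double_rules)+

lemma s_map_closed: "M \<in> dbl B \<Longrightarrow> s_map B M \<in> dbl B"
  unfolding s_map_def drin_sw3_def by (assumption | rule double_rules)+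

end

section \<open>The doubles as spaces of linear maps\<close>

context hopf_algebra
begin

definition ev :: "'b \<Rightarrow> ('k, 'b) dbl \<Rightarrow> 'b" where
  "ev x M = dlift B (\<lambda>\<mu> m. hscale B (\<mu> x) m) M"

lemma ev_bilinear: "dbil (hscale B) (\<lambda>\<mu> m. hscale B (\<mu> x) m)"
  by (assumption | rule bilinear_onI lin_on_scale_left[OF vector_space] lin_on_scale_right[OF vector_space]
      lin_on_apply lin_on_id)+

lemma ev_dtens: "\<mu> \<in> hdual B \<Longrightarrow> ev x (\<mu> \<otimes>\<^bsub>B\<^esub> m) = hscale B (\<mu> x) m"
  unfolding ev_def by (rule dlift_dtens[OF vector_space ev_bilinear])

lemma lin_on_ev:
  "lin_on sV fscale V g \<Longrightarrow> (\<And>v. v \<in> V \<Longrightarrow> g v \<in> dbl B) \<Longrightarrow> lin_on sV (hscale B) V (\<lambda>v. ev x (g v))"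
  unfolding ev_def by (rule lin_on_dlift[OF vector_space ev_bilinear])

lemma lin_on_ev_point:
  assumes "lin_on sV (hscale B) V g" "M \<in> dbl B"
  shows "lin_on sV (hscale B) V (\<lambda>v. ev (g v) M)"
  by (rule lin_on_comp[OF _ assms(1) UNIV_I], unfold ev_def,
      rule lin_on_dlift_fun[OF vector_space assms(2) vector_space subspace_UNIV_B ev_bilinear],
      rule lin_on_scale_left[OF vector_space lin_hdual])

lemma dbl_eqI:
  assumes "M \<in> dbl B" "N \<in> dbl B" "\<And>x. ev x M = ev x N"
  shows "M = N"
proof -
  interpret T: Vector_Spaces.vector_space "fscale :: 'k \<Rightarrow> ('k, 'b) dbl \<Rightarrow> _"
    by (rule vector_space_fscale)
  interpret V: Vector_Spaces.vector_space "hscale B" by (rule vector_space)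
  have N': "fscale (-1) N \<in> dbl B" using assms(2) by (rule T.subspace_scale[OF subspace_dbl])
  have MN: "M + fscale (-1) N \<in> dbl B" using assms(1) N' by (rule T.subspace_add[OF subspace_dbl])
  have "ev x (M + fscale (-1) N) = ev x M + hscale B (-1) (ev x N)" for x
    by (simp only: lin_onD[OF lin_on_ev[OF lin_on_id]] assms(1,2) N')
  then have "ev x (M + fscale (-1) N) = 0" for x
    using assms(3) V.scale_left_distrib[of 1 "-1" "ev x N"] by simp
  then have "M + fscale (-1) N = 0"
    using MN unfolding ev_def dlift_def dbl_def
    by (intro function_tensor_eq_0[OF vector_space subspace_UNIV_B subspace_hdual])
  then show ?thesis by (simp add: fscale_def fun_eq_iff)
qed

lemma ev_sw:
  assumes "bil fscale f" "\<And>u v. f u v \<in> dbl B"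
  shows "ev x (sw B f b) = sw B (\<lambda>u v. ev x (f u v)) b"
  by (rule sw_comm[OF vector_space_fscale subspace_dbl vector_space lin_on_ev[OF lin_on_id] assms])

lemma ev_dsw:
  assumes "bilinear_on fscale fscale fscale (hdual B) (hdual B) f"
    and "\<And>\<phi> \<psi>. \<phi> \<in> hdual B \<Longrightarrow> \<psi> \<in> hdual B \<Longrightarrow> f \<phi> \<psi> \<in> dbl B" "\<beta> \<in> hdual B"
  shows "ev x (dsw B f \<beta>) = dsw B (\<lambda>\<phi> \<psi>. ev x (f \<phi> \<psi>)) \<beta>"
  by (rule dsw_comm[OF vector_space_fscale subspace_dbl vector_space lin_on_ev[OF lin_on_id] assms])

subsection \<open>Eliminating the coproduct of the dual\<close>

text \<open>Forms are functions on pairs rather than curried functions, so that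
  \<open>fscale\<close> is their scalar multiplication and they make up a subspace to which
  \<open>lin_on\<close> applies.\<close>

definition bilinear_forms :: "('b \<times> 'b \<Rightarrow> 'k) set" where
  "bilinear_forms = {F. bil (*) (\<lambda>x y. F (x, y))}"

text \<open>Evaluation at a pair is a constant so that the linearity rules for it unify only with
  evaluations of forms.\<close>

definition form_at :: "('b \<times> 'b \<Rightarrow> 'k) \<Rightarrow> 'b \<Rightarrow> 'b \<Rightarrow> 'k" where
  "form_at F x y = F (x, y)"

lemma form_at_case [simp]: "form_at (\<lambda>(x, y). f x y) a b = f a b"
  by (simp add: form_at_def)

lemma lin_on_form_at: "lin_on fscale (*) V (\<lambda>F. form_at F x y)"
  by (simp add: lin_on_def form_at_def fscale_def)

lemma lin_on_form_at_left:
  assumes "F \<in> bilinear_forms" "lin_on sV (hscale B) V g"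
  shows "lin_on sV (*) V (\<lambda>v. form_at F (g v) y)"
  using assms(1) unfolding form_at_def bilinear_forms_def
  by (intro lin_on_comp[OF bilinear_onD(1)[OF _ UNIV_I] assms(2) UNIV_I]) simp

lemma lin_on_form_at_right:
  assumes "F \<in> bilinear_forms" "lin_on sV (hscale B) V g"
  shows "lin_on sV (*) V (\<lambda>v. form_at F x (g v))"
  using assms(1) unfolding form_at_def bilinear_forms_def
  by (intro lin_on_comp[OF bilinear_onD(2)[OF _ UNIV_I] assms(2) UNIV_I]) simp

lemma subspace_bilinear_forms: "module.subspace fscale bilinear_forms"
proof -
  interpret F: Vector_Spaces.vector_space "fscale :: 'k \<Rightarrow> ('b \<times> 'b \<Rightarrow> 'k) \<Rightarrow> _"
    by (rule vector_space_fscale)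
  show ?thesis
    by (rule F.subspaceI)
      (simp_all add: bilinear_forms_def bilinear_on_def fscale_def algebra_simps)
qed

text \<open>Over a list representing the coproduct of \<beta>, the forms (x, y) \<mapsto> \<phi>(x)
  \<psi>(y) add up to (x, y) \<mapsto> \<beta>(xy), and L commutes with this finite sum. L may
  itself be a long nested Sweedler sum in B, so a whole expression loses its dual components in one
  step.\<close>

lemma dsw_functional:
  assumes "vector_space sX" and L: "lin_on fscale sX bilinear_forms L" and "\<beta> \<in> hdual B"
  shows "dsw B (\<lambda>\<phi> \<psi>. L (\<lambda>(x, y). \<phi> x * \<psi> y)) \<beta> = L (\<lambda>(x, y). \<beta> (x * y))"
proof -
  have in_forms: "(\<lambda>(x, y). \<phi> x * \<psi> y) \<in> bilinear_forms" if "\<phi> \<in> hdual B" "\<psi> \<in> hdual B" for \<phi> \<psi>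
    using bil_dmult[OF that] by (simp add: bilinear_forms_def)
  have bf: "bilinear_on fscale fscale sX (hdual B) (hdual B) (\<lambda>\<phi> \<psi>. L (\<lambda>(x, y). \<phi> x * \<psi> y))"
    by (rule bilinear_onI; rule lin_on_comp[OF L _ in_forms])
      (simp_all add: lin_on_def fscale_def fun_eq_iff algebra_simps)
  obtain ps where ps: "set ps \<subseteq> hdual B \<times> hdual B"
    "dcomult B \<beta> = (\<Sum>(v, w)\<leftarrow>ps. tens fscale fscale v w)"
    using tensor_space_sum_list[OF vector_space_fscale vector_space_fscale subspace_hdual dcomult_in[OF assms(3)]] .
  note lift = tlift_sum_list[OF vector_space_fscale vector_space_fscale _ subspace_hdual subspace_hdual _ ps(1),
      folded ps(2), folded dsw_def]
  have form: "(\<lambda>(x, y). fst p x * snd p y) \<in> bilinear_forms" if "p \<in> set ps" for p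
    using that ps(1) by (intro in_forms) auto
  have "(\<Sum>p\<leftarrow>ps. (\<lambda>(x, y). fst p x * snd p y)) = (\<lambda>(x, y). \<beta> (x * y))"
  proof
    fix xy :: "'b \<times> 'b"
    have "(\<Sum>p\<leftarrow>qs. (\<lambda>(x, y). fst p x * snd p y)) xy = (\<Sum>(\<phi>, \<psi>)\<leftarrow>qs. \<phi> (fst xy) * \<psi> (snd xy))" for qs
      by (induction qs) (auto simp: split_def)
    then show "(\<Sum>p\<leftarrow>ps. (\<lambda>(x, y). fst p x * snd p y)) xy = (\<lambda>(x, y). \<beta> (x * y)) xy"
      using lift[OF vector_space_times bilinear_on_evaluations] dsw_evaluations[OF assms(3)] by (simp add: split_def)
  qed
  moreover have "dsw B (\<lambda>\<phi> \<psi>. L (\<lambda>(x, y). \<phi> x * \<psi> y)) \<beta> = (\<Sum>p\<leftarrow>ps. L (\<lambda>(x, y). fst p x * snd p y))"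
    using lift[OF assms(1) bf] by (simp add: split_def)
  moreover have "L (\<Sum>p\<leftarrow>ps. (\<lambda>(x, y). fst p x * snd p y)) = (\<Sum>p\<leftarrow>ps. L (\<lambda>(x, y). fst p x * snd p y))"
    by (rule lin_on_sum_list(1)[OF vector_space_fscale subspace_bilinear_forms assms(1) L form])
  ultimately show ?thesis by simp
qed

lemma dmult_counit_left: "\<beta> \<in> hdual B \<Longrightarrow> counit B \<cdot>\<^bsub>B\<^esub> \<beta> = \<beta>"
  unfolding dmult_def by (rule ext) (rule sw_counit_left[OF vector_space_times lin_hdual])

lemma scale_scale: "hscale B c (hscale B d y) = hscale B (c * d) y"
  using vector_space by (rule vector_space.vector_space_assms(3))

lemma scale_dmult:
  assumes "\<alpha> \<in> hdual B" "\<beta> \<in> hdual B"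
  shows "hscale B ((\<alpha> \<cdot>\<^bsub>B\<^esub> \<beta>) x) w = sw B (\<lambda>x1 x2. hscale B (\<alpha> x1) (hscale B (\<beta> x2) w)) x"
  unfolding dmult_def scale_scale
  by (rule sw_comm[OF vector_space_times subspace_UNIV_K vector_space
        lin_on_scale_left[OF vector_space lin_on_id] bil_dmult[OF assms] UNIV_I])

text \<open>The left factor enters only through its evaluations \<open>ev x1 A\<close>, so iterated
  products can be evaluated from the outside in. By linearity in A the computation is done for pure
  tensors: evaluating the product in the dual splits x, and the translate of \<beta> supplies the
  argument x'' p.\<close>

lemma ev_heis_mult:
  assumes "A \<in> dbl B" and \<beta>: "\<beta> \<in> hdual B"
  shows "ev x (A \<star>\<^bsub>B\<^esub> (\<beta> \<otimes>\<^bsub>B\<^esub> b)) =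
    sw B (\<lambda>x1 x2. sw B (\<lambda>p q. hscale B (\<beta> (x2 * p)) (q * b)) (ev x1 A)) x"
proof (rule dbl_ext[OF vector_space _ _ _ assms(1)])
  note r = lin_rules lin_on_hdual[OF \<beta>]
  show "lin_on fscale (hscale B) (dbl B) (\<lambda>A. ev x (A \<star>\<^bsub>B\<^esub> (\<beta> \<otimes>\<^bsub>B\<^esub> b)))"
    by (assumption | rule lin_on_ev lin_on_heis_mult_left lin_on_id heis_mult_closed dtens_in_dbl \<beta>)+
  show "lin_on fscale (hscale B) (dbl B) (\<lambda>A. sw B (\<lambda>x1 x2.
      sw B (\<lambda>p q. hscale B (\<beta> (x2 * p)) (q * b)) (ev x1 A)) x)"
    by (assumption | rule r lin_on_ev lin_on_ev_point subspace_dbl)+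
  fix \<alpha> a assume \<alpha>: "\<alpha> \<in> hdual B"
  note r = r lin_on_hdual[OF \<alpha>]
  have "ev x ((\<alpha> \<otimes>\<^bsub>B\<^esub> a) \<star>\<^bsub>B\<^esub> (\<beta> \<otimes>\<^bsub>B\<^esub> b)) =
      sw B (\<lambda>a1 a2. ev x ((\<alpha> \<cdot>\<^bsub>B\<^esub> (a1 \<rightharpoonup>\<^bsub>B\<^esub> \<beta>)) \<otimes>\<^bsub>B\<^esub> (a2 * b))) a"
    unfolding heis_mult_dtens[OF \<alpha> \<beta>]
    by (rule ev_sw) (assumption | rule dual_lin_rules \<alpha> \<beta>)+
  also have "\<dots> = sw B (\<lambda>a1 a2. sw B (\<lambda>x1 x2. hscale B (\<alpha> x1) (hscale B (\<beta> (x2 * a1)) (a2 * b))) x) a"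
    by (simp add: ev_dtens scale_dmult hdual_dmult hdual_lact \<alpha> \<beta>) (simp add: lact_eq[OF \<beta>])
  also have "\<dots> = sw B (\<lambda>x1 x2. sw B (\<lambda>a1 a2. hscale B (\<alpha> x1) (hscale B (\<beta> (x2 * a1)) (a2 * b))) a) x"
    by (rule sw_swap) (rule r)+
  also have "\<dots> = sw B (\<lambda>x1 x2. hscale B (\<alpha> x1) (sw B (\<lambda>a1 a2. hscale B (\<beta> (x2 * a1)) (a2 * b)) a)) x"
    by (rule sw_cong, rule sw_comm[OF vector_space subspace_UNIV_B vector_space
         lin_on_scale_right[OF vector_space lin_on_id] _ UNIV_I, symmetric]) (rule r)+
  \<comment> \<open>The scalar \<alpha>(x') is absorbed into the argument of the inner splitting,
    since \<open>ev\<close> of the pure tensor at x' is \<alpha>(x') a.\<close>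
  also have "\<dots> = sw B (\<lambda>x1 x2. sw B (\<lambda>a1 a2. hscale B (\<beta> (x2 * a1)) (a2 * b)) (ev x1 (\<alpha> \<otimes>\<^bsub>B\<^esub> a))) x"
    unfolding ev_dtens[OF \<alpha>]
    by (rule sw_cong, rule lin_onD(2)[OF lin_on_sw[OF vector_space _ lin_on_id] UNIV_I, symmetric]) (rule r)+
  finally show "ev x ((\<alpha> \<otimes>\<^bsub>B\<^esub> a) \<star>\<^bsub>B\<^esub> (\<beta> \<otimes>\<^bsub>B\<^esub> b)) = \<dots>" .
qed

end

section \<open>The map \<open>s\<close>\<close>

context hopf_algebra_bij_antipode
begin

text \<open>As \<epsilon> is a left unit of the dual, the product is just the splitting of S(m),
  whose components \<open>sw_antipode\<close> reverses.\<close>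

lemma heis_mult_antipodes:
  assumes \<mu>: "\<mu> \<in> hdual B"
  shows "(counit B \<otimes> antipode B m) \<star> (dantipode_inv B \<mu> \<otimes> 1) =
    sw B (\<lambda>m1 m2. (antipode B m2 \<rightharpoonup> dantipode_inv B \<mu>) \<otimes> antipode B m1) m"
proof -
  have \<nu>: "dantipode_inv B \<mu> \<in> hdual B" by (rule hdual_dantipode_inv[OF \<mu>])
  have "(counit B \<otimes> antipode B m) \<star> (dantipode_inv B \<mu> \<otimes> 1) =
      sw B (\<lambda>a1 a2. (a1 \<rightharpoonup> dantipode_inv B \<mu>) \<otimes> a2) (antipode B m)"
    by (simp add: heis_mult_dtens[OF counit_in_hdual \<nu>] dmult_counit_left hdual_lact \<nu>)
  also have "\<dots> = sw B (\<lambda>m1 m2. (antipode B m2 \<rightharpoonup> dantipode_inv B \<mu>) \<otimes> antipode B m1) m"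
    by (rule sw_antipode[OF vector_space_fscale]) (assumption | rule bij_lin_rules \<nu>)+
  finally show ?thesis .
qed

text \<open>Reversal of components under S puts S(u), for the first component u of n, into the third
  place of the Drinfeld product, where the built-in S^-1 turns it back into u.\<close>

lemma drin_antipode_eq:
  assumes \<mu>: "\<mu> \<in> hdual B"
  shows "drin_antipode B (\<mu> \<otimes> n) = sw B (\<lambda>u v. sw B (\<lambda>v1 v2.
    ((antipode B v2 \<rightharpoonup> dantipode_inv B \<mu>) \<leftharpoonup> u) \<otimes> antipode B v1) v) n"
proof -
  let ?\<nu> = "dantipode_inv B \<mu>"
  have \<nu>: "?\<nu> \<in> hdual B" by (rule hdual_dantipode_inv[OF \<mu>])
  note r = bij_lin_rules \<nu>
  have "drin_antipode B (\<mu> \<otimes> n) =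
      sw B (\<lambda>z p3. sw B (\<lambda>p1 p2. ((p1 \<rightharpoonup> ?\<nu>) \<leftharpoonup> Sinv p3) \<otimes> p2) z) (antipode B n)"
    by (simp add: drin_antipode_dtens[OF \<mu>] drin_mult_dtens[OF counit_in_hdual \<nu>] sw3_def
        dmult_counit_left hdual_lact hdual_ract \<nu>)
  also have "\<dots> = sw B (\<lambda>u v. sw B (\<lambda>p1 p2. ((p1 \<rightharpoonup> ?\<nu>) \<leftharpoonup> Sinv (antipode B u)) \<otimes> p2) (antipode B v)) n"
    by (rule sw_antipode[OF vector_space_fscale]) (assumption | rule r)+
  also have "\<dots> = sw B (\<lambda>u v. sw B (\<lambda>v1 v2.
      ((antipode B v2 \<rightharpoonup> ?\<nu>) \<leftharpoonup> Sinv (antipode B u)) \<otimes> antipode B v1) v) n"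
    by (rule sw_cong, rule sw_antipode[OF vector_space_fscale]) (assumption | rule r)+
  finally show ?thesis by simp
qed

text \<open>The component \<mu>2 \<otimes> m1 is split once more, with dual components \<nu>1 and
  \<nu>2, and the pairing becomes \<nu>2(1) \<nu>1(n1) \<epsilon>(n2). The counit removes the
  splitting of m1 and the evaluation at 1 that of \<mu>2, so only the scalar \<mu>2(m1)
  remains.\<close>

lemma s_map_dtens_eta:
  assumes \<mu>: "\<mu> \<in> hdual B"
  shows "s_map B (\<mu> \<otimes> m) =
    dsw B (\<lambda>\<mu>1 \<mu>2. sw B (\<lambda>m1 m2. fscale (\<mu>2 m1) (drin_antipode B (\<mu>1 \<otimes> m2))) m) \<mu>"
proof -
  have "s_map B (\<mu> \<otimes> m) = dsw B (\<lambda>\<mu>1 \<mu>2. sw B (\<lambda>m1 m2. drin_sw B (\<lambda>X1 X2.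
      fscale (eta B X1 X2) (drin_antipode B (\<mu>1 \<otimes> m2))) (\<mu>2 \<otimes> m1)) m) \<mu>"
    unfolding s_map_def drin_sw3_def
    by (rule drin_sw_dtens[OF vector_space_fscale _ \<mu>]) (assumption | rule double_rules)+
  also have "\<dots> = dsw B (\<lambda>\<mu>1 \<mu>2. sw B (\<lambda>m1 m2. fscale (\<mu>2 m1) (drin_antipode B (\<mu>1 \<otimes> m2))) m) \<mu>"
  proof (intro dsw_cong sw_cong)
    fix \<mu>1 \<mu>2 m1 m2 assume h: "\<mu>1 \<in> hdual B" "\<mu>2 \<in> hdual B"
    define Z where "Z = drin_antipode B (\<mu>1 \<otimes> m2)"
    have "drin_sw B (\<lambda>X1 X2. fscale (eta B X1 X2) Z) (\<mu>2 \<otimes> m1) =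
        dsw B (\<lambda>\<nu>1 \<nu>2. sw B (\<lambda>n1 n2. fscale (eta B (\<nu>2 \<otimes> n1) (\<nu>1 \<otimes> n2)) Z) m1) \<mu>2"
      by (rule drin_sw_dtens[OF vector_space_fscale _ h(2)]) (assumption | rule double_rules)+
    also have "\<dots> = dsw B (\<lambda>\<nu>1 \<nu>2. fscale (\<nu>1 m1 * \<nu>2 1) Z) \<mu>2"
    proof (rule dsw_cong)
      fix \<nu>1 \<nu>2 assume n: "\<nu>1 \<in> hdual B" "\<nu>2 \<in> hdual B"
      have "sw B (\<lambda>n1 n2. fscale (eta B (\<nu>2 \<otimes> n1) (\<nu>1 \<otimes> n2)) Z) m1 =
          sw B (\<lambda>n1 n2. fscale (counit B n2) (fscale (\<nu>1 n1 * \<nu>2 1) Z)) m1"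
        by (simp add: eta_dtens n fscale_def mult_ac)
      also have "\<dots> = fscale (\<nu>1 m1 * \<nu>2 1) Z"
        by (rule sw_counit_right[OF vector_space_fscale])
          (rule lin_on_scale_left[OF vector_space_fscale] lin_on_times_left lin_hdual n)+
      finally show "sw B (\<lambda>n1 n2. fscale (eta B (\<nu>2 \<otimes> n1) (\<nu>1 \<otimes> n2)) Z) m1 = fscale (\<nu>1 m1 * \<nu>2 1) Z" .
    qed
    also have "\<dots> = fscale (dsw B (\<lambda>\<nu>1 \<nu>2. \<nu>1 m1 * \<nu>2 1) \<mu>2) Z"
      by (rule dsw_comm[OF vector_space_times subspace_UNIV_K vector_space_fscale
            lin_on_scale_left[OF vector_space_fscale lin_on_id] bilinear_on_evaluations UNIV_I h(2), symmetric])
    finally show "drin_sw B (\<lambda>X1 X2. fscale (eta B X1 X2) (drin_antipode B (\<mu>1 \<otimes> m2))) (\<mu>2 \<otimes> m1) =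
        fscale (\<mu>2 m1) (drin_antipode B (\<mu>1 \<otimes> m2))"
      by (simp add: dsw_evaluations[OF h(2)] Z_def)
  qed
  finally show ?thesis .
qed

lemma s_map_dtens:
  assumes \<mu>: "\<mu> \<in> hdual B"
  shows "s_map B (\<mu> \<otimes> m) = sw B (\<lambda>m1 m2. (antipode B m2 \<rightharpoonup> dantipode_inv B \<mu>) \<otimes> antipode B m1) m"
proof (rule dbl_eqI)
  let ?S = "antipode B" and ?s = "hscale B"
  have \<nu>: "dantipode_inv B \<mu> \<in> hdual B" by (rule hdual_dantipode_inv[OF \<mu>])
  show "s_map B (\<mu> \<otimes> m) \<in> dbl B" by (rule s_map_closed[OF dtens_in_dbl[OF \<mu>]])
  show "sw B (\<lambda>m1 m2. (?S m2 \<rightharpoonup> dantipode_inv B \<mu>) \<otimes> ?S m1) m \<in> dbl B"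
    by (assumption | rule bij_lin_rules \<mu>)+
  fix x
  have ev_antipode: "ev x (drin_antipode B (\<mu>1 \<otimes> n)) =
      sw B (\<lambda>u v. sw B (\<lambda>v1 v2. ?s (\<mu>1 (v2 * Sinv x * Sinv u)) (?S v1)) v) n"
    if \<mu>1: "\<mu>1 \<in> hdual B" for \<mu>1 n
  proof -
    let ?\<nu> = "dantipode_inv B \<mu>1"
    have \<nu>: "?\<nu> \<in> hdual B" by (rule hdual_dantipode_inv[OF \<mu>1])
    have "ev x (drin_antipode B (\<mu>1 \<otimes> n)) =
        sw B (\<lambda>u v. ev x (sw B (\<lambda>v1 v2. ((?S v2 \<rightharpoonup> ?\<nu>) \<leftharpoonup> u) \<otimes> ?S v1) v)) n"
      unfolding drin_antipode_eq[OF \<mu>1] by (rule ev_sw) (assumption | rule bij_lin_rules \<mu>1)+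
    also have "\<dots> = sw B (\<lambda>u v. sw B (\<lambda>v1 v2. ev x (((?S v2 \<rightharpoonup> ?\<nu>) \<leftharpoonup> u) \<otimes> ?S v1)) v) n"
      by (rule sw_cong, rule ev_sw) (assumption | rule bij_lin_rules \<mu>1)+
    also have "\<dots> = sw B (\<lambda>u v. sw B (\<lambda>v1 v2. ?s (\<mu>1 (v2 * Sinv x * Sinv u)) (?S v1)) v) n"
    proof (intro sw_cong)
      fix u v1 v2
      have "((?S v2 \<rightharpoonup> ?\<nu>) \<leftharpoonup> u) x = \<mu>1 (Sinv (u * x * ?S v2))"
        unfolding ract_eq[OF hdual_lact[OF \<nu>]] unfolding lact_eq[OF \<nu>]
        by (simp add: dantipode_inv_eq[OF \<mu>1])
      then show "ev x (((?S v2 \<rightharpoonup> ?\<nu>) \<leftharpoonup> u) \<otimes> ?S v1) = ?s (\<mu>1 (v2 * Sinv x * Sinv u)) (?S v1)"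
        by (simp add: ev_dtens[OF hdual_ract[OF hdual_lact[OF \<nu>]]] Sinv_mult mult.assoc)
    qed
    finally show ?thesis .
  qed
  have "ev x (s_map B (\<mu> \<otimes> m)) =
      dsw B (\<lambda>\<mu>1 \<mu>2. ev x (sw B (\<lambda>m1 m2. fscale (\<mu>2 m1) (drin_antipode B (\<mu>1 \<otimes> m2))) m)) \<mu>"
    unfolding s_map_dtens_eta[OF \<mu>]
    by (rule ev_dsw) (assumption | rule double_rules \<mu> lin_hdual lin_on_apply)+
  also have "\<dots> = dsw B (\<lambda>\<mu>1 \<mu>2. sw B (\<lambda>m1 m2. ?s (\<mu>2 m1) (ev x (drin_antipode B (\<mu>1 \<otimes> m2)))) m) \<mu>"
  proof (rule dsw_cong)
    fix \<mu>1 \<mu>2 assume h: "\<mu>1 \<in> hdual B" "\<mu>2 \<in> hdual B"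
    have "ev x (sw B (\<lambda>m1 m2. fscale (\<mu>2 m1) (drin_antipode B (\<mu>1 \<otimes> m2))) m) =
        sw B (\<lambda>m1 m2. ev x (fscale (\<mu>2 m1) (drin_antipode B (\<mu>1 \<otimes> m2)))) m"
      by (rule ev_sw) (assumption | rule double_rules h lin_hdual)+
    then show "ev x (sw B (\<lambda>m1 m2. fscale (\<mu>2 m1) (drin_antipode B (\<mu>1 \<otimes> m2))) m) =
        sw B (\<lambda>m1 m2. ?s (\<mu>2 m1) (ev x (drin_antipode B (\<mu>1 \<otimes> m2)))) m"
      by (simp add: lin_onD(2)[OF lin_on_ev[OF lin_on_id]] drin_antipode_closed dtens_in_dbl h)
  qed
  also have "\<dots> = dsw B (\<lambda>\<mu>1 \<mu>2. sw B (\<lambda>m1 m2. sw B (\<lambda>u v. sw B (\<lambda>v1 v2.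
      ?s (\<mu>1 (v2 * Sinv x * Sinv u) * \<mu>2 m1) (?S v1)) v) m2) m) \<mu>"
  proof (intro dsw_cong, rule sw_cong)
    fix \<mu>1 \<mu>2 m1 m2 assume h: "\<mu>1 \<in> hdual B" "\<mu>2 \<in> hdual B"
    note r = lin_rules lin_on_Sinv lin_on_hdual[OF h(1)]
    note c = sw_comm[OF vector_space subspace_UNIV_B vector_space lin_on_scale_right[OF vector_space lin_on_id] _ UNIV_I]
    have "?s (\<mu>2 m1) (ev x (drin_antipode B (\<mu>1 \<otimes> m2))) =
      sw B (\<lambda>u v. ?s (\<mu>2 m1) (sw B (\<lambda>v1 v2. ?s (\<mu>1 (v2 * Sinv x * Sinv u)) (?S v1)) v)) m2"
      unfolding ev_antipode[OF h(1)] by (rule c) (rule r)+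
    also have "\<dots> = sw B (\<lambda>u v. sw B (\<lambda>v1 v2. ?s (\<mu>2 m1) (?s (\<mu>1 (v2 * Sinv x * Sinv u)) (?S v1))) v) m2"
      by (rule sw_cong, rule c) (rule r)+
    finally show "?s (\<mu>2 m1) (ev x (drin_antipode B (\<mu>1 \<otimes> m2))) =
      sw B (\<lambda>u v. sw B (\<lambda>v1 v2. ?s (\<mu>1 (v2 * Sinv x * Sinv u) * \<mu>2 m1) (?S v1)) v) m2"
      by (simp add: scale_scale mult.commute)
  qed
  \<comment> \<open>The dual components merge: a product \<mu>1(p) \<mu>2(m1) is replaced by \<mu>(p
    m1). The functional is stated with \<open>form_at\<close> for the sake of the linearity rules,
    and \<open>form_at_case\<close> unfolds it at the two concrete forms.\<close>
  also have "\<dots> = sw B (\<lambda>m1 m2. sw B (\<lambda>u v. sw B (\<lambda>v1 v2.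
      ?s (\<mu> (v2 * Sinv x * Sinv u * m1)) (?S v1)) v) m2) m"
    using dsw_functional[OF vector_space _ \<mu>, of "\<lambda>F. sw B (\<lambda>m1 m2. sw B (\<lambda>u v. sw B (\<lambda>v1 v2.
      ?s (form_at F (v2 * Sinv x * Sinv u) m1) (?S v1)) v) m2) m", unfolded form_at_case]
    by this (assumption | rule lin_rules lin_on_Sinv lin_on_form_at_left lin_on_form_at_right
        lin_on_form_at subspace_bilinear_forms)+
  \<comment> \<open>Coassociativity pairs m1 with u, the component right after it, so that
    \<open>sw_Sinv\<close> can contract S^-1(u) m1.\<close>
  also have "\<dots> = sw B (\<lambda>w v. sw B (\<lambda>m1 u. sw B (\<lambda>v1 v2.
      ?s (\<mu> (v2 * Sinv x * (Sinv u * m1))) (?S v1)) v) w) m"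
    unfolding mult.assoc
    by (rule sw_coassoc[OF vector_space, symmetric]) (rule lin_rules lin_on_Sinv lin_on_hdual[OF \<mu>])+
  also have "\<dots> = sw B (\<lambda>w v. ?s (counit B w) (sw B (\<lambda>v1 v2. ?s (\<mu> (v2 * Sinv x * 1)) (?S v1)) v)) m"
    by (rule sw_cong, rule sw_Sinv[OF vector_space]) (rule lin_rules lin_on_hdual[OF \<mu>])+
  also have "\<dots> = sw B (\<lambda>v1 v2. ?s (\<mu> (v2 * Sinv x * 1)) (?S v1)) m"
    by (rule sw_counit_left[OF vector_space]) (rule lin_rules lin_on_hdual[OF \<mu>])+
  also have "\<dots> = sw B (\<lambda>m1 m2. ev x ((?S m2 \<rightharpoonup> dantipode_inv B \<mu>) \<otimes> ?S m1)) m"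
    unfolding ev_dtens[OF hdual_lact[OF \<nu>]] unfolding lact_eq[OF \<nu>]
    by (simp add: dantipode_inv_eq[OF \<mu>] Sinv_mult)
  also have "\<dots> = ev x (sw B (\<lambda>m1 m2. (?S m2 \<rightharpoonup> dantipode_inv B \<mu>) \<otimes> ?S m1) m)"
    by (rule ev_sw[symmetric]) (assumption | rule bij_lin_rules \<mu>)+
  finally show "ev x (s_map B (\<mu> \<otimes> m)) = \<dots>" .
qed

section \<open>The action\<close>

text \<open>Multiplicativity of \<Delta>, used twice, is combined with \<open>sw_antipode\<close>,
  whose reversal puts c'' into the first slot. Elements of this shape form the B-part of the
  action.\<close>

lemma sw_conjugate:
  assumes sX: "vector_space sX" and f: "bil sX f"
  shows "sw B f (b * a * antipode B c) = sw B (\<lambda>b1 b2. sw B (\<lambda>a1 a2. sw B (\<lambda>c1 c2.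
    f (b1 * a1 * antipode B c2) (b2 * a2 * antipode B c1)) c) a) b"
proof -
  note r = lin_rules sX lin_on_comp[OF bilinear_onD(1)[OF f UNIV_I]]
    lin_on_comp[OF bilinear_onD(2)[OF f UNIV_I]]
  have "sw B f (b * a * antipode B c) =
      sw B (\<lambda>p q. sw B (\<lambda>u v. f (p * u) (q * v)) (antipode B c)) (b * a)"
    by (rule sw_mult[OF sX f])
  also have "\<dots> = sw B (\<lambda>p q. sw B (\<lambda>c1 c2. f (p * antipode B c2) (q * antipode B c1)) c) (b * a)"
    by (rule sw_cong, rule sw_antipode[OF sX]) (rule r)+
  also have "\<dots> = sw B (\<lambda>b1 b2. sw B (\<lambda>a1 a2. sw B (\<lambda>c1 c2.
      f (b1 * a1 * antipode B c2) (b2 * a2 * antipode B c1)) c) a) b"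
    by (rule sw_mult[OF sX]) (rule r)+
  finally show ?thesis .
qed

text \<open>By \<open>s_map_dtens\<close> the value of s is a Sweedler sum of pure tensors, to which
  \<open>ev_heis_mult\<close> applies termwise. The splitting of n is moved innermost, so that what
  remains is a bilinear map in (p, q) applied to the coproduct of \<open>ev x1 A\<close>, ready for
  substitution of another product.\<close>

lemma ev_heis_mult_s_map:
  assumes A: "A \<in> dbl B" and \<mu>: "\<mu> \<in> hdual B"
  shows "ev x (A \<star> s_map B (\<mu> \<otimes> n)) = sw B (\<lambda>x1 x2. sw B (\<lambda>p q. sw B (\<lambda>n1 n2.
    hscale B (\<mu> (Sinv (x2 * p * antipode B n2))) (q * antipode B n1)) n) (ev x1 A)) x"
proof -
  let ?S = "antipode B" and ?\<nu> = "dantipode_inv B \<mu>"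
  have \<nu>: "?\<nu> \<in> hdual B" by (rule hdual_dantipode_inv[OF \<mu>])
  note r = lin_rules lin_on_Sinv lin_on_hdual[OF \<mu>]
  have "A \<star> s_map B (\<mu> \<otimes> n) = sw B (\<lambda>n1 n2. A \<star> ((?S n2 \<rightharpoonup> ?\<nu>) \<otimes> ?S n1)) n"
    unfolding s_map_dtens[OF \<mu>]
    by (rule sw_comm[OF vector_space_fscale subspace_dbl vector_space_fscale])
      (assumption | rule double_rules A \<mu>)+
  then have "ev x (A \<star> s_map B (\<mu> \<otimes> n)) = ev x (sw B (\<lambda>n1 n2. A \<star> ((?S n2 \<rightharpoonup> ?\<nu>) \<otimes> ?S n1)) n)"
    by (rule arg_cong)
  also have "\<dots> = sw B (\<lambda>n1 n2. ev x (A \<star> ((?S n2 \<rightharpoonup> ?\<nu>) \<otimes> ?S n1))) n"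
    by (rule ev_sw) (assumption | rule double_rules A \<mu>)+
  also have "\<dots> = sw B (\<lambda>n1 n2. sw B (\<lambda>x1 x2. sw B (\<lambda>p q.
      hscale B (\<mu> (Sinv (x2 * p * ?S n2))) (q * ?S n1)) (ev x1 A)) x) n"
    unfolding ev_heis_mult[OF A hdual_lact[OF \<nu>]] unfolding lact_eq[OF \<nu>]
    unfolding dantipode_inv_eq[OF \<mu>] ..
  also have "\<dots> = sw B (\<lambda>x1 x2. sw B (\<lambda>n1 n2. sw B (\<lambda>p q.
      hscale B (\<mu> (Sinv (x2 * p * ?S n2))) (q * ?S n1)) (ev x1 A)) n) x"
    by (rule sw_swap) (rule r lin_on_ev_point A)+
  also have "\<dots> = sw B (\<lambda>x1 x2. sw B (\<lambda>p q. sw B (\<lambda>n1 n2.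
      hscale B (\<mu> (Sinv (x2 * p * ?S n2))) (q * ?S n1)) n) (ev x1 A)) x"
    by (rule sw_cong, rule sw_swap) (rule r)+
  finally show ?thesis .
qed

text \<open>\<open>ev_heis_mult_s_map\<close> handles the last factor and
  \<open>ev_heis_mult\<close> the first product. The values of \<mu>1 and \<mu>2 are grouped
  together, as one value of the form that \<open>dsw_functional\<close> will eliminate.\<close>

lemma ev_heis_product:
  assumes \<mu>1: "\<mu>1 \<in> hdual B" and \<mu>2: "\<mu>2 \<in> hdual B" and \<alpha>: "\<alpha> \<in> hdual B"
  shows "ev x ((\<mu>2 \<otimes> z) \<star> (\<alpha> \<otimes> a) \<star> s_map B (\<mu>1 \<otimes> n)) =
    sw B (\<lambda>x' x3. sw B (\<lambda>x1 x2. sw B (\<lambda>m1 m2.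
      sw B (\<lambda>r1 r2. sw B (\<lambda>a1 a2. sw B (\<lambda>n1 n2.
        hscale B (\<alpha> (x2 * m1) * (\<mu>1 (Sinv (x3 * (r1 * a1) * antipode B n2)) * \<mu>2 x1))
          (r2 * a2 * antipode B n1)) n) a) m2) z) x') x"
proof -
  let ?S = "antipode B" and ?s = "hscale B"
  let ?G = "\<lambda>x3 p q. sw B (\<lambda>n1 n2. ?s (\<mu>1 (Sinv (x3 * p * ?S n2))) (q * ?S n1)) n"
  note r = lin_rules lin_on_Sinv lin_on_hdual[OF \<mu>1] lin_on_hdual[OF \<mu>2] lin_on_hdual[OF \<alpha>]
  note B_comm = sw_comm[OF vector_space subspace_UNIV_B vector_space _ _ UNIV_I]
  note s_comm = B_comm[OF lin_on_scale_right[OF vector_space lin_on_id]]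
  have "ev x ((\<mu>2 \<otimes> z) \<star> (\<alpha> \<otimes> a) \<star> s_map B (\<mu>1 \<otimes> n)) =
      sw B (\<lambda>x' x3. sw B (?G x3) (ev x' ((\<mu>2 \<otimes> z) \<star> (\<alpha> \<otimes> a)))) x"
    by (rule ev_heis_mult_s_map[OF heis_mult_closed[OF dtens_in_dbl[OF \<mu>2] dtens_in_dbl[OF \<alpha>]] \<mu>1])
  also have "\<dots> = sw B (\<lambda>x' x3. sw B (\<lambda>x1 x2. sw B (\<lambda>m1 m2. ?s (\<mu>2 x1) (?s (\<alpha> (x2 * m1))
      (sw B (?G x3) (m2 * a)))) z) x') x"
  proof (rule sw_cong)
    fix x' x3
    \<comment> \<open>Splitting an element and then applying \<open>?G x3\<close> is linear, so it
      can be moved through the Sweedler sums and scalars of the first product.\<close>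
    have lG: "lin ?s ?s (sw B (?G x3))"
      by (rule lin_on_sw[OF vector_space _ lin_on_id]) (rule r)+
    have "ev x' ((\<mu>2 \<otimes> z) \<star> (\<alpha> \<otimes> a)) =
        sw B (\<lambda>x1 x2. sw B (\<lambda>m1 m2. ?s (\<alpha> (x2 * m1)) (m2 * a)) (?s (\<mu>2 x1) z)) x'"
      unfolding ev_heis_mult[OF dtens_in_dbl[OF \<mu>2] \<alpha>] ev_dtens[OF \<mu>2] ..
    also have "\<dots> = sw B (\<lambda>x1 x2. ?s (\<mu>2 x1) (sw B (\<lambda>m1 m2. ?s (\<alpha> (x2 * m1)) (m2 * a)) z)) x'"
      by (rule sw_cong, rule lin_onD(2)[OF lin_on_sw[OF vector_space _ lin_on_id] UNIV_I]) (rule r)+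
    also have "\<dots> = sw B (\<lambda>x1 x2. sw B (\<lambda>m1 m2. ?s (\<mu>2 x1) (?s (\<alpha> (x2 * m1)) (m2 * a))) z) x'"
      by (rule sw_cong, rule s_comm) (rule r)+
    finally have "sw B (?G x3) (ev x' ((\<mu>2 \<otimes> z) \<star> (\<alpha> \<otimes> a))) =
        sw B (?G x3) (sw B (\<lambda>x1 x2. sw B (\<lambda>m1 m2. ?s (\<mu>2 x1) (?s (\<alpha> (x2 * m1)) (m2 * a))) z) x')"
      by (rule arg_cong)
    also have "\<dots> = sw B (\<lambda>x1 x2. sw B (?G x3)
        (sw B (\<lambda>m1 m2. ?s (\<mu>2 x1) (?s (\<alpha> (x2 * m1)) (m2 * a))) z)) x'"
      by (rule B_comm[OF lG]) (rule r)+
    also have "\<dots> = sw B (\<lambda>x1 x2. sw B (\<lambda>m1 m2. sw B (?G x3)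
        (?s (\<mu>2 x1) (?s (\<alpha> (x2 * m1)) (m2 * a)))) z) x'"
      by (rule sw_cong, rule B_comm[OF lG]) (rule r)+
    finally show "sw B (?G x3) (ev x' ((\<mu>2 \<otimes> z) \<star> (\<alpha> \<otimes> a))) =
        sw B (\<lambda>x1 x2. sw B (\<lambda>m1 m2. ?s (\<mu>2 x1) (?s (\<alpha> (x2 * m1)) (sw B (?G x3) (m2 * a)))) z) x'"
      by (simp only: lin_onD(2)[OF lG UNIV_I])
  qed
  also have "\<dots> = sw B (\<lambda>x' x3. sw B (\<lambda>x1 x2. sw B (\<lambda>m1 m2.
      sw B (\<lambda>r1 r2. sw B (\<lambda>a1 a2. sw B (\<lambda>n1 n2.
        ?s (\<alpha> (x2 * m1) * (\<mu>1 (Sinv (x3 * (r1 * a1) * ?S n2)) * \<mu>2 x1))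
          (r2 * a2 * ?S n1)) n) a) m2) z) x') x"
  proof (rule sw_cong, rule sw_cong, rule sw_cong)
    fix x1 x2 x3 m1 m2
    let ?h = "\<lambda>w. ?s (\<mu>2 x1) (?s (\<alpha> (x2 * m1)) w)"
    have lh: "lin ?s ?s ?h" by (rule r)+
    have "sw B (?G x3) (m2 * a) = sw B (\<lambda>r1 r2. sw B (\<lambda>a1 a2. ?G x3 (r1 * a1) (r2 * a2)) a) m2"
      by (rule sw_mult[OF vector_space]) (rule r)+
    then have "?h (sw B (?G x3) (m2 * a)) = ?h (sw B (\<lambda>r1 r2. sw B (\<lambda>a1 a2. ?G x3 (r1 * a1) (r2 * a2)) a) m2)"
      by (rule arg_cong)
    also have "\<dots> = sw B (\<lambda>r1 r2. ?h (sw B (\<lambda>a1 a2. ?G x3 (r1 * a1) (r2 * a2)) a)) m2"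
      by (rule B_comm[OF lh]) (rule r)+
    also have "\<dots> = sw B (\<lambda>r1 r2. sw B (\<lambda>a1 a2. ?h (?G x3 (r1 * a1) (r2 * a2))) a) m2"
      by (rule sw_cong, rule B_comm[OF lh]) (rule r)+
    also have "\<dots> = sw B (\<lambda>r1 r2. sw B (\<lambda>a1 a2. sw B (\<lambda>n1 n2.
        ?h (?s (\<mu>1 (Sinv (x3 * (r1 * a1) * ?S n2))) (r2 * a2 * ?S n1))) n) a) m2"
      by (rule sw_cong, rule sw_cong, rule B_comm[OF lh]) (rule r)+
    finally show "?h (sw B (?G x3) (m2 * a)) =
      sw B (\<lambda>r1 r2. sw B (\<lambda>a1 a2. sw B (\<lambda>n1 n2.
        ?s (\<alpha> (x2 * m1) * (\<mu>1 (Sinv (x3 * (r1 * a1) * ?S n2)) * \<mu>2 x1))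
          (r2 * a2 * ?S n1)) n) a) m2"
      by (simp only: scale_scale mult_ac)
  qed
  finally show ?thesis .
qed

text \<open>In each evaluated summand the dual components occur only as the product of \<mu>1 at one
  element and \<mu>2 at x1, so summing over them yields \<mu> at the product of the two
  arguments.\<close>

lemma ev_heis_conjugation:
  assumes \<mu>: "\<mu> \<in> hdual B" and \<alpha>: "\<alpha> \<in> hdual B"
  shows "ev x (dsw B (\<lambda>\<mu>1 \<mu>2. sw B (\<lambda>m1 m2.
      (\<mu>2 \<otimes> m1) \<star> (\<alpha> \<otimes> a) \<star> s_map B (\<mu>1 \<otimes> m2)) m) \<mu>) =
    sw B (\<lambda>z n. sw B (\<lambda>x' x3. sw B (\<lambda>x1 x2. sw B (\<lambda>m1 m2.
      sw B (\<lambda>r1 r2. sw B (\<lambda>a1 a2. sw B (\<lambda>n1 n2.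
        hscale B (\<alpha> (x2 * m1) * \<mu> (Sinv (x3 * (r1 * a1) * antipode B n2) * x1))
          (r2 * a2 * antipode B n1)) n) a) m2) z) x') x) m"
proof -
  let ?S = "antipode B" and ?s = "hscale B"
  \<comment> \<open>A functional of the form F: at (x, y) \<mapsto> \<mu>1(x) \<mu>2(y) it is the
    evaluated summand, at (x, y) \<mapsto> \<mu>(xy) the result.\<close>
  let ?L = "\<lambda>F. sw B (\<lambda>z n. sw B (\<lambda>x' x3. sw B (\<lambda>x1 x2. sw B (\<lambda>m1 m2.
      sw B (\<lambda>r1 r2. sw B (\<lambda>a1 a2. sw B (\<lambda>n1 n2.
        ?s (\<alpha> (x2 * m1) * form_at F (Sinv (x3 * (r1 * a1) * antipode B n2)) x1)
          (r2 * a2 * antipode B n1)) n) a) m2) z) x') x) m"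
  note d = double_rules lin_on_s_map s_map_closed \<alpha> \<mu>
  have "ev x (dsw B (\<lambda>\<mu>1 \<mu>2. sw B (\<lambda>m1 m2.
      (\<mu>2 \<otimes> m1) \<star> (\<alpha> \<otimes> a) \<star> s_map B (\<mu>1 \<otimes> m2)) m) \<mu>) =
    dsw B (\<lambda>\<mu>1 \<mu>2. ev x (sw B (\<lambda>m1 m2.
      (\<mu>2 \<otimes> m1) \<star> (\<alpha> \<otimes> a) \<star> s_map B (\<mu>1 \<otimes> m2)) m)) \<mu>"
    by (rule ev_dsw) (assumption | rule d)+
  also have "\<dots> = dsw B (\<lambda>\<mu>1 \<mu>2. sw B (\<lambda>m1 m2. ev x (
      (\<mu>2 \<otimes> m1) \<star> (\<alpha> \<otimes> a) \<star> s_map B (\<mu>1 \<otimes> m2))) m) \<mu>"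
    by (rule dsw_cong, rule ev_sw) (assumption | rule d)+
  also have "\<dots> = dsw B (\<lambda>\<mu>1 \<mu>2. ?L (\<lambda>(x, y). \<mu>1 x * \<mu>2 y)) \<mu>"
    unfolding form_at_case by (rule dsw_cong) (simp only: ev_heis_product \<alpha>)
  also have "\<dots> = ?L (\<lambda>(x, y). \<mu> (x * y))"
    by (rule dsw_functional[OF vector_space _ \<mu>])
      (assumption | rule lin_rules lin_on_Sinv lin_on_form_at_left lin_on_form_at_right
        lin_on_form_at subspace_bilinear_forms lin_on_hdual[OF \<alpha>])+
  finally show ?thesis unfolding form_at_case .
qed

text \<open>The two products in the dual split x, and the right action of the dual splits b. The
  scalars are collected in the order \<mu>1, \<mu>2, \<mu>3, in which their arguments will be
  multiplied.\<close>

lemma ev_drin_act_summand: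
  assumes \<mu>: "\<mu>1 \<in> hdual B" "\<mu>2 \<in> hdual B" "\<mu>3 \<in> hdual B" and \<alpha>: "\<alpha> \<in> hdual B"
  shows "ev x ((\<mu>3 \<cdot> (m \<rightharpoonup> \<alpha>) \<cdot> dantipode_inv B \<mu>2) \<otimes> (b \<leftharpoondown> dantipode_inv B \<mu>1)) =
    sw B (\<lambda>x' x3. sw B (\<lambda>x1 x2. sw B (\<lambda>y1 y2. hscale B (\<alpha> (x2 * m) *
      (\<mu>1 (Sinv y1) * \<mu>2 (Sinv x3) * \<mu>3 x1)) y2) b) x') x"
proof -
  let ?s = "hscale B" and ?w = "b \<leftharpoondown> dantipode_inv B \<mu>1"
  note r = lin_rules lin_on_Sinv lin_on_hdual[OF \<mu>(1)] lin_on_hdual[OF \<mu>(2)]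
    lin_on_hdual[OF \<mu>(3)] lin_on_hdual[OF \<alpha>]
  have h: "dantipode_inv B \<mu>2 \<in> hdual B" "m \<rightharpoonup> \<alpha> \<in> hdual B" "\<mu>3 \<cdot> (m \<rightharpoonup> \<alpha>) \<in> hdual B"
    using \<mu> \<alpha> by (simp_all add: hdual_dantipode_inv hdual_lact hdual_dmult)
  have "ev x ((\<mu>3 \<cdot> (m \<rightharpoonup> \<alpha>) \<cdot> dantipode_inv B \<mu>2) \<otimes> ?w) =
    sw B (\<lambda>x' x3. sw B (\<lambda>x1 x2. ?s (\<mu>3 x1) (?s (\<alpha> (x2 * m)) (?s (\<mu>2 (Sinv x3)) ?w))) x') x"
    unfolding ev_dtens[OF hdual_dmult[OF h(3,1)]] scale_dmult[OF h(3,1)] scale_dmult[OF \<mu>(3) h(2)]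
    unfolding lact_eq[OF \<alpha>] dantipode_inv_eq[OF \<mu>(2)] ..
  also have "\<dots> = sw B (\<lambda>x' x3. sw B (\<lambda>x1 x2. sw B (\<lambda>y1 y2.
      ?s (\<mu>3 x1) (?s (\<alpha> (x2 * m)) (?s (\<mu>2 (Sinv x3)) (?s (\<mu>1 (Sinv y1)) y2)))) b) x') x"
    unfolding bact_def dantipode_inv_eq[OF \<mu>(1)]
    by (rule sw_cong, rule sw_cong, rule sw_comm[OF vector_space subspace_UNIV_B vector_space _ _ UNIV_I])
      (rule r)+
  finally show ?thesis by (simp only: scale_scale mult_ac)
qed

lemma ev_drin_act:
  assumes \<mu>: "\<mu> \<in> hdual B" and \<alpha>: "\<alpha> \<in> hdual B"
  shows "ev x ((\<mu> \<otimes> m) \<triangleright> (\<alpha> \<otimes> a)) =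
    sw B (\<lambda>z n. sw B (\<lambda>m1 m2. sw B (\<lambda>x' x3. sw B (\<lambda>x1 x2. sw B (\<lambda>y1 y2.
      hscale B (\<alpha> (x2 * m1) * \<mu> (Sinv y1 * Sinv x3 * x1)) y2)
      (m2 * a * antipode B n)) x') x) z) m"
proof -
  let ?S = "antipode B" and ?s = "hscale B"
  let ?T = "\<lambda>\<mu>1 \<mu>2 \<mu>3 m1 m2 m3. (\<mu>3 \<cdot> (m1 \<rightharpoonup> \<alpha>) \<cdot> dantipode_inv B \<mu>2) \<otimes>
     ((m2 * a * ?S m3) \<leftharpoondown> dantipode_inv B \<mu>1)"
  \<comment> \<open>\<open>?E\<close> takes an arbitrary function of the three dual arguments, so
    that the expressions before, between and after the two eliminations are instances of one
    term.\<close>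
  let ?E = "\<lambda>\<phi>. sw B (\<lambda>z n. sw B (\<lambda>m1 m2. sw B (\<lambda>x' x3. sw B (\<lambda>x1 x2. sw B (\<lambda>y1 y2.
      ?s (\<alpha> (x2 * m1) * \<phi> (Sinv y1) (Sinv x3) x1) y2) (m2 * a * ?S n)) x') x) z) m"
  note d = double_rules \<alpha> \<mu>
  note lr = lin_rules lin_on_Sinv lin_on_form_at_left lin_on_form_at_right
        lin_on_form_at subspace_bilinear_forms lin_on_hdual[OF \<alpha>]
  have "ev x ((\<mu> \<otimes> m) \<triangleright> (\<alpha> \<otimes> a)) = dsw B (\<lambda>\<zeta> \<mu>3. ev x (dsw B (\<lambda>\<mu>1 \<mu>2.
      sw B (\<lambda>z m3. sw B (\<lambda>m1 m2. ?T \<mu>1 \<mu>2 \<mu>3 m1 m2 m3) z) m) \<zeta>)) \<mu>"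
    unfolding drin_act_dtens[OF \<mu> \<alpha>] dsw3_def sw3_def
    by (rule ev_dsw) (assumption | rule d)+
  also have "\<dots> = dsw B (\<lambda>\<zeta> \<mu>3. dsw B (\<lambda>\<mu>1 \<mu>2. ev x (
      sw B (\<lambda>z m3. sw B (\<lambda>m1 m2. ?T \<mu>1 \<mu>2 \<mu>3 m1 m2 m3) z) m)) \<zeta>) \<mu>"
    by (rule dsw_cong, rule ev_dsw) (assumption | rule d)+
  also have "\<dots> = dsw B (\<lambda>\<zeta> \<mu>3. dsw B (\<lambda>\<mu>1 \<mu>2. ?E (\<lambda>p q r. \<mu>1 p * \<mu>2 q * \<mu>3 r)) \<zeta>) \<mu>"
  proof (rule dsw_cong, rule dsw_cong)
    fix \<mu>1 \<mu>2 \<mu>3 assume h: "\<mu>1 \<in> hdual B" "\<mu>2 \<in> hdual B" "\<mu>3 \<in> hdual B"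
    have "ev x (sw B (\<lambda>z m3. sw B (\<lambda>m1 m2. ?T \<mu>1 \<mu>2 \<mu>3 m1 m2 m3) z) m) =
        sw B (\<lambda>z m3. ev x (sw B (\<lambda>m1 m2. ?T \<mu>1 \<mu>2 \<mu>3 m1 m2 m3) z)) m"
      by (rule ev_sw) (assumption | rule d h)+
    also have "\<dots> = sw B (\<lambda>z m3. sw B (\<lambda>m1 m2. ev x (?T \<mu>1 \<mu>2 \<mu>3 m1 m2 m3)) z) m"
      by (rule sw_cong, rule ev_sw) (assumption | rule d h)+
    finally show "ev x (sw B (\<lambda>z m3. sw B (\<lambda>m1 m2. ?T \<mu>1 \<mu>2 \<mu>3 m1 m2 m3) z) m) =
        ?E (\<lambda>p q r. \<mu>1 p * \<mu>2 q * \<mu>3 r)"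
      by (simp only: ev_drin_act_summand[OF h \<alpha>])
  qed
  also have "\<dots> = dsw B (\<lambda>\<zeta> \<mu>3. ?E (\<lambda>p q r. \<zeta> (p * q) * \<mu>3 r)) \<mu>"
  proof (rule dsw_cong)
    fix \<zeta> \<mu>3 assume h: "\<zeta> \<in> hdual B" "\<mu>3 \<in> hdual B"
    have "dsw B (\<lambda>\<mu>1 \<mu>2. ?E (\<lambda>p q r. form_at (\<lambda>(x, y). \<mu>1 x * \<mu>2 y) p q * \<mu>3 r)) \<zeta> =
        ?E (\<lambda>p q r. form_at (\<lambda>(x, y). \<zeta> (x * y)) p q * \<mu>3 r)"
      by (rule dsw_functional[OF vector_space _ h(1)])
        (assumption | rule lr lin_on_hdual[OF h(2)])+
    then show "dsw B (\<lambda>\<mu>1 \<mu>2. ?E (\<lambda>p q r. \<mu>1 p * \<mu>2 q * \<mu>3 r)) \<zeta> = ?E (\<lambda>p q r. \<zeta> (p * q) * \<mu>3 r)"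
      unfolding form_at_case .
  qed
  \<comment> \<open>The product p q now counts as a single argument, which exposes a bilinear form
    at (p q, r) for the outer coproduct.\<close>
  also have "\<dots> = dsw B (\<lambda>\<zeta> \<mu>3. ?E (\<lambda>p q r. form_at (\<lambda>(x, y). \<zeta> x * \<mu>3 y) (p * q) r)) \<mu>"
    unfolding form_at_case ..
  also have "\<dots> = ?E (\<lambda>p q r. form_at (\<lambda>(x, y). \<mu> (x * y)) (p * q) r)"
    by (rule dsw_functional[OF vector_space _ \<mu>]) (assumption | rule lr)+
  finally show ?thesis unfolding form_at_case .
qed

text \<open>Evaluated at x, both sides are the same sevenfold Sweedler sum up to the order of
  independent splittings. On the action side the coproduct of m'' a S(m''') is opened by
  \<open>sw_conjugate\<close>; on the other side \<open>Sinv_mult\<close> separates S^-1(x''') from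
  the rest.\<close>

lemma drin_act_dtens_eq_conjugation:
  assumes \<mu>: "\<mu> \<in> hdual B" and \<alpha>: "\<alpha> \<in> hdual B"
  shows "(\<mu> \<otimes> m) \<triangleright> (\<alpha> \<otimes> a) = dsw B (\<lambda>\<mu>1 \<mu>2. sw B (\<lambda>m1 m2.
    (\<mu>2 \<otimes> m1) \<star> (\<alpha> \<otimes> a) \<star> s_map B (\<mu>1 \<otimes> m2)) m) \<mu>"
proof (rule dbl_eqI)
  let ?S = "antipode B" and ?s = "hscale B"
  note r = lin_rules lin_on_Sinv lin_on_hdual[OF \<mu>] lin_on_hdual[OF \<alpha>]
  show "(\<mu> \<otimes> m) \<triangleright> (\<alpha> \<otimes> a) \<in> dbl B" by (intro drin_act_closed dtens_in_dbl \<mu> \<alpha>)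
  show "dsw B (\<lambda>\<mu>1 \<mu>2. sw B (\<lambda>m1 m2.
      (\<mu>2 \<otimes> m1) \<star> (\<alpha> \<otimes> a) \<star> s_map B (\<mu>1 \<otimes> m2)) m) \<mu> \<in> dbl B"
    by (assumption | rule double_rules lin_on_s_map s_map_closed \<alpha> \<mu>)+
  fix x
  let ?Q = "\<lambda>x1 x2 x3 m1 r1 r2 a1 a2 n1 n2. ?s (\<alpha> (x2 * m1) *
     \<mu> (Sinv (r1 * a1 * ?S n2) * Sinv x3 * x1)) (r2 * a2 * ?S n1)"
  let ?R = "\<lambda>x1 x2 x3 m1 m2 n. sw B (\<lambda>r1 r2. sw B (\<lambda>a1 a2. sw B (\<lambda>n1 n2.
      ?Q x1 x2 x3 m1 r1 r2 a1 a2 n1 n2) n) a) m2"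
  have "ev x ((\<mu> \<otimes> m) \<triangleright> (\<alpha> \<otimes> a)) =
    sw B (\<lambda>z n. sw B (\<lambda>m1 m2. sw B (\<lambda>x' x3. sw B (\<lambda>x1 x2. sw B (\<lambda>y1 y2.
      ?s (\<alpha> (x2 * m1) * \<mu> (Sinv y1 * Sinv x3 * x1)) y2)
      (m2 * a * ?S n)) x') x) z) m"
    by (rule ev_drin_act[OF \<mu> \<alpha>])
  also have "\<dots> = sw B (\<lambda>z n. sw B (\<lambda>m1 m2. sw B (\<lambda>x' x3. sw B (\<lambda>x1 x2.
      ?R x1 x2 x3 m1 m2 n) x') x) z) m"
    by (rule sw_cong, rule sw_cong, rule sw_cong, rule sw_cong, rule sw_conjugate[OF vector_space])
      (rule r)+
  \<comment> \<open>The splitting of z is independent of those of x and is moved inside them by two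
    interchanges.\<close>
  also have "\<dots> = sw B (\<lambda>z n. sw B (\<lambda>x' x3. sw B (\<lambda>m1 m2. sw B (\<lambda>x1 x2.
      ?R x1 x2 x3 m1 m2 n) x') z) x) m"
    by (rule sw_cong, rule sw_swap) (rule r)+
  also have "\<dots> = sw B (\<lambda>z n. sw B (\<lambda>x' x3. sw B (\<lambda>x1 x2. sw B (\<lambda>m1 m2.
      ?R x1 x2 x3 m1 m2 n) z) x') x) m"
    by (rule sw_cong, rule sw_cong, rule sw_swap) (rule r)+
  also have "\<dots> = ev x (dsw B (\<lambda>\<mu>1 \<mu>2. sw B (\<lambda>m1 m2.
      (\<mu>2 \<otimes> m1) \<star> (\<alpha> \<otimes> a) \<star> s_map B (\<mu>1 \<otimes> m2)) m) \<mu>)"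
    unfolding ev_heis_conjugation[OF \<mu> \<alpha>] by (simp only: Sinv_mult mult.assoc)
  finally show "ev x ((\<mu> \<otimes> m) \<triangleright> (\<alpha> \<otimes> a)) = \<dots>" .
qed

lemma heis_conjugation_bilinear:
  "A \<in> dbl B \<Longrightarrow> ddbil fscale (\<lambda>M1 M2. M1 \<star> A \<star> s_map B M2)"
  by (assumption | rule double_rules lin_on_s_map s_map_closed)+

text \<open>Both sides are linear in M and in A, hence determined by pure tensors, where
  \<open>drin_sw_dtens\<close> turns the right-hand side into the explicit sum already
  computed.\<close>

lemma drin_act_eq_conjugation:
  assumes "M \<in> dbl B" "A \<in> dbl B"
  shows "M \<triangleright> A = drin_sw B (\<lambda>M1 M2. M1 \<star> A \<star> s_map B M2) M"
proof (rule dbl_ext[OF vector_space_fscale _ _ _ assms(1)])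
  show "lin_on fscale fscale (dbl B) (\<lambda>M. M \<triangleright> A)"
    by (assumption | rule lin_on_drin_act_left lin_on_id assms(2))+
  show "lin_on fscale fscale (dbl B) (drin_sw B (\<lambda>M1 M2. M1 \<star> A \<star> s_map B M2))"
    by (assumption | rule lin_on_drin_sw vector_space_fscale heis_conjugation_bilinear assms(2) lin_on_id)+
  fix \<mu> m assume \<mu>: "\<mu> \<in> hdual B"
  note M = dtens_in_dbl[OF \<mu>]
  show "(\<mu> \<otimes> m) \<triangleright> A = drin_sw B (\<lambda>M1 M2. M1 \<star> A \<star> s_map B M2) (\<mu> \<otimes> m)"
  proof (rule dbl_ext[OF vector_space_fscale _ _ _ assms(2)])
    show "lin_on fscale fscale (dbl B) (\<lambda>A. (\<mu> \<otimes> m) \<triangleright> A)"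
      by (assumption | rule lin_on_drin_act_right lin_on_id M)+
    show "lin_on fscale fscale (dbl B) (\<lambda>A. drin_sw B (\<lambda>M1 M2. M1 \<star> A \<star> s_map B M2) (\<mu> \<otimes> m))"
      by (assumption | rule double_rules lin_on_s_map s_map_closed M)+
    fix \<alpha> a assume \<alpha>: "\<alpha> \<in> hdual B"
    show "(\<mu> \<otimes> m) \<triangleright> (\<alpha> \<otimes> a) =
        drin_sw B (\<lambda>M1 M2. M1 \<star> (\<alpha> \<otimes> a) \<star> s_map B M2) (\<mu> \<otimes> m)"
      unfolding drin_act_dtens_eq_conjugation[OF \<mu> \<alpha>]
      by (rule drin_sw_dtens[OF vector_space_fscale
            heis_conjugation_bilinear[OF dtens_in_dbl[OF \<alpha>]] \<mu>, symmetric])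
  qed
qed

end

theorem mainTheorem7:
  fixes B :: "('k::field, 'b::ring_1) hopf" (structure)
  assumes "hopf_algebra B" and "bij (antipode B)"
  shows "(\<forall>\<mu>\<in>hdual B. \<forall>m.
            s_map B (\<mu> \<otimes> m) = (counit B \<otimes> antipode B m) \<star> (dantipode_inv B \<mu> \<otimes> 1) \<and>
            s_map B (\<mu> \<otimes> m) =
              sw B (\<lambda>m1 m2. (antipode B m2 \<rightharpoonup> dantipode_inv B \<mu>) \<otimes> antipode B m1) m) \<and>
         (\<forall>M\<in>dbl B. \<forall>A\<in>dbl B. M \<triangleright> A = drin_sw B (\<lambda>M1 M2. M1 \<star> A \<star> s_map B M2) M) \<and>
         (\<forall>\<mu>\<in>hdual B. \<forall>\<alpha>\<in>hdual B. \<forall>m a.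
            (\<mu> \<otimes> m) \<triangleright> (\<alpha> \<otimes> a) =
              dsw B (\<lambda>\<mu>1 \<mu>2. sw B (\<lambda>m1 m2.
                (\<mu>2 \<otimes> m1) \<star> (\<alpha> \<otimes> a) \<star> s_map B (\<mu>1 \<otimes> m2)) m) \<mu>)"
proof -
  interpret hopf_algebra_bij_antipode B
    using assms by (intro hopf_algebra_bij_antipode.intro hopf_algebra_bij_antipode_axioms.intro)
  show ?thesis
    by (simp add: heis_mult_antipodes s_map_dtens drin_act_eq_conjugation drin_act_dtens_eq_conjugation)
qed

end
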